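(* Let $\widetilde{\mathscr P}=(\widetilde{\mathscr P}(n))_{n\ge 0}$ be a conformal pseudo operad over a field $\mathbb F$ of characteristic $0$, let $\widetilde W_n=\widetilde{\mathscr P}(n+1)^{S_{n+1}}$ for $n\ge -1$, $\widetilde W=\bigoplus_{n\ge -1}\widetilde W_n$, and for $f\in\widetilde{\mathscr P}(n+1)$, $g\in\widetilde{\mathscr P}(m+1)$ let $$f\,\Box_\lambda\, g=\sum_{\sigma\in S_{m+1,n}}\big(f\circ^1_{-\lambda-\partial}g\big)^{\sigma^{-1}}\in\widetilde{\mathscr P}(m+n+1)[\lambda].$$ Then: (a) $(\partial f)\Box_\lambda g=-\lambda\, f\Box_\lambda g$ and $f\Box_\lambda(\partial g)=(\lambda+\partial)(f\Box_\lambda g)$. (b) Define the associator $(f_\lambda g_\mu h)=(f\Box_\lambda g)\Box_{\lambda+\mu}h-f\Box_\lambda(g\Box_\mu h)$. For $f\in\widetilde W_n$ (and $g\in\widetilde{\mathscr P}(m+1)$, $h\in\widetilde{\mathscr P}(\ell+1)$) one has $$(f_\lambda g_\mu h)=(-1)^{p(g)p(h)}(f_\lambda h_{-\lambda-\mu-\partial}g),$$ where on the right-hand side $\partial$ is moved to the left and acts on all coefficients. (c) For $f\in\widetilde W_n$ and $g\in\widetilde W_m$ we have $f\Box_\lambda g\in\widetilde W_{n+m}[\lambda]$. (d) Consequently, $\widetilde W$ is a $\mathbb Z_{\ge -1}$-graded Lie conformal superalgebra with $\lambda$-bracket given, for $f\in\widetilde W_n$, $g\in\widetilde W_m$, by $$[f_\lambda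 g]=f\Box_\lambda g-(-1)^{p(f)p(g)}\,g\Box_{-\lambda-\partial}f.$$
   Context: Vector superspaces are $\mathbb Z/2$-graded vector spaces over $\mathbb F$; $p$ denotes parity. $S_0$ is the trivial group. Permutations: $\sigma\in S_n$ acts on tensor products of superspaces by $\sigma(v_1\otimes\cdots\otimes v_n)=\epsilon_v(\sigma)\,v_{\sigma^{-1}(1)}\otimes\cdots\otimes v_{\sigma^{-1}(n)}$, $\epsilon_v(\sigma)=\prod_{i<j,\ \sigma(i)>\sigma(j)}(-1)^{p(v_i)p(v_j)}$. For $\sigma\in S_n$, $\tau\in S_m$, $1\le i\le n$, $\sigma\circ_i\tau\in S_{n+m-1}$ is the permutation acting on $v_1\otimes\cdots\otimes v_{n+m-1}$ by first applying $\tau$ to $v_i\otimes\cdots\otimes v_{i+m-1}$ and then applying $\sigma$ to the result, viewed as a tensor product of $n$ factors (the $i$-th factor being the block of length $m$). $S_{m,n}\subset S_{m+n}$ is the set of $(m,n)$-shuffles: $\sigma(1)<\dots<\sigma(m)$, $\sigma(m+1)<\dots<\sigma(m+n)$; $S_{n,0}=S_{0,n}=\{1\}$, and $S_{m,n}=\emptyset$ if $m<0$ or $n<0$. A conformal pseudo operad $\widetilde{\mathscr P}$ is a collection of vector superspaces $\widetilde{\mathscr P}(n)$, $n\ge0$, each with an even endomorphism $\partial$, with a linear parity preserving right action of $S_n$ (denoted $f\mapsto f^\sigma$) commuting with $\partial$, and with parity preserving bilinear products $\circ^i_\lambda:\widetilde{\mathscr P}(n)\times\widetilde{\mathscr P}(m)\to\widetilde{\mathscr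 P}(n+m-1)[\lambda]$, $i=1,\dots,n$, such that for $f\in\widetilde{\mathscr P}(n)$, $g\in\widetilde{\mathscr P}(m)$, $h\in\widetilde{\mathscr P}(\ell)$, $\sigma\in S_n$, $\tau\in S_m$: - sesquilinearity: $(\partial f)\circ^i_\lambda g=(\lambda+\partial)(f\circ^i_\lambda g)$, $f\circ^i_\lambda(\partial g)=-\lambda f\circ^i_\lambda g$; - associativity: $(f\circ^i_\lambda g)\circ^j_\mu h=(-1)^{p(g)p(h)}(f\circ^j_\mu h)\circ^{\ell+i-1}_\lambda g$ if $1\le j<i$; $(f\circ^i_\lambda g)\circ^j_\mu h=f\circ^i_{\lambda+\mu}(g\circ^{j-i+1}_\mu h)$ if $i\le j<i+m$; - equivariance: $f^\sigma\circ^i_\lambda g^\tau=(f\circ^{\sigma(i)}_\lambda g)^{\sigma\circ_i\tau}$. When $\lambda$ is replaced by $-\lambda-\partial$ in a polynomial in $\lambda$, $\partial$ is moved to the left and applied to the coefficients. A Lie conformal superalgebra is a vector superspace $R$ with an even endomorphism $\partial$ and a parity preserving bilinear map $[\cdot_\lambda\cdot]:R\times R\to R[\lambda]$ with $[\partial a_\lambda b]=-\lambda[a_\lambda b]$, $[a_\lambda\partial b]=(\lambda+\partial)[a_\lambda b]$, $[a_\lambda b]=-(-1)^{p(a)p(b)}[b_{-\lambda-\partial}a]$, $[a_\lambda[b_\mu c]]-(-1)^{p(a)p(b)}[b_\mu[a_\lambda b]']=[[a_\lambda b]_{\lambda+\mu}c]$, where $[b_\mu[a_\lambda b]']$ denotes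 $[b_\mu[a_\lambda c]]$. Graded means $R=\bigoplus R_n$ with $\partial R_n\subset R_n$ and $[R_n{}_\lambda R_m]\subset R_{n+m}[\lambda]$. *)

theory Defs
  imports
    "HOL-Computational_Algebra.Polynomial"
    "HOL-Combinatorics.Permutations"
    "HOL-Library.Poly_Mapping"
    "HOL-Library.Z2"
begin

section \<open>Superspaces\<close>

text \<open>
  Vector spaces are subspaces of an ambient space over the field acting through \<open>scale\<close>. A superspace
  is the family of its two homogeneous parts, indexed by the parities \<open>0, 1 :: bit\<close>; the
  underlying vector space is their sum \<open>whole V\<close>.
\<close>

definition superspace :: "('f::field \<Rightarrow> 'v::ab_group_add \<Rightarrow> 'v) \<Rightarrow> (bit \<Rightarrow> 'v set) \<Rightarrow> bool" where
  "superspace scale V \<longleftrightarrow>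
     vector_space scale \<and> (\<forall>p. module.subspace scale (V p)) \<and> V 0 \<inter> V 1 = {0}"

definition whole :: "(bit \<Rightarrow> 'v::ab_group_add set) \<Rightarrow> 'v set" where
  "whole V = {x + y | x y. x \<in> V 0 \<and> y \<in> V 1}"

text \<open>\<open>koszul p q x\<close> is $(-1)^{pq} x$.\<close>

definition koszul :: "bit \<Rightarrow> bit \<Rightarrow> 'a::ab_group_add \<Rightarrow> 'a" where
  "koszul p q x = (if p = 1 \<and> q = 1 then - x else x)"

text \<open>The space $S[\lambda]$ of polynomials with coefficients in \<open>S\<close>.\<close>

definition polys :: "'v::zero set \<Rightarrow> 'v poly set" where
  "polys S = {q. \<forall>k. coeff q k \<in> S}"

definition even_endo ::
  "('f::field \<Rightarrow> 'v::ab_group_add \<Rightarrow> 'v) \<Rightarrow> (bit \<Rightarrow> 'v set) \<Rightarrow> ('v \<Rightarrow> 'v) \<Rightarrow> bool" where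
  "even_endo scale V T \<longleftrightarrow>
     (\<forall>x\<in>whole V. \<forall>y\<in>whole V. T (x + y) = T x + T y) \<and>
     (\<forall>c. \<forall>x\<in>whole V. T (scale c x) = scale c (T x)) \<and>
     (\<forall>p. \<forall>x\<in>V p. T x \<in> V p)"

text \<open>Parity preserving bilinear maps $U \times V \to W[\lambda]$.\<close>

definition even_bilinear ::
  "('f::field \<Rightarrow> 'v::ab_group_add \<Rightarrow> 'v) \<Rightarrow> (bit \<Rightarrow> 'v set) \<Rightarrow> (bit \<Rightarrow> 'v set) \<Rightarrow> (bit \<Rightarrow> 'v set) \<Rightarrow>
     ('v \<Rightarrow> 'v \<Rightarrow> 'v poly) \<Rightarrow> bool" where
  "even_bilinear scale U V W B \<longleftrightarrow>
     (\<forall>x\<in>whole U. \<forall>x'\<in>whole U. \<forall>y\<in>whole V. B (x + x') y = B x y + B x' y) \<and>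
     (\<forall>x\<in>whole U. \<forall>y\<in>whole V. \<forall>y'\<in>whole V. B x (y + y') = B x y + B x y') \<and>
     (\<forall>c. \<forall>x\<in>whole U. \<forall>y\<in>whole V. B (scale c x) y = map_poly (scale c) (B x y)) \<and>
     (\<forall>c. \<forall>x\<in>whole U. \<forall>y\<in>whole V. B x (scale c y) = map_poly (scale c) (B x y)) \<and>
     (\<forall>p q. \<forall>x\<in>U p. \<forall>y\<in>V q. B x y \<in> polys (W (p + q)))"

section \<open>Polynomials in one and two variables\<close>

text \<open>
  \<open>psubst A F\<close> sends $\sum_k \lambda^k c_k$ to $\sum_k A^k (F\,c_k)$, i.e. it applies \<open>F\<close> to the
  coefficients and replaces the variable by the operator \<open>A\<close>, which stands to the left of the
  coefficients.
\<close>

definition psubst :: "('b \<Rightarrow> 'b) \<Rightarrow> ('a::zero \<Rightarrow> 'b) \<Rightarrow> 'a poly \<Rightarrow> 'b::comm_monoid_add" where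
  "psubst A F q = (\<Sum>k\<le>degree q. (A ^^ k) (F (coeff q k)))"

text \<open>Replacing $\lambda$ by $-\lambda-\partial$ in $q(\lambda)$, where \<open>d\<close> is $\partial$.\<close>

definition subst_neg :: "('v \<Rightarrow> 'v) \<Rightarrow> 'v::ab_group_add poly \<Rightarrow> 'v poly" where
  "subst_neg d q = psubst (\<lambda>x. - pCons 0 x - map_poly d x) (\<lambda>c. [:c:]) q"

text \<open>
  An element of $V[\lambda,\mu]$ is a polynomial in $\lambda$ (outer variable) whose coefficients are
  polynomials in $\mu$ (inner variable). The operators below are the multiplications by
  $\lambda$, $\mu$, $\lambda+\mu$ and the operator $-\lambda-\mu-\partial$; they commute.
\<close>

definition mlam :: "'v::zero poly poly \<Rightarrow> 'v poly poly" where
  "mlam x = pCons 0 x"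

definition mmu :: "'v::zero poly poly \<Rightarrow> 'v poly poly" where
  "mmu x = map_poly (pCons 0) x"

definition mlammu :: "'v::ab_group_add poly poly \<Rightarrow> 'v poly poly" where
  "mlammu x = mlam x + mmu x"

definition mneg :: "('v \<Rightarrow> 'v) \<Rightarrow> 'v::ab_group_add poly poly \<Rightarrow> 'v poly poly" where
  "mneg d x = - mlam x - mmu x - map_poly (map_poly d) x"

text \<open>
  \<open>var_to A q\<close> is $q \in V[\lambda]$ with its variable replaced by the operator \<open>A\<close> on
  $V[\lambda,\mu]$. Thus, for a $\lambda$-product \<open>B\<close>, \<open>psubst mlam (\<lambda>c. var_to mmu (B c h)) (B f g)\<close>
  is $(f_\lambda g)_\mu h$.
\<close>

definition var_to :: "('v poly poly \<Rightarrow> 'v poly poly) \<Rightarrow> 'v::ab_group_add poly \<Rightarrow> 'v poly poly" where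
  "var_to A q = psubst A (\<lambda>c. [:[:c:]:]) q"

section \<open>Permutations\<close>

text \<open>$S_n$ consists of the \<open>\<sigma>\<close> with \<open>\<sigma> permutes {1..n}\<close>, multiplied by composition.\<close>

text \<open>
  $v_1 \otimes \dots \otimes v_{n+m-1}$ is viewed as a tensor product of \<open>n\<close> factors, the \<open>i\<close>-th being
  the block $v_i \otimes \dots \otimes v_{i+m-1}$; \<open>factor_of m i k\<close> is the factor containing $v_k$.
\<close>

definition factor_of :: "nat \<Rightarrow> nat \<Rightarrow> nat \<Rightarrow> nat" where
  "factor_of m i k = (if k < i then k else if k < i + m then i else k + 1 - m)"

text \<open>
  The permutation $\sigma \circ_i \tau$. Since $\sigma$ moves the \<open>j\<close>-th factor to
  place $\sigma(j)$, the vector $v_k$ in factor \<open>j\<close> is finally preceded by all factors \<open>b\<close> with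
  $\sigma(b) < \sigma(j)$, which have length \<open>m\<close> for \<open>b = i\<close> and \<open>1\<close> otherwise;
  inside the block its place is given by $\tau$.
\<close>

definition perm_circ :: "nat \<Rightarrow> nat \<Rightarrow> nat \<Rightarrow> (nat \<Rightarrow> nat) \<Rightarrow> (nat \<Rightarrow> nat) \<Rightarrow> nat \<Rightarrow> nat" where
  "perm_circ n m i \<sigma> \<tau> k =
     (if k \<in> {1..n + m - 1}
      then (let j = factor_of m i k in
        (\<Sum>b | b \<in> {1..n} \<and> \<sigma> b < \<sigma> j. if b = i then m else 1) + (if j = i then \<tau> (k + 1 - i) else 1))
      else k)"

text \<open>The $(m,n)$-shuffles $S_{m,n}$.\<close>

definition shuffle_perms :: "int \<Rightarrow> int \<Rightarrow> (nat \<Rightarrow> nat) set" where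
  "shuffle_perms m n =
     (if m < 0 \<or> n < 0 then {}
      else {\<sigma>. \<sigma> permutes {1..nat (m + n)} \<and> strict_mono_on {1..nat m} \<sigma> \<and>
               strict_mono_on {nat m + 1..nat (m + n)} \<sigma>})"

section \<open>Conformal pseudo operads\<close>

text \<open>
  \<open>P n\<close> is the superspace of arity \<open>n\<close>, \<open>d n\<close> its endomorphism $\partial$, \<open>act n \<sigma> f\<close> is
  $f^\sigma$, and \<open>circ n m i f g\<close> is $f \circ^i_\lambda g$ for \<open>f\<close>, \<open>g\<close> of arity \<open>n\<close>, \<open>m\<close>.
  As all operations carry the arities, the \<open>P n\<close> need not be independent in the ambient
  space; any family of superspaces is of this form inside its direct sum.
\<close>

locale conformal_pseudo_operad =
  fixes scale :: "'f::field \<Rightarrow> 'v::ab_group_add \<Rightarrow> 'v"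
    and P :: "nat \<Rightarrow> bit \<Rightarrow> 'v set"
    and d :: "nat \<Rightarrow> 'v \<Rightarrow> 'v"
    and act :: "nat \<Rightarrow> (nat \<Rightarrow> nat) \<Rightarrow> 'v \<Rightarrow> 'v"
    and circ :: "nat \<Rightarrow> nat \<Rightarrow> nat \<Rightarrow> 'v \<Rightarrow> 'v \<Rightarrow> 'v poly"
  assumes superspace: "\<And>n. superspace scale (P n)"
    and d_even: "\<And>n. even_endo scale (P n) (d n)"
    and act_even: "\<And>n \<sigma>. \<sigma> permutes {1..n} \<Longrightarrow> even_endo scale (P n) (act n \<sigma>)"
    and act_id: "\<And>n f. f \<in> whole (P n) \<Longrightarrow> act n id f = f"
    and act_comp: "\<And>n \<sigma> \<tau> f. \<sigma> permutes {1..n} \<Longrightarrow> \<tau> permutes {1..n} \<Longrightarrow> f \<in> whole (P n) \<Longrightarrow>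
        act n (\<sigma> \<circ> \<tau>) f = act n \<tau> (act n \<sigma> f)"
    and act_d: "\<And>n \<sigma> f. \<sigma> permutes {1..n} \<Longrightarrow> f \<in> whole (P n) \<Longrightarrow>
        act n \<sigma> (d n f) = d n (act n \<sigma> f)"
    and circ_bilinear: "\<And>n m i. i \<in> {1..n} \<Longrightarrow>
        even_bilinear scale (P n) (P m) (P (n + m - 1)) (circ n m i)"
    and sesqui_left: "\<And>n m i f g. i \<in> {1..n} \<Longrightarrow> f \<in> whole (P n) \<Longrightarrow> g \<in> whole (P m) \<Longrightarrow>
        circ n m i (d n f) g = pCons 0 (circ n m i f g) + map_poly (d (n + m - 1)) (circ n m i f g)"
    and sesqui_right: "\<And>n m i f g. i \<in> {1..n} \<Longrightarrow> f \<in> whole (P n) \<Longrightarrow> g \<in> whole (P m) \<Longrightarrow>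
        circ n m i f (d m g) = - pCons 0 (circ n m i f g)"
    and assoc_parallel: "\<And>n m l i j f g h q r.
        i \<in> {1..n} \<Longrightarrow> 1 \<le> j \<Longrightarrow> j < i \<Longrightarrow> f \<in> whole (P n) \<Longrightarrow> g \<in> P m q \<Longrightarrow> h \<in> P l r \<Longrightarrow>
        psubst mlam (\<lambda>c. var_to mmu (circ (n + m - 1) l j c h)) (circ n m i f g) =
        koszul q r (psubst mmu (\<lambda>c. var_to mlam (circ (n + l - 1) m (l + i - 1) c g)) (circ n l j f h))"
    and assoc_nested: "\<And>n m l i j f g h.
        i \<in> {1..n} \<Longrightarrow> i \<le> j \<Longrightarrow> j < i + m \<Longrightarrow>
        f \<in> whole (P n) \<Longrightarrow> g \<in> whole (P m) \<Longrightarrow> h \<in> whole (P l) \<Longrightarrow>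
        psubst mlam (\<lambda>c. var_to mmu (circ (n + m - 1) l j c h)) (circ n m i f g) =
        psubst mmu (\<lambda>c. var_to mlammu (circ n (m + l - 1) i f c)) (circ m l (j - i + 1) g h)"
    and equivariance: "\<And>n m i f g \<sigma> \<tau>.
        i \<in> {1..n} \<Longrightarrow> \<sigma> permutes {1..n} \<Longrightarrow> \<tau> permutes {1..m} \<Longrightarrow>
        f \<in> whole (P n) \<Longrightarrow> g \<in> whole (P m) \<Longrightarrow>
        circ n m i (act n \<sigma> f) (act m \<tau> g) =
        map_poly (act (n + m - 1) (perm_circ n m i \<sigma> \<tau>)) (circ n m (\<sigma> i) f g)"

section \<open>Lie conformal superalgebras\<close>

locale lie_conformal_superalgebra =
  fixes scale :: "'f::field \<Rightarrow> 'v::ab_group_add \<Rightarrow> 'v"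
    and R :: "bit \<Rightarrow> 'v set"
    and d :: "'v \<Rightarrow> 'v"
    and br :: "'v \<Rightarrow> 'v \<Rightarrow> 'v poly"
  assumes superspace: "superspace scale R"
    and d_even: "even_endo scale R d"
    and br_bilinear: "even_bilinear scale R R R br"
    and sesqui_left: "\<And>a b. a \<in> whole R \<Longrightarrow> b \<in> whole R \<Longrightarrow> br (d a) b = - pCons 0 (br a b)"
    and sesqui_right: "\<And>a b. a \<in> whole R \<Longrightarrow> b \<in> whole R \<Longrightarrow>
        br a (d b) = pCons 0 (br a b) + map_poly d (br a b)"
    and skew: "\<And>a b p q. a \<in> R p \<Longrightarrow> b \<in> R q \<Longrightarrow> br a b = - koszul p q (subst_neg d (br b a))"
    and jacobi: "\<And>a b c p q. a \<in> R p \<Longrightarrow> b \<in> R q \<Longrightarrow> c \<in> whole R \<Longrightarrow>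
        psubst mmu (\<lambda>x. var_to mlam (br a x)) (br b c)
        - koszul p q (psubst mlam (\<lambda>x. var_to mmu (br b x)) (br a c)) =
        psubst mlam (\<lambda>x. var_to mlammu (br x c)) (br a b)"

text \<open>
  A $\mathbb{Z}_{\ge -1}$-grading is a $\mathbb{Z}$-grading whose components of degree
  below $-1$ vanish; \<open>Rg n p\<close> is the part of parity \<open>p\<close> of the component of degree \<open>n\<close>.
\<close>

locale graded_lie_conformal_superalgebra = lie_conformal_superalgebra scale R d br
  for scale :: "'f::field \<Rightarrow> 'v::ab_group_add \<Rightarrow> 'v" and R d br +
  fixes Rg :: "int \<Rightarrow> bit \<Rightarrow> 'v set"
  assumes Rg_superspace: "\<And>n. superspace scale (Rg n)"
    and Rg_subset: "\<And>n p. Rg n p \<subseteq> R p"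
    and Rg_direct_sum: "\<And>p x. x \<in> R p \<Longrightarrow>
        \<exists>!c. finite {n. c n \<noteq> 0} \<and> (\<forall>n. c n \<in> Rg n p) \<and> x = (\<Sum>n | c n \<noteq> 0. c n)"
    and Rg_below: "\<And>n p. n < -1 \<Longrightarrow> Rg n p = {0}"
    and d_graded: "\<And>n a. a \<in> whole (Rg n) \<Longrightarrow> d a \<in> whole (Rg n)"
    and br_graded: "\<And>n m a b. a \<in> whole (Rg n) \<Longrightarrow> b \<in> whole (Rg m) \<Longrightarrow>
        br a b \<in> polys (whole (Rg (n + m)))"

section \<open>The box product and the space of invariants\<close>

text \<open>
  From here on \<open>n, m, l :: int\<close> are degrees: degree \<open>n\<close> corresponds to arity \<open>n + 1\<close>. The values
  of degree below $-1$ only arise for empty sums, so that the truncation in \<open>ar\<close> is harmless.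
\<close>

definition ar :: "int \<Rightarrow> nat" where
  "ar n = nat (n + 1)"

definition box ::
  "(nat \<Rightarrow> 'v \<Rightarrow> 'v) \<Rightarrow> (nat \<Rightarrow> (nat \<Rightarrow> nat) \<Rightarrow> 'v \<Rightarrow> 'v) \<Rightarrow>
   (nat \<Rightarrow> nat \<Rightarrow> nat \<Rightarrow> 'v \<Rightarrow> 'v \<Rightarrow> 'v poly) \<Rightarrow> int \<Rightarrow> int \<Rightarrow> 'v \<Rightarrow> 'v \<Rightarrow> 'v::ab_group_add poly" where
  "box d act circ n m f g =
     (\<Sum>\<sigma>\<in>shuffle_perms (m + 1) n.
        map_poly (act (ar (n + m)) (inv \<sigma>))
          (subst_neg (d (ar (n + m))) (circ (ar n) (ar m) 1 f g)))"

text \<open>The associator $(f_\lambda g_\mu h) = (f\,\Box_\lambda g)\,\Box_{\lambda+\mu} h - f\,\Box_\lambda (g\,\Box_\mu h)$.\<close>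

definition associator ::
  "(nat \<Rightarrow> 'v \<Rightarrow> 'v) \<Rightarrow> (nat \<Rightarrow> (nat \<Rightarrow> nat) \<Rightarrow> 'v \<Rightarrow> 'v) \<Rightarrow>
   (nat \<Rightarrow> nat \<Rightarrow> nat \<Rightarrow> 'v \<Rightarrow> 'v \<Rightarrow> 'v poly) \<Rightarrow> int \<Rightarrow> int \<Rightarrow> int \<Rightarrow>
   'v \<Rightarrow> 'v \<Rightarrow> 'v \<Rightarrow> 'v::ab_group_add poly poly" where
  "associator d act circ n m l f g h =
     psubst mlam (\<lambda>c. var_to mlammu (box d act circ (n + m) l c h)) (box d act circ n m f g)
     - psubst mmu (\<lambda>c. var_to mlam (box d act circ n (m + l) f c)) (box d act circ m l g h)"

definition W ::
  "(nat \<Rightarrow> bit \<Rightarrow> 'v::ab_group_add set) \<Rightarrow> (nat \<Rightarrow> (nat \<Rightarrow> nat) \<Rightarrow> 'v \<Rightarrow> 'v) \<Rightarrow> int \<Rightarrow> 'v set" where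
  "W P act n =
     (if n < -1 then {0}
      else {f \<in> whole (P (ar n)). \<forall>\<sigma>. \<sigma> permutes {1..ar n} \<longrightarrow> act (ar n) \<sigma> f = f})"

text \<open>
  The direct sum of the \<open>W P act n\<close>, consisting of finitely supported families, with its
  homogeneous components, scalar multiplication and $\partial$.
\<close>

definition Wsum ::
  "(nat \<Rightarrow> bit \<Rightarrow> 'v::ab_group_add set) \<Rightarrow> (nat \<Rightarrow> (nat \<Rightarrow> nat) \<Rightarrow> 'v \<Rightarrow> 'v) \<Rightarrow> bit \<Rightarrow>
   (int \<Rightarrow>\<^sub>0 'v) set" where
  "Wsum P act p = {F. \<forall>n. Poly_Mapping.lookup F n \<in> W P act n \<inter> P (ar n) p}"

definition Wcomp ::
  "(nat \<Rightarrow> bit \<Rightarrow> 'v::ab_group_add set) \<Rightarrow> (nat \<Rightarrow> (nat \<Rightarrow> nat) \<Rightarrow> 'v \<Rightarrow> 'v) \<Rightarrow> int \<Rightarrow> bit \<Rightarrow>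
   (int \<Rightarrow>\<^sub>0 'v) set" where
  "Wcomp P act n p = Poly_Mapping.single n ` (W P act n \<inter> P (ar n) p)"

definition scale_sum :: "('f \<Rightarrow> 'v \<Rightarrow> 'v) \<Rightarrow> 'f \<Rightarrow> (int \<Rightarrow>\<^sub>0 'v) \<Rightarrow> (int \<Rightarrow>\<^sub>0 'v::zero)" where
  "scale_sum scale c = Poly_Mapping.map (scale c)"

definition d_sum :: "(nat \<Rightarrow> 'v \<Rightarrow> 'v) \<Rightarrow> (int \<Rightarrow>\<^sub>0 'v) \<Rightarrow> (int \<Rightarrow>\<^sub>0 'v::zero)" where
  "d_sum d = Poly_Mapping.mapp (\<lambda>n. d (ar n))"

end

theory Submission
  imports Defs
begin

text \<open>
  The box product $f \Box g$ inserts $g$ at the first input of $f$ and sums over the ways of shuffling the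
  inputs of $g$ with the remaining inputs of $f$.

  \<^emph>\<open>The associator.\<close> In $(f \Box g) \Box h$ the element $h$ is inserted at the first place of a shuffled
  $f \circ^1 g$, which is either the first input of $g$ or the second input of $f$. By nested
  associativity the terms of the first kind are those of $f \Box (g \Box h)$. What remains is $f$ with $g$ and
  $h$ inserted at two different inputs, summed over all shuffles of the inputs of $g$, of $h$ and the other
  inputs of $f$ (\<open>asc_formula\<close>). For an invariant $f$ the parallel axiom allows one to exchange $g$ and $h$
  at the cost of a sign and of a permutation of blocks (\<open>circ_parallel_swap\<close>), and the latter is
  absorbed by the sum (\<open>asc_symmetric\<close>).

  \<^emph>\<open>Invariance.\<close> Shuffles represent the cosets of $S_{m+1} \times S_n$ in $S_{m+n+1}$. If $f$ and $g$ are
  invariant, then $f \circ^1 g$ is invariant under this subgroup, hence the box product is a sum over all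
  cosets, which are permuted by $S_{m+n+1}$ (\<open>nbox_invariant\<close>).

  \<^emph>\<open>The bracket.\<close> As for right symmetric algebras, a product whose associator is symmetric in its
  last two arguments has a commutator that satisfies the Jacobi identity: the twelve terms form six
  associators that cancel in pairs (\<open>brs_jacobi\<close>).

  The bookkeeping rests on three devices.

  \<^item> A polynomial identity in $\lambda$ and $\mu$ is proved by evaluating the variables at commuting additive
  operators $A$, $B$ on an abelian group. The substitution of $-\lambda-\partial$ then becomes that of
  $-A-E$, where $E$ is the operator that $\partial$ turns into when it is moved out of the coefficients
  (\<open>psubst_subst_neg\<close>). The variables $\lambda$, $\mu$ and $-\lambda-\mu-\partial$ become three
  operators with symmetric roles, and the change of variables in the symmetry of the associator is
  merely another choice of $A$ and $B$.

  \<^item> Shuffles enter through their inverses, seen as words. Iterated shuffles are compared by one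
  factorization of words (\<open>shuffle_factorization\<close>).

  \<^item> The operations of an operad are additive only on given subspaces of the ambient space. Composed
  with linear projections they become additive everywhere (\<open>total_operad\<close>); the results are transferred
  back at the end.
\<close>


section \<open>Substitution of operators into polynomials\<close>

lemma additive_pCons: "additive (pCons (0::'a::ab_group_add))"
  by (simp add: additive_def)

lemma additive_const_poly: "additive (\<lambda>c::'a::ab_group_add. [:c:])"
  by (simp add: additive_def)

lemma additive_comp: "additive f \<Longrightarrow> additive g \<Longrightarrow> additive (\<lambda>x. f (g x))"
  by (simp add: additive_def)

lemma additive_add: "additive f \<Longrightarrow> additive g \<Longrightarrow> additive (\<lambda>x. f x + g x)"
  by (simp add: additive_def add_ac)

lemma additive_uminus: "additive f \<Longrightarrow> additive (\<lambda>x. - f x)"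
  by (simp add: additive_def)

lemma additive_diff: "additive f \<Longrightarrow> additive g \<Longrightarrow> additive (\<lambda>x. f x - g x)"
  by (simp add: additive_def)

lemma additive_sum: "(\<And>i. i \<in> I \<Longrightarrow> additive (f i)) \<Longrightarrow> additive (\<lambda>x. \<Sum>i\<in>I. f i x)"
  by (simp add: additive_def sum.distrib)

lemma additive_id: "additive (\<lambda>x. x)"
  by (simp add: additive_def)

lemma additive_const_zero: "additive (\<lambda>x. 0)"
  by (simp add: additive_def)

lemma map_poly_add:
  assumes "additive f" shows "map_poly f (p + q) = map_poly f p + map_poly f q"
  using assms by (intro poly_eqI) (simp add: coeff_map_poly additive.zero additive.add)

lemma additive_map_poly: "additive f \<Longrightarrow> additive (map_poly f)"
  by (simp add: additive_def map_poly_add)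

lemma map_poly_pCons0:
  "additive f \<Longrightarrow> map_poly f (pCons c p) = pCons (f c) (map_poly f p)"
  by (simp add: map_poly_pCons additive.zero)

lemmas additive_intros =
  additive_pCons additive_const_poly additive_add additive_uminus additive_diff additive_sum
  additive_id additive_const_zero additive_map_poly

lemma additive_funpow: "additive (A::'a::ab_group_add \<Rightarrow> 'a) \<Longrightarrow> additive (A ^^ k)"
  by (induction k) (simp_all add: additive_def)

lemma psubst_bound:
  assumes A: "additive A" and F: "F 0 = 0" and K: "degree q \<le> K"
  shows "psubst A F q = (\<Sum>k\<le>K. (A ^^ k) (F (coeff q k)))"
  unfolding psubst_def
proof (rule sum.mono_neutral_left)
  show "\<forall>k\<in>{..K} - {..degree q}. (A ^^ k) (F (coeff q k)) = 0"
    using additive.zero[OF additive_funpow[OF A]] by (auto simp: coeff_eq_0 F)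
qed (use K in auto)

lemma psubst_0 [simp]: "F 0 = 0 \<Longrightarrow> psubst A F 0 = 0"
  by (simp add: psubst_def)

lemma psubst_pCons:
  assumes A: "additive A" and F': "additive F"
  shows "psubst A F (pCons c q) = F c + A (psubst A F q)"
proof -
  note F = additive.zero[OF F']
  have "degree (pCons c q) \<le> Suc (degree q)" by (rule degree_pCons_le)
  from psubst_bound[of A F, OF A F this]
  have "psubst A F (pCons c q) = F c + (\<Sum>k\<le>degree q. (A ^^ Suc k) (F (coeff q k)))"
    by (simp add: sum.atMost_Suc_shift del: sum.atMost_Suc)
  also have "(\<Sum>k\<le>degree q. (A ^^ Suc k) (F (coeff q k))) = A (psubst A F q)"
    by (simp add: psubst_def additive.sum[OF A])
  finally show ?thesis .
qed

lemma psubst_const: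
  assumes A: "additive A" and F: "additive F"
  shows "psubst A F [:c:] = F c"
  using psubst_pCons[OF A F, of c 0] by (simp add: additive.zero[OF F] additive.zero[OF A])

lemma psubst_add:
  assumes A: "additive A" and F: "additive F"
  shows "psubst A F (p + q) = psubst A F p + psubst A F q"
proof -
  let ?K = "max (degree p) (degree q)"
  have "degree (p + q) \<le> ?K" by (rule degree_add_le_max)
  then show ?thesis
    using psubst_bound[of A F _ ?K, OF A additive.zero[OF F]] additive.add[OF additive_funpow[OF A]] 
    by (simp add: additive.add[OF F] sum.distrib)
qed

lemma additive_psubst: "additive A \<Longrightarrow> additive F \<Longrightarrow> additive (psubst A F)"
  by (simp add: additive_def psubst_add)

lemma psubst_map_poly:
  assumes A: "additive A" and F': "additive F" and g': "additive g"
  shows "psubst A F (map_poly g q) = psubst A (\<lambda>c. F (g c)) q"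
proof -
  note F = additive.zero[OF F'] and g = additive.zero[OF g']
  have "psubst A F (map_poly g q) = (\<Sum>k\<le>degree q. (A ^^ k) (F (coeff (map_poly g q) k)))"
    by (rule psubst_bound[of A F, OF A F]) (rule map_poly_degree_leq)
  then show ?thesis by (simp add: psubst_def coeff_map_poly g)
qed

lemma psubst_cong:
  assumes "\<And>k. F (coeff q k) = G (coeff q k)"
  shows "psubst A F q = psubst A G q"
  using assms by (simp add: psubst_def)

text \<open>
  An additive map that intertwines the operators commutes with substitution. Every change of variables
  below is an instance: \<open>e\<close> is an evaluation, and \<open>A'\<close> is what the operator \<open>A\<close> becomes under it.
\<close>

lemma psubst_natural:
  assumes e: "additive e" and c: "\<And>x. e (A x) = A' (e x)"
  shows "e (psubst A F q) = psubst A' (\<lambda>c. e (F c)) q"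
proof -
  have "e ((A ^^ k) x) = (A' ^^ k) (e x)" for k x
    by (induction k) (simp_all add: c)
  then show ?thesis by (simp add: psubst_def additive.sum[OF e])
qed

lemma psubst_add_fun:
  assumes "additive A"
  shows "psubst A (\<lambda>c. F c + G c) q = psubst A F q + psubst A G q"
  by (simp add: psubst_def additive.add[OF additive_funpow[OF assms]] sum.distrib)

lemma psubst_uminus_fun:
  assumes "additive A"
  shows "psubst A (\<lambda>c. - F c) q = - psubst A F q"
  by (simp add: psubst_def additive.minus[OF additive_funpow[OF assms]] sum_negf)

lemma psubst_diff_fun:
  assumes "additive A"
  shows "psubst A (\<lambda>c. F c - G c) q = psubst A F q - psubst A G q"
  by (simp add: psubst_def additive.diff[OF additive_funpow[OF assms]] sum_subtractf)

lemma psubst_sum_fun: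
  assumes "additive A"
  shows "psubst A (\<lambda>c. \<Sum>i\<in>I. F i c) q = (\<Sum>i\<in>I. psubst A (F i) q)"
  unfolding psubst_def additive.sum[OF additive_funpow[OF assms]] by (rule sum.swap)

lemma psubst_pCons_const: "psubst (pCons 0) (\<lambda>c. [:c:]) q = (q::'a::ab_group_add poly)"
  by (induction q) (simp_all add: psubst_pCons additive_pCons additive_const_poly)

lemma additive_neg_op:
  "additive d \<Longrightarrow> additive (\<lambda>x::'a::ab_group_add poly. - pCons 0 x - map_poly d x)"
  by (intro additive_intros)

text \<open>
  Substituting an operator \<open>A\<close> for \<open>\<lambda>\<close> after \<open>\<lambda> \<mapsto> -\<lambda>-\<partial>\<close> amounts to substituting \<open>-A - E\<close>,
  where \<open>E\<close> is what \<open>\<partial>\<close> becomes once it is moved out of the coefficients.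
\<close>

lemma psubst_subst_neg:
  assumes A: "additive A" and F: "additive F" and d: "additive d" and E: "additive E"
    and FE: "\<And>c. F (d c) = E (F c)" and AE: "\<And>x. A (E x) = E (A x)"
  shows "psubst A F (subst_neg d q) = psubst (\<lambda>x. - A x - E x) F q"
proof -
  have e: "additive (psubst A F)" by (rule additive_psubst[OF A F])
  note F0 = additive.zero[OF F]
  have comm: "psubst A F (- pCons 0 x - map_poly d x) = - A (psubst A F x) - E (psubst A F x)" for x
  proof -
    have "psubst A F (map_poly d x) = E (psubst A F x)"
      unfolding psubst_map_poly[OF A F d] FE by (rule psubst_natural[of E A A, OF E AE[symmetric], symmetric])
    moreover have "psubst A F (pCons 0 x) = A (psubst A F x)"
      by (simp add: psubst_pCons[OF A F] F0)
    ultimately show ?thesis by (simp only: additive.diff[OF e] additive.minus[OF e])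
  qed
  show ?thesis
    unfolding subst_neg_def
    unfolding psubst_natural[where A' = "\<lambda>x. - A x - E x", of "psubst A F", OF e comm] 
      psubst_const[OF A F] by (rule refl)
qed

lemma additive_subst_neg: "additive d \<Longrightarrow> additive (subst_neg d)"
  unfolding subst_neg_def by (intro additive_psubst additive_neg_op additive_const_poly)

text \<open>The formal operator $-\lambda-\partial$ is itself intertwined by any map compatible with $\partial$.\<close>

lemma map_poly_subst_neg:
  assumes e: "additive e" and d: "additive d" and d': "additive d'" and ed: "\<And>c. e (d c) = d' (e c)"
  shows "map_poly e (subst_neg d q) = subst_neg d' (map_poly e q)"
proof -
  let ?X = "\<lambda>x. - pCons 0 x - map_poly d x" and ?X' = "\<lambda>x. - pCons 0 x - map_poly d' x"
  have comm: "map_poly e (?X x) = ?X' (map_poly e x)" for x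
    by (rule poly_eqI)
      (simp add: coeff_map_poly additive.zero[OF e] additive.zero[OF d] additive.zero[OF d']
        additive.diff[OF e] additive.minus[OF e] ed coeff_pCons split: nat.split)
  have "map_poly e (subst_neg d q) = psubst ?X' (\<lambda>c. [:e c:]) q"
    unfolding subst_neg_def
      psubst_natural[where e = "map_poly e" and A = ?X and A' = ?X', OF additive_map_poly[OF e] comm]
    by (simp add: map_poly_pCons0 e)
  also have "\<dots> = subst_neg d' (map_poly e q)"
    unfolding subst_neg_def
    by (rule psubst_map_poly[OF additive_neg_op[OF d'] additive_const_poly e, symmetric])
  finally show ?thesis .
qed

text \<open>Here $\partial$ stays $\partial$, so that $-A-\partial$ for $A = -\lambda-\partial$ is $\lambda$ again.\<close>

lemma subst_neg_involution:
  assumes d: "additive d"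
  shows "subst_neg d (subst_neg d q) = q"
proof -
  let ?X = "\<lambda>x. - pCons 0 x - map_poly d x"
  have "?X (map_poly d x) = map_poly d (?X x)" for x
    by (simp add: additive.diff[OF additive_map_poly[OF d]] additive.minus[OF additive_map_poly[OF d]]
        map_poly_pCons0[OF d] additive.zero[OF d])
  then have "psubst ?X (\<lambda>c. [:c:]) (subst_neg d q) = psubst (\<lambda>x. - ?X x - map_poly d x) (\<lambda>c. [:c:]) q"
    by (intro psubst_subst_neg additive_neg_op[OF d] additive_const_poly d additive_map_poly[OF d])
      (simp_all add: map_poly_pCons0[OF d])
  also have "(\<lambda>x. - ?X x - map_poly d x) = pCons 0" by (simp add: fun_eq_iff)
  finally show ?thesis unfolding psubst_pCons_const subst_neg_def .
qed

lemma coeff_subst_neg_mem: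
  fixes d :: "'v::ab_group_add \<Rightarrow> 'v"
  assumes d: "\<And>c. c \<in> S \<Longrightarrow> d c \<in> S" and 0: "0 \<in> S" "d 0 = 0"
    and S: "\<And>x y. x \<in> S \<Longrightarrow> y \<in> S \<Longrightarrow> x - y \<in> S"
    and q: "q \<in> polys S"
  shows "subst_neg d q \<in> polys S"
proof -
  have add: "x + y \<in> S" if "x \<in> S" "y \<in> S" for x y
    using S[OF that(1) S[OF \<open>0 \<in> S\<close> that(2)]] by simp
  have step: "- pCons 0 x - map_poly d x \<in> polys S" if "x \<in> polys S" for x
    using that S[OF \<open>0 \<in> S\<close>] S d 0
    by (auto simp: polys_def coeff_map_poly coeff_pCons split: nat.splits)
  have pow: "((\<lambda>x. - pCons 0 x - map_poly d x) ^^ k) x \<in> polys S" if "x \<in> polys S" for x k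
    by (induction k) (use that step in simp_all)
  have "[:c:] \<in> polys S" if "c \<in> S" for c
    using that 0 by (auto simp: polys_def coeff_pCons split: nat.splits)
  then have "((\<lambda>x. - pCons 0 x - map_poly d x) ^^ k) [:coeff q k:] \<in> polys S" for k
    using pow q by (simp add: polys_def)
  then show ?thesis
    unfolding subst_neg_def psubst_def
  proof -
    assume *: "\<And>k. ((\<lambda>x. - pCons 0 x - map_poly d x) ^^ k) [:coeff q k:] \<in> polys S"
    have "(\<Sum>k\<in>K. ((\<lambda>x. - pCons 0 x - map_poly d x) ^^ k) [:coeff q k:]) \<in> polys S"
      if "finite K" for K
      using that by induction (use * add 0 in \<open>auto simp: polys_def\<close>)
    then show "(\<Sum>k\<le>degree q. ((\<lambda>x. - pCons 0 x - map_poly d x) ^^ k) [:coeff q k:]) \<in> polys S"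
      by simp
  qed
qed

section \<open>Shuffles as words\<close>

text \<open>
  A permutation \<open>\<gamma>\<close> is read as the word $\gamma(1)\dots\gamma(N)$, and \<open>col\<close> sorts the letters into blocks.
  The words in which the letters of every block come in increasing order are the \<^emph>\<open>inverses\<close> of the
  shuffles, and it is by inverses of shuffles that the box product acts. In this form iterated
  shuffles become insertions of one word into another.
\<close>

definition Sh :: "nat \<Rightarrow> (nat \<Rightarrow> 'c) \<Rightarrow> (nat \<Rightarrow> nat) set" where
  "Sh N col = {\<gamma>. \<gamma> permutes {1..N} \<and>
     (\<forall>j\<in>{1..N}. \<forall>k\<in>{1..N}. j < k \<longrightarrow> col (\<gamma> j) = col (\<gamma> k) \<longrightarrow> \<gamma> j < \<gamma> k)}"

lemma Sh_permutes: "\<gamma> \<in> Sh N col \<Longrightarrow> \<gamma> permutes {1..N}"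
  by (simp add: Sh_def)

lemma finite_Sh: "finite (Sh N col)"
  by (rule finite_subset[OF _ finite_permutations[of "{1..N}"]]) (auto simp: Sh_def)

lemma permutes_range: "\<gamma> permutes {1..N::nat} \<Longrightarrow> k \<in> {1..N} \<Longrightarrow> 1 \<le> \<gamma> k \<and> \<gamma> k \<le> N"
  using permutes_in_image[of \<gamma> "{1..N}" k] by auto

lemma Sh_mono_iff:
  assumes "\<gamma> \<in> Sh N col" "j \<in> {1..N}" "k \<in> {1..N}" "col (\<gamma> j) = col (\<gamma> k)"
  shows "\<gamma> j < \<gamma> k \<longleftrightarrow> j < k"
proof -
  have *: "\<And>j k. j \<in> {1..N} \<Longrightarrow> k \<in> {1..N} \<Longrightarrow> j < k \<Longrightarrow> col (\<gamma> j) = col (\<gamma> k) \<Longrightarrow> \<gamma> j < \<gamma> k"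
    using assms(1) by (simp add: Sh_def)
  show ?thesis
    using *[OF assms(2,3) _ assms(4)] *[OF assms(3,2) _ assms(4)[symmetric]]
    by (cases j k rule: linorder_cases) auto
qed

lemma permutes_intervalI:
  assumes "inj_on f {1..N::nat}" "\<And>k. k \<in> {1..N} \<Longrightarrow> f k \<in> {1..N}" "\<And>k. k \<notin> {1..N} \<Longrightarrow> f k = k"
  shows "f permutes {1..N}"
proof (rule bij_imp_permutes)
  have "f ` {1..N} = {1..N}" by (rule endo_inj_surj) (use assms in auto)
  then show "bij_betw f {1..N} {1..N}" using assms(1) by (simp add: bij_betw_def)
qed (use assms in auto)

lemma permutes_rank:
  assumes "\<gamma> permutes {1..N::nat}" "k \<in> {1..N}"
  shows "\<gamma> k = card {j \<in> {1..N}. \<gamma> j \<le> \<gamma> k}"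
proof -
  have "\<gamma> ` {j \<in> {1..N}. \<gamma> j \<le> \<gamma> k} = {1..\<gamma> k}"
  proof (rule antisym; rule subsetI)
    fix v assume v: "v \<in> {1..\<gamma> k}"
    then have "v \<in> {1..N}" using permutes_range[OF assms] by auto
    then have "inv \<gamma> v \<in> {1..N}" using permutes_in_image[OF permutes_inv[OF assms(1)]] by auto
    moreover have "\<gamma> (inv \<gamma> v) = v" by (rule permutes_inverses[OF assms(1)])
    ultimately show "v \<in> \<gamma> ` {j \<in> {1..N}. \<gamma> j \<le> \<gamma> k}"
      using v by (intro image_eqI[of _ _ "inv \<gamma> v"]) auto
  qed (use permutes_range[OF assms(1)] in force)
  moreover have "inj_on \<gamma> {j \<in> {1..N}. \<gamma> j \<le> \<gamma> k}"
    using permutes_inj[OF assms(1)] by (simp add: inj_on_def)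
  ultimately show ?thesis using card_image[of \<gamma> "{j \<in> {1..N}. \<gamma> j \<le> \<gamma> k}"] by simp
qed

text \<open>By the rank formula the values can be recovered from the order between them.\<close>

lemma permutes_eqI_order:
  assumes "\<gamma> permutes {1..N::nat}" "\<gamma>' permutes {1..N}"
    and "\<And>j k. j \<in> {1..N} \<Longrightarrow> k \<in> {1..N} \<Longrightarrow> j \<noteq> k \<Longrightarrow> \<gamma> j < \<gamma> k \<longleftrightarrow> \<gamma>' j < \<gamma>' k"
  shows "\<gamma> = \<gamma>'"
proof
  fix k
  show "\<gamma> k = \<gamma>' k"
  proof (cases "k \<in> {1..N}")
    case True
    have "\<gamma> j \<le> \<gamma> k \<longleftrightarrow> \<gamma>' j \<le> \<gamma>' k" if "j \<in> {1..N}" for j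
      using assms(3)[OF that True] permutes_inj[OF assms(1)] permutes_inj[OF assms(2)]
      by (cases "j = k") (auto simp: order_le_less inj_eq)
    then have "{j \<in> {1..N}. \<gamma> j \<le> \<gamma> k} = {j \<in> {1..N}. \<gamma>' j \<le> \<gamma>' k}" by blast
    then show ?thesis using permutes_rank[OF assms(1) True] permutes_rank[OF assms(2) True] by simp
  next
    case False
    then show ?thesis using assms by (simp add: permutes_not_in)
  qed
qed

lemma card_le_strict_mono:
  assumes "finite T" "j \<in> T" "k \<in> T" "j < (k::nat)"
  shows "card {i \<in> T. i \<le> j} < card {i \<in> T. i \<le> k}"
proof (rule psubset_card_mono)
  show "{i \<in> T. i \<le> j} \<subset> {i \<in> T. i \<le> k}" using assms by force
qed (use assms in simp)

lemma card_le_bounds: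
  assumes "finite T" "k \<in> (T::nat set)"
  shows "1 \<le> card {i \<in> T. i \<le> k}" "card {i \<in> T. i \<le> k} \<le> card T"
  using assms by (auto intro!: card_mono simp: Suc_le_eq card_gt_0_iff)

text \<open>
  The word sends each place to its rank among the places of its own block, shifted by \<open>L\<close> for the
  second block. Together with the uniqueness lemma below, two-block shuffles are thus
  the same as sets of \<open>L\<close> places.
\<close>

lemma ex_shuffle_with_places:
  assumes S: "S \<subseteq> {1..N}" "card S = L"
  obtains \<beta> where "\<beta> \<in> Sh N (\<lambda>v. v \<le> L)" "\<And>k. k \<in> {1..N} \<Longrightarrow> \<beta> k \<le> L \<longleftrightarrow> k \<in> S"
proof -
  let ?T = "{1..N} - S"
  define \<beta> where "\<beta> k = (if k \<in> S then card {i \<in> S. i \<le> k}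
     else if k \<in> {1..N} then L + card {i \<in> ?T. i \<le> k} else k)" for k
  have fin: "finite S" "finite ?T" using S finite_subset by auto
  have cT: "L + card ?T = N" 
    using S fin card_mono[of "{1..N}" S] by (simp add: card_Diff_subset)
  have bS: "1 \<le> \<beta> k \<and> \<beta> k \<le> L" if "k \<in> S" for k
    using that card_le_bounds[OF fin(1) that] S by (simp add: \<beta>_def)
  have bT: "L < \<beta> k \<and> \<beta> k \<le> N" if "k \<in> ?T" for k
    using that card_le_bounds[OF fin(2) that] cT by (simp add: \<beta>_def)
  have mS: "\<beta> j < \<beta> k" if "j \<in> S" "k \<in> S" "j < k" for j k
    using that card_le_strict_mono[OF fin(1) that] by (simp add: \<beta>_def)
  have mT: "\<beta> j < \<beta> k" if "j \<in> ?T" "k \<in> ?T" "j < k" for j k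
    using that card_le_strict_mono[OF fin(2) that] by (simp add: \<beta>_def)
  have places: "\<beta> k \<le> L \<longleftrightarrow> k \<in> S" if "k \<in> {1..N}" for k
    using bS[of k] bT[of k] that by fastforce
  have mono: "\<beta> j < \<beta> k" if "j \<in> {1..N}" "k \<in> {1..N}" "j < k" "(\<beta> j \<le> L) = (\<beta> k \<le> L)" for j k
    using that places[of j] places[of k] mS[of j k] mT[of j k] by blast
  have "\<beta> permutes {1..N}"
  proof (rule permutes_intervalI)
    show "inj_on \<beta> {1..N}"
    proof (rule linorder_inj_onI)
      fix j k assume *: "j < k" "j \<in> {1..N}" "k \<in> {1..N}"
      show "\<beta> j \<noteq> \<beta> k"
      proof
        assume "\<beta> j = \<beta> k"
        then show False using mono[of j k] * by simp
      qed
    qed auto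
    show "\<beta> k \<in> {1..N}" if "k \<in> {1..N}" for k
      using bS[of k] bT[of k] that cT by (cases "k \<in> S") auto
    show "\<beta> k = k" if "k \<notin> {1..N}" for k using that S by (auto simp: \<beta>_def)
  qed
  then have "\<beta> \<in> Sh N (\<lambda>v. v \<le> L)" using mono by (simp add: Sh_def)
  then show thesis using places that by blast
qed

lemma shuffle_eqI_places:
  assumes "\<beta> \<in> Sh N (\<lambda>v. v \<le> L)" "\<beta>' \<in> Sh N (\<lambda>v. v \<le> L)"
    and places: "\<And>k. k \<in> {1..N} \<Longrightarrow> \<beta> k \<le> L \<longleftrightarrow> \<beta>' k \<le> L"
  shows "\<beta> = \<beta>'"
proof (rule permutes_eqI_order)
  show "\<beta> permutes {1..N}" "\<beta>' permutes {1..N}"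
    by (rule Sh_permutes[OF assms(1)], rule Sh_permutes[OF assms(2)])
  show "\<beta> j < \<beta> k \<longleftrightarrow> \<beta>' j < \<beta>' k" if *: "j \<in> {1..N}" "k \<in> {1..N}" for j k
  proof (cases "(\<beta> j \<le> L) = (\<beta> k \<le> L)")
    case True
    then have "(\<beta>' j \<le> L) = (\<beta>' k \<le> L)" using places[OF *(1)] places[OF *(2)] by blast
    then show ?thesis
      using Sh_mono_iff[OF assms(1) * True] Sh_mono_iff[OF assms(2) *] by blast
  next
    case False
    then show ?thesis using places[OF *(1)] places[OF *(2)] by auto
  qed
qed

text \<open>
  The common source of all identities between iterated shuffle sums. For a union \<open>T\<close> of colour classes,
  a word \<open>\<gamma>\<close> first records which places carry letters of \<open>T\<close>, and this is a two-block shuffle \<open>\<beta>\<close>;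
  what remains, \<open>\<delta>\<close>, writes the letters of \<open>T\<close> first and then the other ones. Both factors are
  determined by \<open>\<gamma>\<close> since \<open>\<beta>\<close> is determined by its places.
\<close>

lemma shuffle_factorization:
  assumes T: "T \<subseteq> {1..N}" "card T = L"
    and sat: "\<And>u v. u \<in> {1..N} \<Longrightarrow> v \<in> {1..N} \<Longrightarrow> col u = col v \<Longrightarrow> u \<in> T \<longleftrightarrow> v \<in> T"
  shows "bij_betw (\<lambda>(\<delta>, \<beta>). \<delta> \<circ> \<beta>)
    ({\<delta> \<in> Sh N col. \<delta> ` {1..L} = T} \<times> Sh N (\<lambda>v. v \<le> L)) (Sh N col)"
proof -
  have LN: "L \<le> N" using T card_mono[of "{1..N}" T] by simp
  have side: "\<delta> v \<in> T \<longleftrightarrow> v \<le> L"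
    if "\<delta> permutes {1..N}" "\<delta> ` {1..L} = T" "v \<in> {1..N}" for \<delta> v
  proof -
    have "\<delta> v \<in> T \<longleftrightarrow> v \<in> {1..L}"
      using inj_image_mem_iff[OF permutes_inj[OF that(1)], of v "{1..L}"] that(2) by simp
    then show ?thesis using that(3) by simp
  qed
  show ?thesis
  proof (rule bij_betwI')
    fix x y
    assume "x \<in> {\<delta> \<in> Sh N col. \<delta> ` {1..L} = T} \<times> Sh N (\<lambda>v. v \<le> L)"
      and "y \<in> {\<delta> \<in> Sh N col. \<delta> ` {1..L} = T} \<times> Sh N (\<lambda>v. v \<le> L)"
    then obtain \<delta> \<beta> \<delta>' \<beta>' where xy: "x = (\<delta>, \<beta>)" "y = (\<delta>', \<beta>')"
      and d: "\<delta> \<in> Sh N col" "\<delta> ` {1..L} = T" "\<delta>' \<in> Sh N col" "\<delta>' ` {1..L} = T"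
      and b: "\<beta> \<in> Sh N (\<lambda>v. v \<le> L)" "\<beta>' \<in> Sh N (\<lambda>v. v \<le> L)" by auto
    note p = Sh_permutes[OF d(1)] Sh_permutes[OF d(3)] Sh_permutes[OF b(1)] Sh_permutes[OF b(2)]
    have "x = y" if eq: "\<delta> \<circ> \<beta> = \<delta>' \<circ> \<beta>'"
    proof -
      have "\<beta> = \<beta>'"
      proof (rule shuffle_eqI_places[OF b])
        fix k assume k: "k \<in> {1..N}"
        have r: "\<beta> k \<in> {1..N}" "\<beta>' k \<in> {1..N}"
          using k permutes_in_image[OF p(3)] permutes_in_image[OF p(4)] by auto
        have "\<delta> (\<beta> k) = \<delta>' (\<beta>' k)" using fun_cong[OF eq, of k] by simp
        then show "\<beta> k \<le> L \<longleftrightarrow> \<beta>' k \<le> L"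
          using side[OF p(1) d(2) r(1)] side[OF p(2) d(4) r(2)] by argo
      qed
      moreover have "\<delta> = \<delta>'"
      proof
        fix v
        have "\<delta> (\<beta> (inv \<beta> v)) = \<delta>' (\<beta> (inv \<beta> v))"
          using fun_cong[OF eq, of "inv \<beta> v"] \<open>\<beta> = \<beta>'\<close> by simp
        then show "\<delta> v = \<delta>' v" by (simp add: permutes_inverses[OF p(3)])
      qed
      ultimately show ?thesis by (simp add: xy)
    qed
    then show "((case x of (\<delta>, \<beta>) \<Rightarrow> \<delta> \<circ> \<beta>) = (case y of (\<delta>, \<beta>) \<Rightarrow> \<delta> \<circ> \<beta>)) = (x = y)"
      by (auto simp: xy)
  next
    fix x assume "x \<in> {\<delta> \<in> Sh N col. \<delta> ` {1..L} = T} \<times> Sh N (\<lambda>v. v \<le> L)"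
    then obtain \<delta> \<beta> where x: "x = (\<delta>, \<beta>)" and d: "\<delta> \<in> Sh N col" "\<delta> ` {1..L} = T"
      and b: "\<beta> \<in> Sh N (\<lambda>v. v \<le> L)" by auto
    note p = Sh_permutes[OF d(1)] Sh_permutes[OF b]
    have "\<delta> (\<beta> j) < \<delta> (\<beta> k)"
      if jk: "j \<in> {1..N}" "k \<in> {1..N}" "j < k" "col (\<delta> (\<beta> j)) = col (\<delta> (\<beta> k))" for j k
    proof -
      have r: "\<beta> j \<in> {1..N}" "\<beta> k \<in> {1..N}" using jk permutes_in_image[OF p(2)] by auto
      then have r': "\<delta> (\<beta> j) \<in> {1..N}" "\<delta> (\<beta> k) \<in> {1..N}" using permutes_in_image[OF p(1)] by auto
      have "(\<beta> j \<le> L) = (\<beta> k \<le> L)"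
        using sat[OF r' jk(4)] side[OF p(1) d(2) r(1)] side[OF p(1) d(2) r(2)] by blast
      then have "\<beta> j < \<beta> k" using Sh_mono_iff[OF b jk(1,2)] jk(3) by blast
      then show ?thesis using Sh_mono_iff[OF d(1) r jk(4)] by blast
    qed
    then show "(case x of (\<delta>, \<beta>) \<Rightarrow> \<delta> \<circ> \<beta>) \<in> Sh N col"
      using permutes_compose[OF p(2) p(1)] by (simp add: x Sh_def)
  next
    fix \<gamma> assume g: "\<gamma> \<in> Sh N col"
    note p = Sh_permutes[OF g]
    let ?S = "{k \<in> {1..N}. \<gamma> k \<in> T}"
    have "\<gamma> ` ?S = T"
    proof (rule antisym; rule subsetI)
      fix v assume v: "v \<in> T"
      then have "v \<in> \<gamma> ` {1..N}" using permutes_image[OF p] T(1) by auto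
      then obtain k where "k \<in> {1..N}" "v = \<gamma> k" by (rule imageE)
      then show "v \<in> \<gamma> ` ?S" using v by (intro image_eqI[of _ _ k]) auto
    qed auto
    then have cS: "card ?S = L" 
      using T(2) card_image[OF inj_on_subset[OF permutes_inj[OF p] subset_UNIV], of ?S] by simp
    obtain \<beta> where b: "\<beta> \<in> Sh N (\<lambda>v. v \<le> L)" and places: "\<And>k. k \<in> {1..N} \<Longrightarrow> \<beta> k \<le> L \<longleftrightarrow> k \<in> ?S"
      using ex_shuffle_with_places[of ?S N L] cS by blast
    note q = Sh_permutes[OF b]
    define \<delta> where "\<delta> = \<gamma> \<circ> inv \<beta>"
    have qi: "inv \<beta> permutes {1..N}" by (rule permutes_inv[OF q])
    have dp: "\<delta> permutes {1..N}" unfolding \<delta>_def by (rule permutes_compose[OF qi p])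
    have inT: "\<delta> v \<in> T \<longleftrightarrow> v \<le> L" if "v \<in> {1..N}" for v
    proof -
      have "inv \<beta> v \<in> {1..N}" using that permutes_in_image[OF qi] by auto
      then show ?thesis using places[of "inv \<beta> v"] by (simp add: \<delta>_def permutes_inverses[OF q])
    qed
    have img: "\<delta> ` {1..L} = T"
    proof (rule card_subset_eq)
      show "finite T" using T finite_subset by auto
      show "\<delta> ` {1..L} \<subseteq> T" using inT LN by auto
      have "card (\<delta> ` {1..L}) = card {1..L}"
        by (rule card_image[OF inj_on_subset[OF permutes_inj[OF dp] subset_UNIV]])
      then show "card (\<delta> ` {1..L}) = card T" using T by simp
    qed
    have "\<delta> j < \<delta> k" if jk: "j \<in> {1..N}" "k \<in> {1..N}" "j < k" "col (\<delta> j) = col (\<delta> k)" for j k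
    proof -
      have r: "inv \<beta> j \<in> {1..N}" "inv \<beta> k \<in> {1..N}" using jk permutes_in_image[OF qi] by auto
      have r': "\<delta> j \<in> {1..N}" "\<delta> k \<in> {1..N}" using jk permutes_in_image[OF dp] by auto
      have "(\<beta> (inv \<beta> j) \<le> L) = (\<beta> (inv \<beta> k) \<le> L)"
        unfolding permutes_inverses[OF q] using sat[OF r' jk(4)] inT[OF jk(1)] inT[OF jk(2)] by blast
      then have "\<beta> (inv \<beta> j) < \<beta> (inv \<beta> k) \<longleftrightarrow> inv \<beta> j < inv \<beta> k"
        by (rule Sh_mono_iff[OF b r])
      then have "inv \<beta> j < inv \<beta> k" using jk(3) unfolding permutes_inverses[OF q] by blast
      then show ?thesis using Sh_mono_iff[OF g r] jk(4) unfolding \<delta>_def o_apply by blast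
    qed
    then have "\<delta> \<in> Sh N col" using dp by (simp add: Sh_def)
    moreover have "\<gamma> = \<delta> \<circ> \<beta>" by (simp add: \<delta>_def fun_eq_iff permutes_inverses[OF q])
    ultimately show "\<exists>x\<in>{\<delta> \<in> Sh N col. \<delta> ` {1..L} = T} \<times> Sh N (\<lambda>v. v \<le> L).
        \<gamma> = (case x of (\<delta>, \<beta>) \<Rightarrow> \<delta> \<circ> \<beta>)"
      using img b by (intro bexI[of _ "(\<delta>, \<beta>)"]) auto
  qed
qed

text \<open>
  Two-block shuffles represent the cosets of the subgroup of the \<open>\<kappa>\<close> that preserve the first block,
  and translation by \<open>\<rho>\<close> permutes these cosets: \<open>\<phi> \<alpha>\<close> is the shuffle with the places of \<open>\<alpha> \<circ> \<rho>\<close>.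
\<close>

lemma shuffle_coset_action:
  assumes r: "\<rho> permutes {1..N}" and LN: "L \<le> N"
  obtains \<phi> where "bij_betw \<phi> (Sh N (\<lambda>v. v \<le> L)) (Sh N (\<lambda>v. v \<le> L))"
    and "\<And>\<alpha>. \<alpha> \<in> Sh N (\<lambda>v. v \<le> L) \<Longrightarrow>
      \<exists>\<kappa>. \<kappa> permutes {1..N} \<and> \<kappa> ` {1..L} = {1..L} \<and> \<alpha> \<circ> \<rho> = \<kappa> \<circ> \<phi> \<alpha>"
proof -
  let ?S = "Sh N (\<lambda>v. v \<le> L)"
  have "\<exists>\<beta>\<in>?S. \<forall>k\<in>{1..N}. \<beta> k \<le> L \<longleftrightarrow> \<alpha> (\<rho> k) \<le> L" if a: "\<alpha> \<in> ?S" for \<alpha>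
  proof -
    have p: "\<alpha> \<circ> \<rho> permutes {1..N}" using permutes_compose[OF r Sh_permutes[OF a]] .
    have "(\<alpha> \<circ> \<rho>) ` {k \<in> {1..N}. (\<alpha> \<circ> \<rho>) k \<le> L} = {1..L}"
    proof (rule antisym; rule subsetI)
      fix v assume v: "v \<in> {1..L}"
      then have "v \<in> (\<alpha> \<circ> \<rho>) ` {1..N}" using permutes_image[OF p] LN by auto
      then show "v \<in> (\<alpha> \<circ> \<rho>) ` {k \<in> {1..N}. (\<alpha> \<circ> \<rho>) k \<le> L}" using v by auto
    qed (use permutes_range[OF p] in auto)
    then have "card {k \<in> {1..N}. (\<alpha> \<circ> \<rho>) k \<le> L} = L"
      using card_image[OF inj_on_subset[OF permutes_inj[OF p] subset_UNIV],
          of "{k \<in> {1..N}. (\<alpha> \<circ> \<rho>) k \<le> L}"] by simp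
    then obtain \<beta> where "\<beta> \<in> ?S" "\<And>k. k \<in> {1..N} \<Longrightarrow> \<beta> k \<le> L \<longleftrightarrow> k \<in> {k \<in> {1..N}. (\<alpha> \<circ> \<rho>) k \<le> L}"
      using ex_shuffle_with_places[of "{k \<in> {1..N}. (\<alpha> \<circ> \<rho>) k \<le> L}" N L] by blast
    then show ?thesis by (intro bexI[of _ \<beta>]) auto
  qed
  then obtain \<phi> where ph: "\<And>\<alpha>. \<alpha> \<in> ?S \<Longrightarrow> \<phi> \<alpha> \<in> ?S"
    and pl: "\<And>\<alpha> k. \<alpha> \<in> ?S \<Longrightarrow> k \<in> {1..N} \<Longrightarrow> \<phi> \<alpha> k \<le> L \<longleftrightarrow> \<alpha> (\<rho> k) \<le> L"
    by metis
  have "inj_on \<phi> ?S"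
  proof (rule inj_onI)
    fix \<alpha> \<alpha>' assume a: "\<alpha> \<in> ?S" "\<alpha>' \<in> ?S" "\<phi> \<alpha> = \<phi> \<alpha>'"
    show "\<alpha> = \<alpha>'"
    proof (rule shuffle_eqI_places[OF a(1,2)])
      fix k assume k: "k \<in> {1..N}"
      have "inv \<rho> k \<in> {1..N}" using k permutes_in_image[OF permutes_inv[OF r]] by auto
      then show "\<alpha> k \<le> L \<longleftrightarrow> \<alpha>' k \<le> L"
        using pl[OF a(1), of "inv \<rho> k"] pl[OF a(2), of "inv \<rho> k"] a(3)
        by (simp add: permutes_inverses[OF r])
    qed
  qed
  then have bij: "bij_betw \<phi> ?S ?S"
    using ph endo_inj_surj[of ?S \<phi>] finite_Sh by (auto simp: bij_betw_def image_subset_iff)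
  moreover have "\<exists>\<kappa>. \<kappa> permutes {1..N} \<and> \<kappa> ` {1..L} = {1..L} \<and> \<alpha> \<circ> \<rho> = \<kappa> \<circ> \<phi> \<alpha>" if a: "\<alpha> \<in> ?S" for \<alpha>
  proof -
    note p = Sh_permutes[OF a] and q = Sh_permutes[OF ph[OF a]]
    define \<kappa> where "\<kappa> = (\<alpha> \<circ> \<rho>) \<circ> inv (\<phi> \<alpha>)"
    have qi: "inv (\<phi> \<alpha>) permutes {1..N}" by (rule permutes_inv[OF q])
    have kp: "\<kappa> permutes {1..N}"
      unfolding \<kappa>_def by (intro permutes_compose[OF qi] permutes_compose[OF r] p)
    have "\<kappa> v \<in> {1..L}" if v: "v \<in> {1..L}" for v
    proof -
      have "inv (\<phi> \<alpha>) v \<in> {1..N}" using v LN permutes_in_image[OF qi, of v] by auto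
      then have "\<kappa> v \<le> L"
        using pl[OF a, of "inv (\<phi> \<alpha>) v"] v by (simp add: \<kappa>_def permutes_inverses[OF q])
      then show ?thesis using permutes_range[OF kp, of v] v LN by auto
    qed
    then have "\<kappa> ` {1..L} = {1..L}"
      using permutes_inj[OF kp] by (intro endo_inj_surj) (auto simp: inj_on_def inj_def)
    moreover have "\<alpha> \<circ> \<rho> = \<kappa> \<circ> \<phi> \<alpha>" by (simp add: \<kappa>_def fun_eq_iff permutes_inverses[OF q])
    ultimately show ?thesis using kp by blast
  qed
  ultimately show thesis using that by blast
qed

text \<open>
  The box product sums over shuffles but acts by their inverses. Increasing order of \<open>\<sigma>\<close> on each block
  means that the letters of that block come in order in the word of \<open>inv \<sigma>\<close>.
\<close>

lemma sum_shuffle_perms: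
  "(\<Sum>\<sigma>\<in>shuffle_perms (int b) (int a). F (inv \<sigma>)) = (\<Sum>\<alpha>\<in>Sh (a + b) (\<lambda>v. v \<le> b). F \<alpha>)"
proof (rule sum.reindex_bij_witness[where i = inv and j = inv])
  fix \<sigma> assume s: "\<sigma> \<in> shuffle_perms (int b) (int a)"
  have N: "nat (int b + int a) = a + b" by simp
  have p: "\<sigma> permutes {1..a + b}" and m1: "strict_mono_on {1..b} \<sigma>"
    and m2: "strict_mono_on {b + 1..a + b} \<sigma>"
    using s unfolding shuffle_perms_def N by (simp_all split: if_splits)
  show "inv (inv \<sigma>) = \<sigma>" by (rule inv_inv_eq[OF permutes_bij[OF p]])
  have pi: "inv \<sigma> permutes {1..a + b}" by (rule permutes_inv[OF p])
  have "inv \<sigma> j < inv \<sigma> k"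
    if jk: "j \<in> {1..a + b}" "k \<in> {1..a + b}" "j < k" "(inv \<sigma> j \<le> b) = (inv \<sigma> k \<le> b)" for j k
  proof (rule ccontr)
    assume n: "\<not> inv \<sigma> j < inv \<sigma> k"
    have "inv \<sigma> j \<noteq> inv \<sigma> k" using jk(3) permutes_inj[OF pi] by (auto dest: injD)
    then have lt: "inv \<sigma> k < inv \<sigma> j" using n by simp
    have r: "1 \<le> inv \<sigma> j \<and> inv \<sigma> j \<le> a + b" "1 \<le> inv \<sigma> k \<and> inv \<sigma> k \<le> a + b"
      using permutes_range[OF pi] jk by auto
    have "\<sigma> (inv \<sigma> k) < \<sigma> (inv \<sigma> j)"
    proof (cases "inv \<sigma> j \<le> b")
      case True
      then show ?thesis using strict_mono_onD[OF m1 _ _ lt] r jk(4) by auto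
    next
      case False
      then show ?thesis using strict_mono_onD[OF m2 _ _ lt] r jk(4) by auto
    qed
    then show False using jk(3) by (simp add: permutes_inverses[OF p])
  qed
  then show "inv \<sigma> \<in> Sh (a + b) (\<lambda>v. v \<le> b)" using pi by (simp add: Sh_def)
next
  fix \<alpha> assume a: "\<alpha> \<in> Sh (a + b) (\<lambda>v. v \<le> b)"
  note p = Sh_permutes[OF a]
  have pi: "inv \<alpha> permutes {1..a + b}" by (rule permutes_inv[OF p])
  show "inv (inv \<alpha>) = \<alpha>" by (rule inv_inv_eq[OF permutes_bij[OF p]])
  have "inv \<alpha> j < inv \<alpha> k"
    if jk: "j \<in> {1..a + b}" "k \<in> {1..a + b}" "j < k" "(j \<le> b) = (k \<le> b)" for j k
    using Sh_mono_iff[OF a, of "inv \<alpha> j" "inv \<alpha> k"] jk permutes_in_image[OF pi]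
    by (simp add: permutes_inverses[OF p])
  then have "strict_mono_on {1..b} (inv \<alpha>)" "strict_mono_on {b + 1..a + b} (inv \<alpha>)"
    by (auto intro!: strict_mono_onI)
  moreover have "nat (int b + int a) = a + b" by simp
  ultimately show "inv \<alpha> \<in> shuffle_perms (int b) (int a)"
    using pi unfolding shuffle_perms_def by simp
qed simp

section \<open>Block permutations\<close>

lemma permutes_eq_iff: "\<alpha> permutes A \<Longrightarrow> \<alpha> j = \<alpha> k \<longleftrightarrow> j = k"
  by (simp add: inj_eq permutes_inj)

text \<open>
  The factors moved to places before \<open>v\<close> are \<open>v - 1\<close> in number and have length \<open>1\<close> except
  for the \<open>i\<close>-th one.
\<close>

lemma sum_block_lengths:
  fixes n m i v :: nat
  assumes a: "\<alpha> permutes {1..n}" and i: "i \<in> {1..n}" and v: "1 \<le> v" "v \<le> n"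
  shows "(\<Sum>b | b \<in> {1..n} \<and> \<alpha> b < v. if b = i then m else 1) =
    (if \<alpha> i < v then v + m - 2 else v - 1)"
proof -
  let ?B = "{b. b \<in> {1..n} \<and> \<alpha> b < v}"
  have "\<alpha> ` ?B = {1..<v}"
  proof (rule antisym; rule subsetI)
    fix u assume u: "u \<in> {1..<v}"
    then have "u \<in> \<alpha> ` {1..n}" using permutes_image[OF a] v by auto
    then show "u \<in> \<alpha> ` ?B" using u by auto
  qed (use permutes_range[OF a] in auto)
  then have card: "card ?B = v - 1"
    using card_image[OF inj_on_subset[OF permutes_inj[OF a] subset_UNIV], of ?B] by simp
  show ?thesis
  proof (cases "\<alpha> i < v")
    case True
    then have "i \<in> ?B" using i by simp
    then have "(\<Sum>b\<in>?B. if b = i then m else 1) = m + (\<Sum>b\<in>?B - {i}. 1)"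
      by (subst sum.remove[of _ i]) (auto intro!: sum.cong)
    also have "\<dots> = m + (v - 1 - 1)" using card \<open>i \<in> ?B\<close> by simp
    moreover have "2 \<le> v" using True permutes_range[OF a i] by linarith
    ultimately show ?thesis using True by simp
  next
    case False
    then have "(\<Sum>b\<in>?B. if b = i then m else 1) = (\<Sum>b\<in>?B. 1)" by (intro sum.cong) auto
    then show ?thesis using False card by simp
  qed
qed

text \<open>
  When the letter \<open>p\<close> is replaced by the block of letters $p, \dots, p+L-1$, the other letters are
  renamed by \<open>expand\<close>; \<open>squash\<close> undoes this outside the block.
\<close>

definition expand :: "nat \<Rightarrow> nat \<Rightarrow> nat \<Rightarrow> nat" where
  "expand p L v = (if v < p then v else v + L - 1)"

definition squash :: "nat \<Rightarrow> nat \<Rightarrow> nat \<Rightarrow> nat" where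
  "squash p L v = (if v < p then v else v + 1 - L)"

text \<open>As a word, $\alpha \circ_1 \tau$ is \<open>\<alpha>\<close> with its first letter replaced by a block arranged by \<open>\<tau>\<close>.\<close>

lemma perm_circ_1:
  assumes a: "\<alpha> permutes {1..n}" and n: "1 \<le> n" and k: "k \<in> {1..n + L - 1}"
  shows "perm_circ n L 1 \<alpha> \<tau> k =
    (if k \<le> L then \<alpha> 1 - 1 + \<tau> k else expand (\<alpha> 1) L (\<alpha> (k + 1 - L)))"
proof (cases "k \<le> L")
  case True
  then have "factor_of L 1 k = 1" using k by (auto simp: factor_of_def)
  moreover have "1 \<le> \<alpha> 1 \<and> \<alpha> 1 \<le> n" using permutes_range[OF a, of 1] n by simp
  ultimately show ?thesis
    using k True sum_block_lengths[OF a, of 1 "\<alpha> 1" L] n by (simp add: perm_circ_def)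
next
  case False
  then have f: "factor_of L 1 k = k + 1 - L" using k by (auto simp: factor_of_def)
  have j: "k + 1 - L \<in> {1..n}" "k + 1 - L \<noteq> 1" using k False by auto
  have r: "1 \<le> \<alpha> (k + 1 - L) \<and> \<alpha> (k + 1 - L) \<le> n" using permutes_range[OF a j(1)] .
  have r1: "1 \<le> \<alpha> 1" using permutes_range[OF a, of 1] n by simp
  have "\<alpha> (k + 1 - L) \<noteq> \<alpha> 1" using permutes_eq_iff[OF a] j(2) by blast
  then consider "\<alpha> (k + 1 - L) < \<alpha> 1"
    | "\<alpha> 1 < \<alpha> (k + 1 - L)" "Suc (\<alpha> (k + 1 - L) + L - 2) = \<alpha> (k + 1 - L) + L - 1"
    using r1 by linarith
  then show ?thesis
    by cases
      (use k False f j r sum_block_lengths[OF a, of 1 "\<alpha> (k + 1 - L)" L] n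
        in \<open>auto simp: perm_circ_def Let_def expand_def\<close>)
qed

lemma perm_circ_1_outside: "k \<notin> {1..n + L - 1} \<Longrightarrow> perm_circ n L i \<alpha> \<tau> k = k"
  unfolding perm_circ_def by (rule if_not_P)

lemma expand_not_block: "v \<noteq> p \<Longrightarrow> \<not> (p \<le> expand p L v \<and> expand p L v < p + L)"
  by (auto simp: expand_def)

lemma expand_less_iff: "u \<noteq> p \<Longrightarrow> v \<noteq> p \<Longrightarrow> expand p L u < expand p L v \<longleftrightarrow> u < v"
  by (auto simp: expand_def)

lemma squash_expand: "v \<noteq> p \<Longrightarrow> squash p L (expand p L v) = v"
  by (auto simp: expand_def squash_def)

lemma expand_squash: "\<not> (p \<le> v \<and> v < p + L) \<Longrightarrow> expand p L (squash p L v) = v"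
  by (auto simp: expand_def squash_def)

lemma squash_neq: "\<not> (p \<le> v \<and> v < p + L) \<Longrightarrow> squash p L v \<noteq> p"
  by (auto simp: squash_def)

lemma perm_circ_1_permutes:
  assumes a: "\<alpha> permutes {1..n}" and n: "1 \<le> n" and t: "\<tau> permutes {1..L}"
  shows "perm_circ n L 1 \<alpha> \<tau> permutes {1..n + L - 1}"
proof (rule permutes_intervalI)
  let ?p = "perm_circ n L 1 \<alpha> \<tau>"
  have r1: "1 \<le> \<alpha> 1" "\<alpha> 1 \<le> n" using permutes_range[OF a, of 1] n by auto
  have low: "\<alpha> 1 \<le> ?p k \<and> ?p k < \<alpha> 1 + L" if "k \<in> {1..n + L - 1}" "k \<le> L" for k
    using perm_circ_1[OF a n that(1)] that permutes_range[OF t, of k] r1 by auto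
  have a1eq: "\<alpha> j = \<alpha> 1 \<longleftrightarrow> j = 1" for j by (rule permutes_eq_iff[OF a])
  have ne: "\<alpha> (k + 1 - L) \<noteq> \<alpha> 1" if "k \<in> {1..n + L - 1}" "\<not> k \<le> L" for k
    using that a1eq[of "k + 1 - L"] by auto
  have high: "\<not> (\<alpha> 1 \<le> ?p k \<and> ?p k < \<alpha> 1 + L)" if "k \<in> {1..n + L - 1}" "\<not> k \<le> L" for k
    using perm_circ_1[OF a n that(1)] that expand_not_block[OF ne[OF that]] by simp
  show "inj_on ?p {1..n + L - 1}"
  proof (rule inj_onI)
    fix j k assume jk: "j \<in> {1..n + L - 1}" "k \<in> {1..n + L - 1}" and eq: "?p j = ?p k"
    consider "j \<le> L" "k \<le> L" | "\<not> j \<le> L" "\<not> k \<le> L" | "(j \<le> L) \<noteq> (k \<le> L)" by blast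
    then show "j = k"
    proof cases
      case 1
      then have "\<tau> j = \<tau> k" using perm_circ_1[OF a n jk(1)] perm_circ_1[OF a n jk(2)] eq by simp
      then show ?thesis by (simp only: permutes_eq_iff[OF t])
    next
      case 2
      then have "expand (\<alpha> 1) L (\<alpha> (j + 1 - L)) = expand (\<alpha> 1) L (\<alpha> (k + 1 - L))"
        using perm_circ_1[OF a n jk(1)] perm_circ_1[OF a n jk(2)] eq by simp
      then have "\<alpha> (j + 1 - L) = \<alpha> (k + 1 - L)"
        using squash_expand[OF ne[OF jk(1) 2(1)], of L] squash_expand[OF ne[OF jk(2) 2(2)], of L] by simp
      then have "j + 1 - L = k + 1 - L" by (simp only: permutes_eq_iff[OF a])
      then show ?thesis using 2 by simp
    next
      case 3
      then show ?thesis using low[OF jk(1)] low[OF jk(2)] high[OF jk(1)] high[OF jk(2)] eq by auto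
    qed
  qed
  show "?p k \<in> {1..n + L - 1}" if k: "k \<in> {1..n + L - 1}" for k
  proof (cases "k \<le> L")
    case True
    then show ?thesis using low[OF k] r1 by auto
  next
    case False
    then have "k + 1 - L \<in> {1..n}" using k by auto
    then have "1 \<le> \<alpha> (k + 1 - L)" "\<alpha> (k + 1 - L) \<le> n"
      using permutes_range[OF a, of "k + 1 - L"] by blast+
    then show ?thesis using perm_circ_1[OF a n k] False ne[OF k False] r1 by (auto simp: expand_def)
  qed
qed (simp add: perm_circ_1_outside)

text \<open>Contracting the initial block of \<open>\<delta>\<close> to the single letter \<open>p\<close> gives \<open>\<alpha>\<close>.\<close>

lemma ex_perm_circ_1:
  assumes d: "\<delta> permutes {1..n + L - 1}" and n: "1 \<le> n" and p: "p \<in> {1..n}"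
    and img: "\<delta> ` {1..L} = {p..<p + L}"
  obtains \<alpha> \<tau> where "\<alpha> permutes {1..n}" "\<tau> permutes {1..L}" "\<alpha> 1 = p"
    "\<delta> = perm_circ n L 1 \<alpha> \<tau>"
proof -
  define \<tau> where "\<tau> k = (if k \<in> {1..L} then \<delta> k + 1 - p else k)" for k
  define \<alpha> where "\<alpha> j = (if j = 1 then p else if j \<in> {1..n} then squash p L (\<delta> (j + L - 1)) else j)" for j
  have block: "p \<le> \<delta> k \<and> \<delta> k < p + L" if "k \<in> {1..L}" for k
    using img that by (metis atLeastLessThan_iff imageI)
  have notblock: "\<not> (p \<le> \<delta> k \<and> \<delta> k < p + L)" if "k \<notin> {1..L}" for k
    using img that inj_image_mem_iff[OF permutes_inj[OF d], of k "{1..L}"] by auto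
  have inj: "\<delta> j = \<delta> k \<Longrightarrow> j = k" for j k by (simp only: permutes_eq_iff[OF d])
  have t: "\<tau> permutes {1..L}"
  proof (rule permutes_intervalI)
    show "inj_on \<tau> {1..L}"
    proof (rule inj_onI)
      fix j k assume jk: "j \<in> {1..L}" "k \<in> {1..L}" "\<tau> j = \<tau> k"
      then have "\<delta> j + 1 - p = \<delta> k + 1 - p" by (simp add: \<tau>_def)
      then have "\<delta> j = \<delta> k" using block[OF jk(1)] block[OF jk(2)] by arith
      then show "j = k" by (rule inj)
    qed
    show "\<tau> k \<in> {1..L}" if "k \<in> {1..L}" for k using block[OF that] that by (auto simp: \<tau>_def)
  qed (auto simp: \<tau>_def)
  have a: "\<alpha> permutes {1..n}"
  proof (rule permutes_intervalI)
    have nb: "\<not> (p \<le> \<delta> (j + L - 1) \<and> \<delta> (j + L - 1) < p + L)" if "j \<in> {1..n}" "j \<noteq> 1" for j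
      by (rule notblock) (use that in auto)
    show "inj_on \<alpha> {1..n}"
    proof (rule inj_onI)
      fix j k assume jk: "j \<in> {1..n}" "k \<in> {1..n}" "\<alpha> j = \<alpha> k"
      show "j = k"
      proof (cases "j = 1 \<or> k = 1")
        case True
        have "\<alpha> i \<noteq> p" if "i \<in> {1..n}" "i \<noteq> 1" for i
          using squash_neq[OF nb[OF that]] that by (simp add: \<alpha>_def)
        moreover have "\<alpha> 1 = p" by (simp add: \<alpha>_def)
        ultimately show ?thesis using True jk by metis
      next
        case False
        then have ne: "j \<noteq> 1" "k \<noteq> 1" by auto
        have e: "squash p L (\<delta> (j + L - 1)) = squash p L (\<delta> (k + L - 1))"
          using jk ne by (simp add: \<alpha>_def)
        have "\<delta> (j + L - 1) = expand p L (squash p L (\<delta> (j + L - 1)))"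
          by (rule expand_squash[OF nb[OF jk(1) ne(1)], symmetric])
        also have "\<dots> = \<delta> (k + L - 1)"
          unfolding e by (rule expand_squash[OF nb[OF jk(2) ne(2)]])
        finally have "j + L - 1 = k + L - 1" by (rule inj)
        then show ?thesis using jk by auto
      qed
    qed
    show "\<alpha> j \<in> {1..n}" if j: "j \<in> {1..n}" for j
    proof (cases "j = 1")
      case False
      then have "j + L - 1 \<in> {1..n + L - 1}" using j by auto
      then have "1 \<le> \<delta> (j + L - 1)" "\<delta> (j + L - 1) \<le> n + L - 1"
        using permutes_range[OF d] by auto
      then show ?thesis using False j p nb[OF j False] by (auto simp: \<alpha>_def squash_def)
    qed (use p in \<open>simp add: \<alpha>_def\<close>)
  qed (use n in \<open>auto simp: \<alpha>_def\<close>)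
  have a1: "\<alpha> 1 = p" by (simp add: \<alpha>_def)
  have "\<delta> k = perm_circ n L 1 \<alpha> \<tau> k" for k
  proof (cases "k \<in> {1..n + L - 1}")
    case True
    note f = perm_circ_1[OF a n True, of \<tau>]
    show ?thesis
    proof (cases "k \<le> L")
      case le: True
      then show ?thesis using f a1 block[of k] True p by (auto simp: \<tau>_def)
    next
      case False
      then have j: "k + 1 - L \<in> {1..n}" "k + 1 - L \<noteq> 1" "k + 1 - L + L - 1 = k" using True by auto
      then have "\<alpha> (k + 1 - L) = squash p L (\<delta> k)" by (simp add: \<alpha>_def)
      moreover have "expand p L (squash p L (\<delta> k)) = \<delta> k"
        by (rule expand_squash[OF notblock]) (use False in simp)
      ultimately show ?thesis using f a1 False by simp
    qed
  next
    case False
    then show ?thesis using d by (simp add: perm_circ_1_outside permutes_not_in)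
  qed
  then show thesis using that[OF a t a1] by blast
qed

lemma increasing_permutes_eq_id:
  assumes "\<tau> permutes {1..L::nat}" "\<And>j k. j \<in> {1..L} \<Longrightarrow> k \<in> {1..L} \<Longrightarrow> j < k \<Longrightarrow> \<tau> j < \<tau> k"
  shows "\<tau> = id"
proof (rule permutes_eqI_order[OF assms(1) permutes_id])
  fix j k assume jk: "j \<in> {1..L}" "k \<in> {1..L}" "j \<noteq> k"
  then show "\<tau> j < \<tau> k \<longleftrightarrow> id j < id k"
    using assms(2)[OF jk(1,2)] assms(2)[OF jk(2,1)] by (cases j k rule: linorder_cases) auto
qed

text \<open>
  The colouring \<open>col'\<close> refines \<open>col\<close> by giving the block that replaces the letter \<open>p\<close> a colour of
  its own; \<open>p\<close> has to be the first letter of its colour, since the words considered start with it.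
\<close>

lemma expand_shuffles:
  assumes n: "1 \<le> n" and p: "p \<in> {1..n}"
    and pmin: "\<And>v. v \<in> {1..n} \<Longrightarrow> col v = col p \<Longrightarrow> p \<le> v"
    and blk: "\<And>u v. u \<in> {p..<p + L} \<Longrightarrow> v \<in> {1..n + L - 1} \<Longrightarrow> col' u = col' v \<longleftrightarrow> v \<in> {p..<p + L}"
    and nblk: "\<And>u v. u \<in> {1..n + L - 1} - {p..<p + L} \<Longrightarrow> v \<in> {1..n + L - 1} - {p..<p + L} \<Longrightarrow>
      col' u = col' v \<longleftrightarrow> col (squash p L u) = col (squash p L v)"
  shows "bij_betw (\<lambda>\<alpha>. perm_circ n L 1 \<alpha> id) {\<alpha> \<in> Sh n col. \<alpha> 1 = p}
    {\<delta> \<in> Sh (n + L - 1) col'. \<delta> ` {1..L} = {p..<p + L}}"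
proof (rule bij_betwI')
  let ?N = "n + L - 1"
  fix \<alpha> \<alpha>' assume a: "\<alpha> \<in> {\<alpha> \<in> Sh n col. \<alpha> 1 = p}" "\<alpha>' \<in> {\<alpha> \<in> Sh n col. \<alpha> 1 = p}"
  have ap: "\<alpha> permutes {1..n}" "\<alpha>' permutes {1..n}" using a by (auto simp: Sh_def)
  have "\<alpha> = \<alpha>'" if eq: "perm_circ n L 1 \<alpha> id = perm_circ n L 1 \<alpha>' id"
  proof
    fix j
    consider "j = 1" | "j \<notin> {1..n}" | "j \<in> {1..n}" "j \<noteq> 1" by blast
    then show "\<alpha> j = \<alpha>' j"
    proof cases
      case 3
      then have k: "j + L - 1 \<in> {1..?N}" "\<not> j + L - 1 \<le> L" "j + L - 1 + 1 - L = j" by auto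
      have "\<alpha> 1 = p" "\<alpha>' 1 = p" using a by auto
      then have "expand p L (\<alpha> j) = perm_circ n L 1 \<alpha> id (j + L - 1)"
        "expand p L (\<alpha>' j) = perm_circ n L 1 \<alpha>' id (j + L - 1)"
        unfolding perm_circ_1[OF ap(1) n k(1)] perm_circ_1[OF ap(2) n k(1)] k(3)
        using k(2) by auto
      then have e: "expand p L (\<alpha> j) = expand p L (\<alpha>' j)" unfolding eq by (rule trans[OF _ sym])
      have "\<alpha> j \<noteq> \<alpha> 1" "\<alpha>' j \<noteq> \<alpha>' 1"
        unfolding permutes_eq_iff[OF ap(1)] permutes_eq_iff[OF ap(2)] by (rule 3(2))+
      then have ne: "\<alpha> j \<noteq> p" "\<alpha>' j \<noteq> p" unfolding \<open>\<alpha> 1 = p\<close> \<open>\<alpha>' 1 = p\<close> .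
      have "\<alpha> j = squash p L (expand p L (\<alpha> j))" by (rule squash_expand[OF ne(1), symmetric])
      also have "\<dots> = \<alpha>' j" unfolding e by (rule squash_expand[OF ne(2)])
      finally show ?thesis .
    qed (use a ap in \<open>auto simp: permutes_not_in\<close>)
  qed
  then show "(perm_circ n L 1 \<alpha> id = perm_circ n L 1 \<alpha>' id) = (\<alpha> = \<alpha>')" by auto
next
  let ?N = "n + L - 1"
  fix \<alpha> assume "\<alpha> \<in> {\<alpha> \<in> Sh n col. \<alpha> 1 = p}"
  then have a: "\<alpha> \<in> Sh n col" "\<alpha> 1 = p" by auto
  note ap = Sh_permutes[OF a(1)]
  let ?d = "perm_circ n L 1 \<alpha> id"
  have dp: "?d permutes {1..?N}" by (rule perm_circ_1_permutes[OF ap n permutes_id])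
  have low: "?d k = p - 1 + k" if "k \<in> {1..L}" for k
  proof -
    have "k \<in> {1..?N}" using that n by auto
    then show ?thesis using perm_circ_1[OF ap n, of k L id] that a by simp
  qed
  have high: "?d k = expand p L (\<alpha> (k + 1 - L))" "\<alpha> (k + 1 - L) \<noteq> p" "k + 1 - L \<in> {1..n}"
    if "k \<in> {1..?N}" "\<not> k \<le> L" for k
    using perm_circ_1[OF ap n, of k L id] that a permutes_eq_iff[OF ap, of "k + 1 - L" 1] by auto
  have img: "?d ` {1..L} = {p..<p + L}"
  proof (rule antisym; rule subsetI)
    fix v assume "v \<in> {p..<p + L}"
    then have v: "v + 1 - p \<in> {1..L}" by auto
    moreover have "v = ?d (v + 1 - p)" using low[OF v] p \<open>v \<in> {p..<p + L}\<close> by auto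
    ultimately show "v \<in> ?d ` {1..L}" by (rule rev_image_eqI)
  qed (use low p in auto)
  have "?d j < ?d k" if jk: "j \<in> {1..?N}" "k \<in> {1..?N}" "j < k" "col' (?d j) = col' (?d k)" for j k
  proof -
    have r: "?d j \<in> {1..?N}" "?d k \<in> {1..?N}" using jk permutes_in_image[OF dp] by auto
    consider "k \<le> L" | "j \<le> L" "\<not> k \<le> L" | "\<not> j \<le> L" "\<not> k \<le> L" by linarith
    then show ?thesis
    proof cases
      case 1
      then show ?thesis using low[of j] low[of k] jk by simp
    next
      case 2
      have "?d j \<in> {p..<p + L}" using low[of j] 2 jk p by auto
      moreover have "?d k \<notin> {p..<p + L}"
        using high[OF jk(2) 2(2)] expand_not_block[OF high(2)[OF jk(2) 2(2)], of L] by simp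
      ultimately show ?thesis using blk[of "?d j" "?d k"] r jk(4) by simp
    next
      case 3
      note hj = high[OF jk(1) 3(1)] and hk = high[OF jk(2) 3(2)]
      have nb: "?d j \<notin> {p..<p + L}" "?d k \<notin> {p..<p + L}"
        using hj hk expand_not_block[OF hj(2), of L] expand_not_block[OF hk(2), of L] by auto
      then have "col (squash p L (?d j)) = col (squash p L (?d k))" using nblk[of "?d j" "?d k"] r jk(4) by simp
      then have "col (\<alpha> (j + 1 - L)) = col (\<alpha> (k + 1 - L))"
        using hj hk by (simp add: squash_expand)
      then have "\<alpha> (j + 1 - L) < \<alpha> (k + 1 - L)"
        using Sh_mono_iff[OF a(1) hj(3) hk(3)] jk(3) 3 by simp
      then show ?thesis using hj hk by (simp add: expand_less_iff)
    qed
  qed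
  then show "?d \<in> {\<delta> \<in> Sh ?N col'. \<delta> ` {1..L} = {p..<p + L}}" using dp img by (simp add: Sh_def)
next
  let ?N = "n + L - 1"
  fix \<delta> assume "\<delta> \<in> {\<delta> \<in> Sh ?N col'. \<delta> ` {1..L} = {p..<p + L}}"
  then have d: "\<delta> \<in> Sh ?N col'" "\<delta> ` {1..L} = {p..<p + L}" by auto
  note dp = Sh_permutes[OF d(1)]
  obtain \<alpha> \<tau> where ap: "\<alpha> permutes {1..n}" and tp: "\<tau> permutes {1..L}" and a1: "\<alpha> 1 = p"
    and eq: "\<delta> = perm_circ n L 1 \<alpha> \<tau>"
    using ex_perm_circ_1[OF dp n p d(2)] by blast
  have "\<tau> j < \<tau> k" if jk: "j \<in> {1..L}" "k \<in> {1..L}" "j < k" for j k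
  proof -
    have r: "j \<in> {1..?N}" "k \<in> {1..?N}" using jk n by auto
    have m: "\<delta> j \<in> {p..<p + L}" "\<delta> k \<in> {p..<p + L}" using d(2) jk by auto
    have "col' (\<delta> j) = col' (\<delta> k)"
      using blk[OF m(1), of "\<delta> k"] m permutes_in_image[OF dp, of k] r by blast
    then have "\<delta> j < \<delta> k" using Sh_mono_iff[OF d(1) r] jk(3) by simp
    then show ?thesis
      using perm_circ_1[OF ap n r(1), of \<tau>] perm_circ_1[OF ap n r(2), of \<tau>] jk eq by simp
  qed
  \<comment> \<open>The block has a single colour, so that its letters come in order.\<close>
  then have t: "\<tau> = id" by (rule increasing_permutes_eq_id[OF tp])
  have "\<alpha> j < \<alpha> k" if jk: "j \<in> {1..n}" "k \<in> {1..n}" "j < k" "col (\<alpha> j) = col (\<alpha> k)" for j k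
  proof (cases "j = 1")
    case True
    then have "p \<le> \<alpha> k" using pmin[of "\<alpha> k"] jk a1 permutes_in_image[OF ap] by auto
    moreover have "\<alpha> k \<noteq> p" using True jk(3) a1 permutes_eq_iff[OF ap, of k 1] by auto
    ultimately show ?thesis using True a1 by simp
  next
    case False
    let ?j = "j + L - 1" and ?k = "k + L - 1"
    have r: "?j \<in> {1..?N}" "?k \<in> {1..?N}" "\<not> ?j \<le> L" "\<not> ?k \<le> L" "?j + 1 - L = j" "?k + 1 - L = k"
      using jk False by auto
    have ne: "\<alpha> j \<noteq> p" "\<alpha> k \<noteq> p" using False jk a1 permutes_eq_iff[OF ap, of j 1] permutes_eq_iff[OF ap, of k 1] by auto
    have e: "\<delta> ?j = expand p L (\<alpha> j)" "\<delta> ?k = expand p L (\<alpha> k)"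
      using perm_circ_1[OF ap n r(1), of \<tau>] perm_circ_1[OF ap n r(2), of \<tau>] r a1 eq by auto
    have nb: "\<delta> ?j \<notin> {p..<p + L}" "\<delta> ?k \<notin> {p..<p + L}"
      using e expand_not_block[OF ne(1), of L] expand_not_block[OF ne(2), of L] by auto
    have "\<delta> ?j \<in> {1..?N}" "\<delta> ?k \<in> {1..?N}" using r permutes_in_image[OF dp] by auto
    then have "col' (\<delta> ?j) = col' (\<delta> ?k)"
      using nblk[of "\<delta> ?j" "\<delta> ?k"] nb jk(4)
      unfolding e squash_expand[OF ne(1)] squash_expand[OF ne(2)] by blast
    moreover have "?j < ?k" using jk r by auto
    ultimately have "\<delta> ?j < \<delta> ?k" using Sh_mono_iff[OF d(1) r(1,2)] by blast
    then show ?thesis unfolding e expand_less_iff[OF ne] .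
  qed
  then have "\<alpha> \<in> Sh n col" using ap by (simp add: Sh_def)
  then show "\<exists>\<alpha>\<in>{\<alpha> \<in> Sh n col. \<alpha> 1 = p}. \<delta> = perm_circ n L 1 \<alpha> id"
    using eq t a1 by blast
qed

definition blocks :: "nat \<Rightarrow> nat \<Rightarrow> nat \<Rightarrow> nat" where
  "blocks x y v = (if v \<le> x then 0 else if v \<le> x + y then 1 else 2)"

lemma sum_expand_shuffles:
  assumes n: "1 \<le> n" and p: "p \<in> {1..n}" 
    and pmin: "\<And>v. v \<in> {1..n} \<Longrightarrow> col v = col p \<Longrightarrow> p \<le> v"
    and blk: "\<And>u v. u \<in> {p..<p + L} \<Longrightarrow> v \<in> {1..n + L - 1} \<Longrightarrow> col' u = col' v \<longleftrightarrow> v \<in> {p..<p + L}"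
    and nblk: "\<And>u v. u \<in> {1..n + L - 1} - {p..<p + L} \<Longrightarrow> v \<in> {1..n + L - 1} - {p..<p + L} \<Longrightarrow>
      col' u = col' v \<longleftrightarrow> col (squash p L u) = col (squash p L v)"
  shows "(\<Sum>\<alpha> | \<alpha> \<in> Sh n col \<and> \<alpha> 1 = p. \<Sum>\<beta>\<in>Sh (n + L - 1) (\<lambda>v. v \<le> L). 
      F (perm_circ n L 1 \<alpha> id \<circ> \<beta>)) = (\<Sum>\<gamma>\<in>Sh (n + L - 1) col'. F \<gamma>)"
proof -
  let ?N = "n + L - 1"
  let ?D = "{\<delta> \<in> Sh ?N col'. \<delta> ` {1..L} = {p..<p + L}}"
  have T: "{p..<p + L} \<subseteq> {1..?N}" "card {p..<p + L} = L" using p by auto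
  have sat: "u \<in> {p..<p + L} \<longleftrightarrow> v \<in> {p..<p + L}"
    if "u \<in> {1..?N}" "v \<in> {1..?N}" "col' u = col' v" for u v
    using blk[of u v] blk[of v u] that by metis
  have "(\<Sum>\<alpha> | \<alpha> \<in> Sh n col \<and> \<alpha> 1 = p. \<Sum>\<beta>\<in>Sh ?N (\<lambda>v. v \<le> L). F (perm_circ n L 1 \<alpha> id \<circ> \<beta>)) =
      (\<Sum>\<delta>\<in>?D. \<Sum>\<beta>\<in>Sh ?N (\<lambda>v. v \<le> L). F (\<delta> \<circ> \<beta>))"
    by (rule sum.reindex_bij_betw[OF expand_shuffles[OF n p pmin blk nblk]])
  also have "\<dots> = (\<Sum>x\<in>?D \<times> Sh ?N (\<lambda>v. v \<le> L). F (case x of (\<delta>, \<beta>) \<Rightarrow> \<delta> \<circ> \<beta>))"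
    unfolding sum.cartesian_product by (rule sum.cong) auto
  also have "\<dots> = (\<Sum>\<gamma>\<in>Sh ?N col'. F \<gamma>)"
    by (rule sum.reindex_bij_betw[OF shuffle_factorization[OF T sat]])
  finally show ?thesis .
qed

text \<open>
  The two iterated shuffle sums in $(f \Box g) \Box h$, where \<open>g\<close> and \<open>h\<close> have arities \<open>b\<close> and \<open>c\<close> and \<open>f\<close>
  has arity \<open>a + 1\<close>. The word \<open>\<alpha>\<close> shuffles the inputs of \<open>g\<close> (its first block) with the other inputs
  of \<open>f\<close>, and \<open>h\<close> is inserted at the input \<open>\<alpha> 1\<close>. If this is the first free input of \<open>f\<close>, the outcome
  is the sum over the shuffles of the inputs of \<open>g\<close>, those of \<open>h\<close> and the \<open>a - 1\<close> remaining ones of \<open>f\<close>;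
  if it is the first input of \<open>g\<close>, that input is used up and the inputs of \<open>h\<close> come first.
\<close>

lemma sum_shuffles_second_first:
  assumes "1 \<le> a"
  shows "(\<Sum>\<alpha> | \<alpha> \<in> Sh (a + b) (\<lambda>v. v \<le> b) \<and> \<alpha> 1 = b + 1. \<Sum>\<beta>\<in>Sh (a + b + c - 1) (\<lambda>v. v \<le> c).
      F (perm_circ (a + b) c 1 \<alpha> id \<circ> \<beta>)) = (\<Sum>\<gamma>\<in>Sh (a + b + c - 1) (blocks b c). F \<gamma>)"
  by (rule sum_expand_shuffles) (use assms in \<open>auto simp: blocks_def squash_def\<close>)

lemma sum_shuffles_first_first:
  assumes "1 \<le> b"
  shows "(\<Sum>\<alpha> | \<alpha> \<in> Sh (a + b) (\<lambda>v. v \<le> b) \<and> \<alpha> 1 = 1. \<Sum>\<beta>\<in>Sh (a + b + c - 1) (\<lambda>v. v \<le> c).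
      F (perm_circ (a + b) c 1 \<alpha> id \<circ> \<beta>)) = (\<Sum>\<gamma>\<in>Sh (a + b + c - 1) (blocks c (b - 1)). F \<gamma>)"
  by (rule sum_expand_shuffles) (use assms in \<open>auto simp: blocks_def squash_def\<close>)

text \<open>The first letter of a word is the smallest letter of its block.\<close>

lemma shuffle_first_letter:
  assumes "\<alpha> \<in> Sh (a + b) (\<lambda>v. v \<le> b)" "1 \<le> a + b"
  shows "\<alpha> 1 = 1 \<and> 1 \<le> b \<or> \<alpha> 1 = b + 1 \<and> 1 \<le> a"
proof -
  note p = Sh_permutes[OF assms(1)]
  have r: "1 \<le> \<alpha> 1" "\<alpha> 1 \<le> a + b" using permutes_range[OF p, of 1] assms(2) by auto
  have no: False if "u \<in> {1..a + b}" "u < \<alpha> 1" "(u \<le> b) = (\<alpha> 1 \<le> b)" for u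
  proof -
    have "inv \<alpha> u \<in> {1..a + b}" using that permutes_in_image[OF permutes_inv[OF p]] by auto
    then have "inv \<alpha> u < 1"
      using Sh_mono_iff[OF assms(1), of "inv \<alpha> u" 1] that assms(2) by (simp add: permutes_inverses[OF p])
    then show False using \<open>inv \<alpha> u \<in> {1..a + b}\<close> by simp
  qed
  show ?thesis
  proof (cases "\<alpha> 1 \<le> b")
    case True
    then show ?thesis using no[of 1] r by fastforce
  next
    case False
    then show ?thesis using no[of "b + 1"] r by fastforce
  qed
qed

text \<open>
  The iterated shuffle sum in $f \Box (g \Box h)$: the inputs of \<open>h\<close> and \<open>g\<close> are shuffled among themselves
  and then, as one block, with those of \<open>f\<close>. In terms of the factorization above, a word that preserves
  the first \<open>b + c\<close> letters and keeps the others in order fixes the latter.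
\<close>

lemma sum_shuffles_nested:
  "(\<Sum>\<tau>\<in>Sh (b + c) (\<lambda>v. v \<le> c). \<Sum>\<sigma>\<in>Sh (a + (b + c)) (\<lambda>v. v \<le> b + c). F (\<tau> \<circ> \<sigma>)) =
    (\<Sum>\<gamma>\<in>Sh (a + (b + c)) (blocks c b). F \<gamma>)"
proof -
  let ?N = "a + (b + c)" and ?M = "b + c"
  let ?D = "{\<delta> \<in> Sh ?N (blocks c b). \<delta> ` {1..?M} = {1..?M}}"
  have "?D = Sh ?M (\<lambda>v. v \<le> c)"
  proof (rule antisym; rule subsetI)
    fix \<delta> assume "\<delta> \<in> ?D"
    then have d: "\<delta> \<in> Sh ?N (blocks c b)" "\<delta> ` {1..?M} = {1..?M}" by auto
    note dp = Sh_permutes[OF d(1)]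
    have "\<delta> v \<in> {1..?M} \<longleftrightarrow> v \<in> {1..?M}" for v
      using inj_image_mem_iff[OF permutes_inj[OF dp], of v "{1..?M}"] d(2) by simp
    then have side: "v \<in> {1..?N} \<Longrightarrow> \<delta> v \<le> ?M \<longleftrightarrow> v \<le> ?M" for v
      using permutes_range[OF dp, of v] by auto
    have m: "\<delta> j < \<delta> k" if "j \<in> {1..?N}" "k \<in> {1..?N}" "j < k" "blocks c b (\<delta> j) = blocks c b (\<delta> k)" for j k
      using Sh_mono_iff[OF d(1)] that by simp
    define \<epsilon> where "\<epsilon> v = (if v \<le> ?M then v else \<delta> v)" for v
    have "\<epsilon> permutes {1..?N}"
    proof (rule permutes_intervalI)
      show "inj_on \<epsilon> {1..?N}"
      proof (rule inj_onI)
        fix j k assume "j \<in> {1..?N}" "k \<in> {1..?N}" "\<epsilon> j = \<epsilon> k"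
        then show "j = k"
          using side[of j] side[of k] permutes_eq_iff[OF dp, of j k] by (auto simp: \<epsilon>_def split: if_splits)
      qed
      show "\<epsilon> k \<in> {1..?N}" if "k \<in> {1..?N}" for k
        using that permutes_in_image[OF dp] by (simp add: \<epsilon>_def)
    qed (use dp in \<open>auto simp: \<epsilon>_def permutes_not_in\<close>)
    then have eid: "\<epsilon> = id"
    proof (rule increasing_permutes_eq_id)
      fix j k assume jk: "j \<in> {1..?N}" "k \<in> {1..?N}" "j < k"
      consider "k \<le> ?M" | "j \<le> ?M" "\<not> k \<le> ?M" | "\<not> j \<le> ?M" "\<not> k \<le> ?M" by linarith
      then show "\<epsilon> j < \<epsilon> k"
      proof cases
        case 3
        then have "blocks c b (\<delta> j) = blocks c b (\<delta> k)"
          using side[OF jk(1)] side[OF jk(2)] by (auto simp: blocks_def)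
        then show ?thesis using m[OF jk] 3 by (simp add: \<epsilon>_def)
      qed (use side[OF jk(2)] jk in \<open>auto simp: \<epsilon>_def\<close>)
    qed
    have out: "\<delta> v = v" if "\<not> v \<le> ?M" for v
      using that fun_cong[OF eid, of v] by (simp add: \<epsilon>_def)
    have "\<delta> permutes {1..?M}"
    proof (rule permutes_intervalI)
      show "inj_on \<delta> {1..?M}" by (rule inj_on_subset[OF permutes_inj[OF dp] subset_UNIV])
      show "\<delta> k = k" if "k \<notin> {1..?M}" for k
        using that out[of k] dp by (cases "k = 0") (auto simp: permutes_not_in)
    qed (use d(2) in blast)
    moreover have "\<delta> j < \<delta> k"
      if jk: "j \<in> {1..?M}" "k \<in> {1..?M}" "j < k" "(\<delta> j \<le> c) = (\<delta> k \<le> c)" for j k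
      using m[of j k] jk side[of j] side[of k] by (auto simp: blocks_def)
    ultimately show "\<delta> \<in> Sh ?M (\<lambda>v. v \<le> c)" by (simp add: Sh_def)
  next
    fix \<delta> assume d: "\<delta> \<in> Sh ?M (\<lambda>v. v \<le> c)"
    note dp = Sh_permutes[OF d]
    have dN: "\<delta> permutes {1..?N}" by (rule permutes_subset[OF dp]) auto
    have out: "v \<notin> {1..?M} \<Longrightarrow> \<delta> v = v" for v by (rule permutes_not_in[OF dp])
    have "\<delta> j < \<delta> k"
      if jk: "j \<in> {1..?N}" "k \<in> {1..?N}" "j < k" "blocks c b (\<delta> j) = blocks c b (\<delta> k)" for j k
    proof (cases "k \<le> ?M")
      case True
      then have r: "j \<in> {1..?M}" "k \<in> {1..?M}" using jk by auto
      have "(\<delta> j \<le> c) = (\<delta> k \<le> c)"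
        using jk(4) permutes_range[OF dp r(1)] permutes_range[OF dp r(2)]
        by (auto simp: blocks_def split: if_splits)
      then show ?thesis using Sh_mono_iff[OF d r] jk(3) by simp
    next
      case False
      then show ?thesis
        using out[of k] out[of j] jk permutes_range[OF dp, of j] by (cases "j \<le> ?M") auto
    qed
    then show "\<delta> \<in> ?D" using dN permutes_image[OF dp] by (simp add: Sh_def)
  qed
  moreover have "bij_betw (\<lambda>(\<delta>, \<beta>). \<delta> \<circ> \<beta>) (?D \<times> Sh ?N (\<lambda>v. v \<le> ?M)) (Sh ?N (blocks c b))"
    by (rule shuffle_factorization) (auto simp: blocks_def split: if_splits)
  ultimately have bij: "bij_betw (\<lambda>(\<delta>, \<beta>). \<delta> \<circ> \<beta>) (Sh ?M (\<lambda>v. v \<le> c) \<times> Sh ?N (\<lambda>v. v \<le> ?M)) (Sh ?N (blocks c b))"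
    by simp
  have "(\<Sum>\<tau>\<in>Sh ?M (\<lambda>v. v \<le> c). \<Sum>\<sigma>\<in>Sh ?N (\<lambda>v. v \<le> ?M). F (\<tau> \<circ> \<sigma>)) =
      (\<Sum>x\<in>Sh ?M (\<lambda>v. v \<le> c) \<times> Sh ?N (\<lambda>v. v \<le> ?M). F (case x of (\<tau>, \<sigma>) \<Rightarrow> \<tau> \<circ> \<sigma>))"
    unfolding sum.cartesian_product by (rule sum.cong) auto
  also have "\<dots> = (\<Sum>\<gamma>\<in>Sh ?N (blocks c b). F \<gamma>)" by (rule sum.reindex_bij_betw[OF bij])
  finally show ?thesis .
qed

definition block_swap :: "nat \<Rightarrow> nat \<Rightarrow> nat \<Rightarrow> nat" where
  "block_swap b c k = (if k \<in> {1..b} then k + c else if k \<in> {b + 1..b + c} then k - b else k)"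

lemma block_swap_inverse: "block_swap c b (block_swap b c k) = k"
  by (auto simp: block_swap_def)

lemma block_swap_permutes:
  assumes "b + c \<le> N" shows "block_swap b c permutes {1..N}"
proof (rule permutes_intervalI)
  show "inj_on (block_swap b c) {1..N}" by (rule inj_onI) (metis block_swap_inverse)
qed (use assms in \<open>auto simp: block_swap_def\<close>)

lemma sum_block_swap:
  assumes "b + c \<le> N"
  shows "(\<Sum>\<gamma>\<in>Sh N (blocks b c). F (block_swap b c \<circ> \<gamma>)) = (\<Sum>\<gamma>\<in>Sh N (blocks c b). F \<gamma>)"
proof -
  have mem: "block_swap b c \<circ> \<gamma> \<in> Sh N (blocks c b)"
    if bc: "b + c \<le> N" and g: "\<gamma> \<in> Sh N (blocks b c)" for b c \<gamma>
  proof -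
    note p = Sh_permutes[OF g]
    have "block_swap b c (\<gamma> j) < block_swap b c (\<gamma> k)"
      if jk: "j \<in> {1..N}" "k \<in> {1..N}" "j < k"
        "blocks c b (block_swap b c (\<gamma> j)) = blocks c b (block_swap b c (\<gamma> k))" for j k
    proof -
      have r: "1 \<le> \<gamma> j" "1 \<le> \<gamma> k" using permutes_range[OF p] jk by auto
      then have "blocks b c (\<gamma> j) = blocks b c (\<gamma> k)"
        using jk(4) by (auto simp: blocks_def block_swap_def split: if_splits)
      then have "\<gamma> j < \<gamma> k" "blocks b c (\<gamma> j) = blocks b c (\<gamma> k)"
        using Sh_mono_iff[OF g jk(1,2)] jk(3) by auto
      then show ?thesis using r by (auto simp: blocks_def block_swap_def split: if_splits)
    qed
    then show ?thesis using permutes_compose[OF p block_swap_permutes[OF bc]] by (simp add: Sh_def)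
  qed
  show ?thesis
    by (rule sum.reindex_bij_witness[where i = "\<lambda>\<gamma>. block_swap c b \<circ> \<gamma>" and j = "\<lambda>\<gamma>. block_swap b c \<circ> \<gamma>"])
      (use mem assms in \<open>auto simp: fun_eq_iff block_swap_inverse add.commute\<close>)
qed

text \<open>
  The block swap arises from the transposition of the first two inputs of \<open>f\<close> by inserting one element
  into the second input and the other into the first.
\<close>

lemma perm_circ_transpose:
  assumes n: "2 \<le> n" and k: "k \<in> {1..n + c - 1}"
  shows "perm_circ n c 2 (transpose 1 2) id k = (if k = 1 then c + 1 else if k \<le> c + 1 then k - 1 else k)"
proof -
  have a: "transpose 1 (2::nat) permutes {1..n}" by (rule permutes_swap_id) (use n in auto)
  have t: "transpose 1 2 (Suc 0) = (2::nat)" "transpose 1 2 2 = (1::nat)"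
    by (simp_all add: transpose_def)
  note s = sum_block_lengths[OF a, of 2 _ c]
  consider "k = 1" | "1 < k" "k \<le> c + 1" | "c + 1 < k" using k by fastforce
  then show ?thesis
  proof cases
    case 1
    then show ?thesis using s[of 2] n k by (simp add: perm_circ_def factor_of_def t Let_def)
  next
    case 2
    then show ?thesis using s[of 1] n k by (auto simp: perm_circ_def factor_of_def t Let_def)
  next
    case 3
    then have "k + 1 - c \<noteq> 1" "k + 1 - c \<noteq> 2" by arith+
    then have "transpose 1 2 (k + 1 - c) = k + 1 - c" by (simp add: transpose_def)
    then show ?thesis using 3 s[of "k + 1 - c"] n k
      by (auto simp: perm_circ_def factor_of_def t Let_def)
  qed
qed

lemma perm_circ_transpose_permutes:
  assumes n: "2 \<le> n"
  shows "perm_circ n c 2 (transpose 1 2) id permutes {1..n + c - 1}"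
proof (rule permutes_intervalI)
  show "inj_on (perm_circ n c 2 (transpose 1 2) id) {1..n + c - 1}"
  proof (rule inj_onI)
    fix j k assume jk: "j \<in> {1..n + c - 1}" "k \<in> {1..n + c - 1}"
      "perm_circ n c 2 (transpose 1 2) id j = perm_circ n c 2 (transpose 1 2) id k"
    show "j = k"
      using jk(3) unfolding perm_circ_transpose[OF n jk(1)] perm_circ_transpose[OF n jk(2)]
      using jk(1,2) by (auto split: if_splits)
  qed
  show "perm_circ n c 2 (transpose 1 2) id k \<in> {1..n + c - 1}" if "k \<in> {1..n + c - 1}" for k
    unfolding perm_circ_transpose[OF n that] using that n by auto
qed (simp add: perm_circ_1_outside)

lemma perm_circ_block_swap:
  assumes n: "2 \<le> n"
  shows "perm_circ (n + c - 1) b 1 (perm_circ n c 2 (transpose 1 2) id) id = block_swap b c"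
proof
  fix k
  let ?t = "perm_circ n c 2 (transpose 1 2) id"
  have t1: "?t 1 = c + 1" using perm_circ_transpose[OF n, of 1 c] n by simp
  show "perm_circ (n + c - 1) b 1 ?t id k = block_swap b c k"
  proof (cases "k \<in> {1..n + c - 1 + b - 1}")
    case True
    note f = perm_circ_1[OF perm_circ_transpose_permutes[OF n] _ True, of id]
    show ?thesis
    proof (cases "k \<le> b")
      case le: True
      then show ?thesis using f t1 True n by (simp add: block_swap_def)
    next
      case False
      then have "k + 1 - b \<in> {1..n + c - 1}" using True by auto
      then have "?t (k + 1 - b) = (if k + 1 - b \<le> c + 1 then k - b else k + 1 - b)"
        using perm_circ_transpose[OF n, of "k + 1 - b" c] False by auto
      then show ?thesis using f t1 True False n by (auto simp: block_swap_def expand_def)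
    qed
  next
    case False
    then show ?thesis using n by (auto simp: perm_circ_1_outside block_swap_def)
  qed
qed

section \<open>Operads with everywhere additive operations\<close>

lemma koszul_additive: "additive e \<Longrightarrow> e (koszul p q x) = koszul p q (e x)"
  by (simp add: koszul_def additive.minus)

lemma additive_koszul: "additive (koszul p q)"
  by (simp add: koszul_def additive_def)

lemma koszul_koszul: "koszul p q (koszul p q x) = x"
  by (simp add: koszul_def)

lemma koszul_commute: "koszul p q = koszul q p"
  by (auto simp: koszul_def fun_eq_iff)

lemma perm_circ_id_left:
  assumes t: "\<tau> permutes {1..L}" and n: "1 \<le> n"
  shows "perm_circ n L 1 id \<tau> = \<tau>"
proof
  fix k
  show "perm_circ n L 1 id \<tau> k = \<tau> k"
  proof (cases "k \<in> {1..n + L - 1}")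
    case True
    then show ?thesis
      using perm_circ_1[OF permutes_id n True, of \<tau>] permutes_not_in[OF t, of k]
      by (auto simp: expand_def)
  next
    case False
    then show ?thesis using n permutes_not_in[OF t, of k] by (auto simp: perm_circ_1_outside)
  qed
qed

lemma additive_poly_poly_const: "additive (\<lambda>c::'v::ab_group_add. [:[:c:]:])"
  by (simp add: additive_def)

lemma additive_mlam: "additive (mlam :: 'v::ab_group_add poly poly \<Rightarrow> _)"
  by (simp add: additive_def mlam_def)

lemma additive_mmu: "additive (mmu :: 'v::ab_group_add poly poly \<Rightarrow> _)"
  unfolding mmu_def[abs_def] by (intro additive_intros)

lemma additive_mlammu: "additive (mlammu :: 'v::ab_group_add poly poly \<Rightarrow> _)"
  unfolding mlammu_def[abs_def] by (intro additive_intros additive_mlam additive_mmu)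

lemma mlam_mmu: "mlam (mmu x) = mmu (mlam (x :: 'v::ab_group_add poly poly))"
  by (simp add: mlam_def mmu_def map_poly_pCons0 additive_pCons)

text \<open>
  Evaluation of the two variables of $V[\lambda,\mu]$ at commuting operators \<open>X\<close>, \<open>Y\<close>. It turns the
  associativity axioms, which hold for the formal variables, into identities between operators.
\<close>

context
  fixes X Y :: "'m::ab_group_add \<Rightarrow> 'm" and \<kappa> :: "'v::ab_group_add \<Rightarrow> 'm"
  assumes X: "additive X" and Y: "additive Y" and \<kappa>: "additive \<kappa>" and XY: "\<And>x. X (Y x) = Y (X x)"
begin

lemma additive_eval2: "additive (psubst X (psubst Y \<kappa>))"
  by (intro additive_psubst X Y \<kappa>)

lemma eval2_mlam: "psubst X (psubst Y \<kappa>) (mlam x) = X (psubst X (psubst Y \<kappa>) x)"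
  by (simp add: mlam_def psubst_pCons[OF X additive_psubst[OF Y \<kappa>]] additive.zero[OF \<kappa>])

lemma eval2_mmu: "psubst X (psubst Y \<kappa>) (mmu x) = Y (psubst X (psubst Y \<kappa>) x)"
proof -
  have "psubst X (psubst Y \<kappa>) (mmu x) = psubst X (\<lambda>c. psubst Y \<kappa> (pCons 0 c)) x"
    unfolding mmu_def by (rule psubst_map_poly[OF X additive_psubst[OF Y \<kappa>] additive_pCons])
  also have "\<dots> = psubst X (\<lambda>c. Y (psubst Y \<kappa> c)) x"
    by (simp add: psubst_pCons[OF Y \<kappa>] additive.zero[OF \<kappa>])
  also have "\<dots> = Y (psubst X (psubst Y \<kappa>) x)"
    by (rule psubst_natural[OF Y, symmetric]) (simp add: XY)
  finally show ?thesis .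
qed

lemma eval2_mlammu:
  "psubst X (psubst Y \<kappa>) (mlammu x) = X (psubst X (psubst Y \<kappa>) x) + Y (psubst X (psubst Y \<kappa>) x)"
  by (simp add: mlammu_def additive.add[OF additive_eval2] eval2_mlam eval2_mmu)

lemma eval2_const: "psubst X (psubst Y \<kappa>) [:[:c:]:] = \<kappa> c"
proof -
  have "psubst X (psubst Y \<kappa>) [:[:c:]:] = psubst Y \<kappa> [:c:]" by (rule psubst_const[OF X additive_psubst[OF Y \<kappa>]])
  also have "\<dots> = \<kappa> c" by (rule psubst_const[OF Y \<kappa>])
  finally show ?thesis .
qed

lemma eval2_var_to:
  assumes "\<And>x. psubst X (psubst Y \<kappa>) (A x) = A' (psubst X (psubst Y \<kappa>) x)"
  shows "psubst X (psubst Y \<kappa>) (var_to A q) = psubst A' \<kappa> q"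
  unfolding var_to_def psubst_natural[where A' = A', of "psubst X (psubst Y \<kappa>)", OF additive_eval2 assms] eval2_const
  by (rule refl)

end

text \<open>
  A conformal pseudo operad whose operations are additive on the whole ambient space, with projections
  \<open>pr n p\<close> to the homogeneous parts. Additivity without membership conditions is what makes the
  calculus of substitutions applicable to arbitrary polynomials. The identity permutation acts as
  a projection, which is invisible to the products. In the equivariance axiom, that the composite is a
  permutation is a premise; it is verified for the two kinds of composites that occur.
\<close>

locale total_operad =
  fixes scale :: "'f::field \<Rightarrow> 'v::ab_group_add \<Rightarrow> 'v"
    and P :: "nat \<Rightarrow> bit \<Rightarrow> 'v set"
    and d :: "nat \<Rightarrow> 'v \<Rightarrow> 'v"
    and act :: "nat \<Rightarrow> (nat \<Rightarrow> nat) \<Rightarrow> 'v \<Rightarrow> 'v"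
    and circ :: "nat \<Rightarrow> nat \<Rightarrow> nat \<Rightarrow> 'v \<Rightarrow> 'v \<Rightarrow> 'v poly"
    and pr :: "nat \<Rightarrow> bit \<Rightarrow> 'v \<Rightarrow> 'v"
  assumes superspace: "\<And>n. superspace scale (P n)"
    and pr_add: "\<And>n p. additive (pr n p)"
    and pr_scale: "\<And>n p c x. pr n p (scale c x) = scale c (pr n p x)"
    and pr_in: "\<And>n p x. pr n p x \<in> P n p"
    and pr_id: "\<And>n p x. x \<in> P n p \<Longrightarrow> pr n p x = x"
    and pr_other: "\<And>n p q x. x \<in> P n q \<Longrightarrow> p \<noteq> q \<Longrightarrow> pr n p x = 0"
    and d_add: "\<And>n. additive (d n)"
    and d_scale: "\<And>n c x. d n (scale c x) = scale c (d n x)"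
    and d_in: "\<And>n p x. x \<in> P n p \<Longrightarrow> d n x \<in> P n p"
    and act_add: "\<And>n \<sigma>. additive (act n \<sigma>)"
    and act_scale: "\<And>n \<sigma> c x. act n \<sigma> (scale c x) = scale c (act n \<sigma> x)"
    and act_in: "\<And>n \<sigma> p x. \<sigma> permutes {1..n} \<Longrightarrow> x \<in> P n p \<Longrightarrow> act n \<sigma> x \<in> P n p"
    and act_comp: "\<And>n \<sigma> \<tau> f. \<sigma> permutes {1..n} \<Longrightarrow> \<tau> permutes {1..n} \<Longrightarrow>
        act n (\<sigma> \<circ> \<tau>) f = act n \<tau> (act n \<sigma> f)"
    and act_d: "\<And>n \<sigma> f. \<sigma> permutes {1..n} \<Longrightarrow> act n \<sigma> (d n f) = d n (act n \<sigma> f)"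
    and circ_add_left: "\<And>n m i g. additive (\<lambda>f. circ n m i f g)"
    and circ_add_right: "\<And>n m i f. additive (circ n m i f)"
    and circ_scale_left: "\<And>n m i c f g. circ n m i (scale c f) g = map_poly (scale c) (circ n m i f g)"
    and circ_scale_right: "\<And>n m i c f g. circ n m i f (scale c g) = map_poly (scale c) (circ n m i f g)"
    and circ_in: "\<And>n m i p q f g. i \<in> {1..n} \<Longrightarrow> f \<in> P n p \<Longrightarrow> g \<in> P m q \<Longrightarrow>
        circ n m i f g \<in> polys (P (n + m - 1) (p + q))"
    and sesqui_left: "\<And>n m i f g. i \<in> {1..n} \<Longrightarrow>
        circ n m i (d n f) g = pCons 0 (circ n m i f g) + map_poly (d (n + m - 1)) (circ n m i f g)"
    and sesqui_right: "\<And>n m i f g. i \<in> {1..n} \<Longrightarrow>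
        circ n m i f (d m g) = - pCons 0 (circ n m i f g)"
    and assoc_parallel: "\<And>n m l i j f g h q r.
        i \<in> {1..n} \<Longrightarrow> 1 \<le> j \<Longrightarrow> j < i \<Longrightarrow> g \<in> P m q \<Longrightarrow> h \<in> P l r \<Longrightarrow>
        psubst mlam (\<lambda>c. var_to mmu (circ (n + m - 1) l j c h)) (circ n m i f g) =
        koszul q r (psubst mmu (\<lambda>c. var_to mlam (circ (n + l - 1) m (l + i - 1) c g)) (circ n l j f h))"
    and assoc_nested: "\<And>n m l i j f g h.
        i \<in> {1..n} \<Longrightarrow> i \<le> j \<Longrightarrow> j < i + m \<Longrightarrow>
        psubst mlam (\<lambda>c. var_to mmu (circ (n + m - 1) l j c h)) (circ n m i f g) =
        psubst mmu (\<lambda>c. var_to mlammu (circ n (m + l - 1) i f c)) (circ m l (j - i + 1) g h)"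
    and equivariance: "\<And>n m i f g \<sigma> \<tau>.
        i \<in> {1..n} \<Longrightarrow> \<sigma> permutes {1..n} \<Longrightarrow> \<tau> permutes {1..m} \<Longrightarrow>
        perm_circ n m i \<sigma> \<tau> permutes {1..n + m - 1} \<Longrightarrow>
        circ n m i (act n \<sigma> f) (act m \<tau> g) =
        map_poly (act (n + m - 1) (perm_circ n m i \<sigma> \<tau>)) (circ n m (\<sigma> i) f g)"
    and circ_act_id_left: "\<And>n m i f g. circ n m i (act n id f) g = circ n m i f g"
    and circ_act_id_right: "\<And>n m i f g. circ n m i f (act m id g) = circ n m i f g"
begin

lemmas zero_simps = additive.zero[OF d_add] additive.zero[OF act_add] additive.zero[OF circ_add_left]
  additive.zero[OF circ_add_right]

lemma circ_act_left:
  assumes "i \<in> {1..n}" "\<sigma> permutes {1..n}" "perm_circ n m i \<sigma> id permutes {1..n + m - 1}"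
  shows "circ n m i (act n \<sigma> f) g =
    map_poly (act (n + m - 1) (perm_circ n m i \<sigma> id)) (circ n m (\<sigma> i) f g)"
  using equivariance[OF assms(1,2) permutes_id assms(3), of f g] unfolding circ_act_id_right .

lemma circ_act_right:
  assumes "1 \<le> n" "\<tau> permutes {1..m}"
  shows "circ n m 1 f (act m \<tau> g) = map_poly (act (n + m - 1) \<tau>) (circ n m 1 f g)"
proof -
  have "\<tau> permutes {1..n + m - 1}" by (rule permutes_subset[OF assms(2)]) (use assms(1) in auto)
  then show ?thesis
    using equivariance[of 1 n id \<tau> m f g, OF _ permutes_id assms(2)] assms(1)
    unfolding circ_act_id_left perm_circ_id_left[OF assms(2,1)] by simp
qed

text \<open>The box product by arities: \<open>f\<close> has arity \<open>a + 1\<close> and \<open>g\<close> has arity \<open>b\<close>.\<close>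

definition nbox :: "nat \<Rightarrow> nat \<Rightarrow> 'v \<Rightarrow> 'v \<Rightarrow> 'v poly" where
  "nbox a b f g = (\<Sum>\<alpha>\<in>Sh (a + b) (\<lambda>v. v \<le> b).
     map_poly (act (a + b) \<alpha>) (subst_neg (d (a + b)) (circ (Suc a) b 1 f g)))"

lemma box_eq_nbox: "box d act circ (int a) (int b - 1) f g = nbox a b f g"
proof -
  have "ar (int a + (int b - 1)) = a + b" "ar (int a) = Suc a" "ar (int b - 1) = b"
    by (simp_all add: ar_def nat_add_distrib)
  moreover have "int b - 1 + 1 = int b" by simp
  ultimately show ?thesis
    unfolding box_def nbox_def
    by (simp only: sum_shuffle_perms[of "\<lambda>\<alpha>. map_poly (act (a + b) \<alpha>)
      (subst_neg (d (a + b)) (circ (Suc a) b 1 f g))"])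
qed

lemma box_eq_0: "n < 0 \<or> m < -1 \<Longrightarrow> box d act circ n m f g = 0"
  by (auto simp: box_def shuffle_perms_def)

lemma box_cases:
  obtains "n < 0 \<or> m < -1" | a b where "n = int a" "m = int b - 1"
proof (cases "n < 0 \<or> m < -1")
  case False
  then have "n = int (nat n)" "m = int (nat (m + 1)) - 1" by auto
  then show ?thesis using that(2) by blast
qed (use that in blast)

lemma additive_nbox_left: "additive (\<lambda>f. nbox a b f g)"
  unfolding nbox_def
  by (intro additive_sum additive_comp[OF additive_map_poly[OF act_add]]
      additive_comp[OF additive_subst_neg[OF d_add]] circ_add_left)

lemma additive_nbox_right: "additive (nbox a b f)"
  unfolding nbox_def
  by (intro additive_sum additive_comp[OF additive_map_poly[OF act_add]]
      additive_comp[OF additive_subst_neg[OF d_add]] circ_add_right)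

lemma additive_box_left: "additive (\<lambda>f. box d act circ n m f g)"
proof (cases n m rule: box_cases)
  case 1 then show ?thesis by (simp add: box_eq_0 additive_const_zero)
next
  case (2 a b) then show ?thesis by (simp add: box_eq_nbox additive_nbox_left)
qed

lemma additive_box_right: "additive (box d act circ n m f)"
proof (cases n m rule: box_cases)
  case 1 then have "box d act circ n m f = (\<lambda>g. 0)" by (simp add: box_eq_0 fun_eq_iff)
  then show ?thesis by (simp add: additive_const_zero)
next
  case (2 a b) then have "box d act circ n m f = nbox a b f" by (simp add: box_eq_nbox fun_eq_iff)
  then show ?thesis by (simp add: additive_nbox_right)
qed

text \<open>
  Identities are checked after evaluating the variable at an operator \<open>A\<close> on an abelian group into
  which the coefficients are mapped by \<open>\<iota>\<close>, with \<open>D\<close> in the role of $\partial$. The substitution of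
  $-\lambda-\partial$ then becomes that of $-A-D$.
\<close>

lemma psubst_nbox:
  assumes A: "additive A" and i: "additive \<iota>" and D: "additive D"
    and iD: "\<And>c. \<iota> (d (a + b) c) = D (\<iota> c)" and AD: "\<And>x. A (D x) = D (A x)"
  shows "psubst A \<iota> (nbox a b f g) = (\<Sum>\<alpha>\<in>Sh (a + b) (\<lambda>v. v \<le> b).
    psubst (\<lambda>x. - A x - D x) (\<lambda>c. \<iota> (act (a + b) \<alpha> c)) (circ (Suc a) b 1 f g))"
  unfolding nbox_def additive.sum[OF additive_psubst[OF A i]]
proof (rule sum.cong[OF refl])
  fix \<alpha> assume "\<alpha> \<in> Sh (a + b) (\<lambda>v. v \<le> b)"
  then have p: "\<alpha> permutes {1..a + b}" by (rule Sh_permutes)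
  let ?q = "circ (Suc a) b 1 f g"
  have "psubst A \<iota> (map_poly (act (a + b) \<alpha>) (subst_neg (d (a + b)) ?q)) =
      psubst A (\<lambda>c. \<iota> (act (a + b) \<alpha> c)) (subst_neg (d (a + b)) ?q)"
    by (rule psubst_map_poly[OF A i act_add])
  also have "\<dots> = psubst (\<lambda>x. - A x - D x) (\<lambda>c. \<iota> (act (a + b) \<alpha> c)) ?q"
    by (rule psubst_subst_neg[OF A additive_comp[OF i act_add] d_add D])
      (simp_all add: act_d[OF p] iD AD)
  finally show "psubst A \<iota> (map_poly (act (a + b) \<alpha>) (subst_neg (d (a + b)) ?q)) =
      psubst (\<lambda>x. - A x - D x) (\<lambda>c. \<iota> (act (a + b) \<alpha> c)) ?q" .
qed

lemma psubst_circ_d_left: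
  assumes B: "additive B" and k: "additive \<kappa>" and D: "additive D"
    and kD: "\<And>c. \<kappa> (d (n + m - 1) c) = D (\<kappa> c)" and BD: "\<And>x. B (D x) = D (B x)"
    and i: "i \<in> {1..n}"
  shows "psubst B \<kappa> (circ n m i (d n f) g) =
    B (psubst B \<kappa> (circ n m i f g)) + D (psubst B \<kappa> (circ n m i f g))"
proof -
  have "psubst B \<kappa> (map_poly (d (n + m - 1)) (circ n m i f g)) =
      psubst B (\<lambda>c. \<kappa> (d (n + m - 1) c)) (circ n m i f g)"
    by (rule psubst_map_poly[OF B k d_add])
  also have "\<dots> = D (psubst B \<kappa> (circ n m i f g))"
    unfolding kD by (rule psubst_natural[where A = B and A' = B, OF D BD[symmetric], symmetric])
  finally show ?thesis
    unfolding sesqui_left[OF i] psubst_add[OF B k] psubst_pCons[OF B k]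
    by (simp add: additive.zero[OF k])
qed

lemma psubst_circ_d_right:
  assumes B: "additive B" and k: "additive \<kappa>" and i: "i \<in> {1..n}"
  shows "psubst B \<kappa> (circ n m i f (d m g)) = - B (psubst B \<kappa> (circ n m i f g))"
  unfolding sesqui_right[OF i] additive.minus[OF additive_psubst[OF B k]]
    psubst_pCons[OF B k]
  by (simp add: additive.zero[OF k])

text \<open>
  Sesquilinearity of the box product: for $A' = -A-D$, differentiating \<open>f\<close> multiplies by $A'+D = -A$,
  and differentiating \<open>g\<close> multiplies by $-A' = A+D$.
\<close>

lemma psubst_nbox_d_left:
  assumes A: "additive A" and i: "additive \<iota>" and D: "additive D"
    and iD: "\<And>c. \<iota> (d (a + b) c) = D (\<iota> c)" and AD: "\<And>x. A (D x) = D (A x)"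
  shows "psubst A \<iota> (nbox a b (d (Suc a) f) g) = - A (psubst A \<iota> (nbox a b f g))"
proof -
  note N = psubst_nbox[OF A i D iD AD]
  show ?thesis
    unfolding N additive.sum[OF A] sum_negf[symmetric]
  proof (rule sum.cong[OF refl])
    fix \<alpha> assume "\<alpha> \<in> Sh (a + b) (\<lambda>v. v \<le> b)"
    then have p: "\<alpha> permutes {1..a + b}" by (rule Sh_permutes)
    show "psubst (\<lambda>x. - A x - D x) (\<lambda>c. \<iota> (act (a + b) \<alpha> c)) (circ (Suc a) b 1 (d (Suc a) f) g) =
      - A (psubst (\<lambda>x. - A x - D x) (\<lambda>c. \<iota> (act (a + b) \<alpha> c)) (circ (Suc a) b 1 f g))"
      by (subst psubst_circ_d_left[where D = D])
        (auto intro!: additive_intros A D additive_comp[OF i act_add]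
          simp: act_d[OF p] iD AD additive.minus[OF D] additive.diff[OF D])
  qed
qed

lemma psubst_nbox_d_right:
  assumes A: "additive A" and i: "additive \<iota>" and D: "additive D"
    and iD: "\<And>c. \<iota> (d (a + b) c) = D (\<iota> c)" and AD: "\<And>x. A (D x) = D (A x)"
  shows "psubst A \<iota> (nbox a b f (d b g)) = A (psubst A \<iota> (nbox a b f g)) + D (psubst A \<iota> (nbox a b f g))"
proof -
  note N = psubst_nbox[OF A i D iD AD]
  show ?thesis
    unfolding N additive.sum[OF A] additive.sum[OF D] sum.distrib[symmetric]
  proof (rule sum.cong[OF refl])
    fix \<alpha>
    have B: "additive (\<lambda>x. - A x - D x)" by (intro additive_intros A D)
    show "psubst (\<lambda>x. - A x - D x) (\<lambda>c. \<iota> (act (a + b) \<alpha> c)) (circ (Suc a) b 1 f (d b g)) =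
      A (psubst (\<lambda>x. - A x - D x) (\<lambda>c. \<iota> (act (a + b) \<alpha> c)) (circ (Suc a) b 1 f g)) +
      D (psubst (\<lambda>x. - A x - D x) (\<lambda>c. \<iota> (act (a + b) \<alpha> c)) (circ (Suc a) b 1 f g))"
      by (subst psubst_circ_d_right[OF B additive_comp[OF i act_add]]) auto
  qed
qed

lemma psubst_box_d_left:
  assumes A: "additive A" and i: "additive \<iota>" and D: "additive D"
    and iD: "\<And>c. \<iota> (d (ar (n + m)) c) = D (\<iota> c)" and AD: "\<And>x. A (D x) = D (A x)"
  shows "psubst A \<iota> (box d act circ n m (d (ar n) f) g) = - A (psubst A \<iota> (box d act circ n m f g))"
proof (cases n m rule: box_cases)
  case 1
  then show ?thesis by (simp add: box_eq_0 additive.zero[OF i] additive.zero[OF A])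
next
  case (2 a b)
  then have "ar (n + m) = a + b" "ar n = Suc a" by (simp_all add: ar_def nat_add_distrib)
  then show ?thesis using psubst_nbox_d_left[OF A i D _ AD] iD 2 by (simp add: box_eq_nbox)
qed

lemma psubst_box_d_right:
  assumes A: "additive A" and i: "additive \<iota>" and D: "additive D"
    and iD: "\<And>c. \<iota> (d (ar (n + m)) c) = D (\<iota> c)" and AD: "\<And>x. A (D x) = D (A x)"
  shows "psubst A \<iota> (box d act circ n m f (d (ar m) g)) =
    A (psubst A \<iota> (box d act circ n m f g)) + D (psubst A \<iota> (box d act circ n m f g))"
proof (cases n m rule: box_cases)
  case 1
  then show ?thesis by (simp add: box_eq_0 additive.zero[OF i] additive.zero[OF A] additive.zero[OF D])
next
  case (2 a b)
  then have "ar (n + m) = a + b" "ar m = b" by (simp_all add: ar_def nat_add_distrib)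
  then show ?thesis using psubst_nbox_d_right[OF A i D _ AD] iD 2 by (simp add: box_eq_nbox)
qed

text \<open>Evaluating $\lambda$ at itself gives back the polynomial identities.\<close>

lemma box_d_left: "box d act circ n m (d (ar n) f) g = - pCons 0 (box d act circ n m f g)"
  using psubst_box_d_left[where A = "pCons 0" and \<iota> = "\<lambda>c. [:c:]" and D = "map_poly (d (ar (n + m)))", of n m f g]
  by (simp add: psubst_pCons_const additive_intros d_add map_poly_pCons0 zero_simps)

lemma box_d_right:
  "box d act circ n m f (d (ar m) g) =
    pCons 0 (box d act circ n m f g) + map_poly (d (ar (n + m))) (box d act circ n m f g)"
  using psubst_box_d_right[where A = "pCons 0" and \<iota> = "\<lambda>c. [:c:]" and D = "map_poly (d (ar (n + m)))", of n m f g]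
  by (simp add: psubst_pCons_const additive_intros d_add map_poly_pCons0 zero_simps)

section \<open>The associator\<close>

context
  fixes X Y :: "'m::ab_group_add \<Rightarrow> 'm" and \<kappa> :: "'v \<Rightarrow> 'm"
  assumes X: "additive X" and Y: "additive Y" and \<kappa>: "additive \<kappa>" and XY: "\<And>x. X (Y x) = Y (X x)"
begin

lemma psubst_assoc_nested:
  assumes "i \<in> {1..n}" "i \<le> j" "j < i + m"
  shows "psubst X (\<lambda>c. psubst Y \<kappa> (circ (n + m - 1) l j c h)) (circ n m i f g) =
    psubst Y (\<lambda>c. psubst (\<lambda>x. X x + Y x) \<kappa> (circ n (m + l - 1) i f c)) (circ m l (j - i + 1) g h)"
proof -
  note E = additive_eval2[OF X Y \<kappa> XY]
  note V = eval2_var_to[OF X Y \<kappa> XY]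
  note l = eval2_mlam[OF X Y \<kappa> XY] and m = eval2_mmu[OF X Y \<kappa> XY] and lm = eval2_mlammu[OF X Y \<kappa> XY]
  have "psubst X (psubst Y \<kappa>) (psubst mlam (\<lambda>c. var_to mmu (circ (n + m - 1) l j c h)) (circ n m i f g)) =
      psubst X (psubst Y \<kappa>) (psubst mmu (\<lambda>c. var_to mlammu (circ n (m + l - 1) i f c)) (circ m l (j - i + 1) g h))"
    using assoc_nested[OF assms] by simp
  then show ?thesis
    unfolding psubst_natural[where A = mlam and A' = X, OF E l] psubst_natural[where A = mmu and A' = Y, OF E m] V[where A = mmu and A' = Y, OF m] V[where A = mlammu and A' = "\<lambda>x. X x + Y x", OF lm] .
qed

lemma psubst_assoc_parallel:
  assumes "i \<in> {1..n}" "1 \<le> j" "j < i" "g \<in> P m q" "h \<in> P l r"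
  shows "psubst X (\<lambda>c. psubst Y \<kappa> (circ (n + m - 1) l j c h)) (circ n m i f g) =
    koszul q r (psubst Y (\<lambda>c. psubst X \<kappa> (circ (n + l - 1) m (l + i - 1) c g)) (circ n l j f h))"
proof -
  note E = additive_eval2[OF X Y \<kappa> XY]
  note V = eval2_var_to[OF X Y \<kappa> XY]
  note l = eval2_mlam[OF X Y \<kappa> XY] and m = eval2_mmu[OF X Y \<kappa> XY]
  have "psubst X (psubst Y \<kappa>) (psubst mlam (\<lambda>c. var_to mmu (circ (n + m - 1) l j c h)) (circ n m i f g)) =
      psubst X (psubst Y \<kappa>) (koszul q r (psubst mmu (\<lambda>c. var_to mlam (circ (n + l - 1) m (l + i - 1) c g)) (circ n l j f h)))"
    using assoc_parallel[OF assms, of f] by simp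
  then show ?thesis
    unfolding koszul_additive[OF E] psubst_natural[where A = mlam and A' = X, OF E l] psubst_natural[where A = mmu and A' = Y, OF E m] V[where A = mlam and A' = X, OF l] V[where A = mmu and A' = Y, OF m] .
qed

text \<open>
  The heart of the symmetry of the associator. By the parallel axiom, inserting \<open>g\<close> at input \<open>1\<close>
  and then \<open>h\<close> at the next free input of \<open>f\<close> is the same as inserting \<open>h\<close> at input \<open>2\<close> and then \<open>g\<close>
  at input \<open>1\<close>. As \<open>f\<close> is invariant under the transposition of its first two inputs, the latter is a
  block swap of the composite with \<open>h\<close> and \<open>g\<close> inserted in the opposite order. The operators
  \<open>X\<close> and \<open>Y\<close> follow \<open>h\<close> and \<open>g\<close>.
\<close>

lemma circ_parallel_swap:
  assumes f: "\<And>\<sigma>. \<sigma> permutes {1..Suc a} \<Longrightarrow> act (Suc a) \<sigma> f = f" and a: "1 \<le> a"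
    and g: "g \<in> P b q" and h: "h \<in> P c r"
  shows "psubst Y (\<lambda>x. psubst X \<kappa> (circ (a + b) c (b + 1) x h)) (circ (Suc a) b 1 f g) =
    koszul q r (psubst X (\<lambda>x. psubst Y (\<lambda>u. \<kappa> (act (a + b + c - 1) (block_swap b c) u))
      (circ (a + c) b (c + 1) x g)) (circ (Suc a) c 1 f h))"
proof -
  let ?s = "transpose 1 (2::nat)"
  let ?t = "perm_circ (Suc a) c 2 ?s id"
  have s: "?s permutes {1..Suc a}" by (rule permutes_swap_id) (use a in auto)
  have t: "?t permutes {1..a + c}" using perm_circ_transpose_permutes[of "Suc a" c] a by simp
  have t1: "?t 1 = c + 1" using perm_circ_transpose[of "Suc a" 1 c] a by simp
  have sw: "perm_circ (a + c) b 1 ?t id = block_swap b c"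
    using perm_circ_block_swap[of "Suc a" c b] a by simp
  have "circ (Suc a) c 2 f h = circ (Suc a) c 2 (act (Suc a) ?s f) h" using f[OF s] by simp
  also have "\<dots> = map_poly (act (a + c) ?t) (circ (Suc a) c 1 f h)"
    using circ_act_left[of 2 "Suc a" ?s c f h, OF _ s] a t by simp
  finally have c2: "circ (Suc a) c 2 f h = map_poly (act (a + c) ?t) (circ (Suc a) c 1 f h)" .
  have "koszul r q (psubst Y (\<lambda>x. psubst X \<kappa> (circ (a + b) c (b + 1) x h)) (circ (Suc a) b 1 f g)) =
      psubst X (\<lambda>x. psubst Y \<kappa> (circ (a + c) b 1 x g)) (circ (Suc a) c 2 f h)"
    using psubst_assoc_parallel[of 2 "Suc a" 1 h c r g b q f] a g h by simp
  also have "\<dots> = psubst X (\<lambda>x. psubst Y \<kappa> (circ (a + c) b 1 (act (a + c) ?t x) g)) (circ (Suc a) c 1 f h)"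
    unfolding c2
    by (rule psubst_map_poly[OF X additive_comp[OF additive_psubst[OF Y \<kappa>] circ_add_left] act_add])
  also have "\<dots> = psubst X (\<lambda>x. psubst Y (\<lambda>u. \<kappa> (act (a + b + c - 1) (block_swap b c) u))
      (circ (a + c) b (c + 1) x g)) (circ (Suc a) c 1 f h)"
  proof (rule psubst_cong)
    fix k
    let ?x = "coeff (circ (Suc a) c 1 f h) k"
    have "circ (a + c) b 1 (act (a + c) ?t ?x) g =
        map_poly (act (a + b + c - 1) (block_swap b c)) (circ (a + c) b (c + 1) ?x g)"
      using circ_act_left[of 1 "a + c" ?t b ?x g, OF _ t] a block_swap_permutes[of b c "a + b + c - 1"]
      unfolding t1 sw by (simp add: ac_simps)
    then show "psubst Y \<kappa> (circ (a + c) b 1 (act (a + c) ?t ?x) g) =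
        psubst Y (\<lambda>u. \<kappa> (act (a + b + c - 1) (block_swap b c) u)) (circ (a + c) b (c + 1) ?x g)"
      by (simp add: psubst_map_poly[OF Y \<kappa> act_add])
  qed
  finally have "koszul r q (koszul r q (psubst Y (\<lambda>x. psubst X \<kappa> (circ (a + b) c (b + 1) x h)) (circ (Suc a) b 1 f g))) =
    koszul r q (psubst X (\<lambda>x. psubst Y (\<lambda>u. \<kappa> (act (a + b + c - 1) (block_swap b c) u))
      (circ (a + c) b (c + 1) x g)) (circ (Suc a) c 1 f h))" by simp
  then show ?thesis unfolding koszul_koszul by (simp add: koszul_commute)
qed

end

context
  fixes A B D :: "'m::ab_group_add \<Rightarrow> 'm"
  assumes A: "additive A" and B: "additive B" and D: "additive D"
    and AB: "\<And>x. A (B x) = B (A x)" and AD: "\<And>x. A (D x) = D (A x)" and BD: "\<And>x. B (D x) = D (B x)"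
begin

text \<open>
  In $(f \Box_A g) \Box_{A+B} h$ the inner $\partial$ is moved through the outer product, where it acts as
  $-(A+B)$. The inner substitution $-A-\partial$ thus becomes \<open>B\<close>, and the outer one becomes
  \<open>-(A+B)-D\<close>. Equivariance moves the inner shuffle \<open>\<alpha>\<close> outside and \<open>h\<close> to the input \<open>\<alpha> 1\<close>.
\<close>

lemma nested_nbox_left:
  assumes i: "additive \<iota>" and N: "a + b = Suc a'" and iD: "\<And>c'. \<iota> (d (a' + c) c') = D (\<iota> c')"
  shows "psubst A (\<lambda>x. psubst (\<lambda>y. A y + B y) \<iota> (nbox a' c x h)) (nbox a b f g) =
    (\<Sum>\<alpha>\<in>Sh (a + b) (\<lambda>v. v \<le> b). \<Sum>\<beta>\<in>Sh (a' + c) (\<lambda>v. v \<le> c).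
      psubst B (\<lambda>x. psubst (\<lambda>y. - (A y + B y) - D y)
          (\<lambda>u. \<iota> (act (a' + c) (perm_circ (a + b) c 1 \<alpha> id \<circ> \<beta>) u)) (circ (a + b) c (\<alpha> 1) x h))
        (circ (Suc a) b 1 f g))"
proof -
  let ?N = "\<lambda>y. - (A y + B y) - D y"
  let ?S = "Sh (a' + c) (\<lambda>v. v \<le> c)"
  have addN: "additive ?N" and addAB: "additive (\<lambda>y. A y + B y)" and addE: "additive (\<lambda>y. - (A y + B y))"
    by (intro additive_intros A B D)+
  note lin = additive.add[OF A] additive.add[OF B] additive.add[OF D] additive.minus[OF A] additive.minus[OF B]
    additive.minus[OF D] additive.diff[OF A] additive.diff[OF B] additive.diff[OF D] AB AD BD
  define G where "G \<beta> x = psubst ?N (\<lambda>u. \<iota> (act (a' + c) \<beta> u)) (circ (Suc a') c 1 x h)" for \<beta> x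
  have inner: "psubst (\<lambda>y. A y + B y) \<iota> (nbox a' c x h) = (\<Sum>\<beta>\<in>?S. G \<beta> x)" for x
    unfolding G_def by (rule psubst_nbox[OF addAB i D iD]) (simp_all add: lin)
  have G: "additive (G \<beta>)" for \<beta>
    unfolding G_def by (rule additive_comp[OF additive_psubst[OF addN additive_comp[OF i act_add]] circ_add_left])
  have Gd: "G \<beta> (d (a + b) x) = - (A (G \<beta> x) + B (G \<beta> x))" if "\<beta> \<in> ?S" for \<beta> x
  proof -
    note p = Sh_permutes[OF that]
    show ?thesis
      unfolding G_def N
      by (subst psubst_circ_d_left[OF addN additive_comp[OF i act_add] D])
        (use act_d[OF p] iD in \<open>simp_all add: lin algebra_simps\<close>)
  qed
  have Gact: "G \<beta> (act (a + b) \<alpha> x) = psubst ?N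
      (\<lambda>u. \<iota> (act (a' + c) (perm_circ (a + b) c 1 \<alpha> id \<circ> \<beta>) u)) (circ (a + b) c (\<alpha> 1) x h)"
    if al: "\<alpha> permutes {1..a + b}" and be: "\<beta> \<in> ?S" for \<alpha> \<beta> x
  proof -
    have pc: "perm_circ (a + b) c 1 \<alpha> id permutes {1..a' + c}"
      using perm_circ_1_permutes[OF al _ permutes_id, of c] N by simp
    have "circ (Suc a') c 1 (act (a + b) \<alpha> x) h =
        map_poly (act (a' + c) (perm_circ (a + b) c 1 \<alpha> id)) (circ (a + b) c (\<alpha> 1) x h)"
      using circ_act_left[of 1 "a + b" \<alpha> c x h] al N pc by simp
    then show ?thesis
      unfolding G_def act_comp[OF pc Sh_permutes[OF be]]
      using psubst_map_poly[OF addN additive_comp[OF i act_add] act_add,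
          where q = "circ (a + b) c (\<alpha> 1) x h"] by metis
  qed
  have E: "(\<lambda>x. - A x - - (A x + B x)) = B" by (simp add: fun_eq_iff)
  have "psubst A (\<lambda>x. psubst (\<lambda>y. A y + B y) \<iota> (nbox a' c x h)) (nbox a b f g) =
      (\<Sum>\<beta>\<in>?S. psubst A (G \<beta>) (nbox a b f g))"
    unfolding inner by (rule psubst_sum_fun[OF A])
  also have "\<dots> = (\<Sum>\<beta>\<in>?S. \<Sum>\<alpha>\<in>Sh (a + b) (\<lambda>v. v \<le> b).
      psubst B (\<lambda>x. G \<beta> (act (a + b) \<alpha> x)) (circ (Suc a) b 1 f g))"
  proof (rule sum.cong[OF refl])
    fix \<beta> assume be: "\<beta> \<in> ?S"
    show "psubst A (G \<beta>) (nbox a b f g) = (\<Sum>\<alpha>\<in>Sh (a + b) (\<lambda>v. v \<le> b).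
      psubst B (\<lambda>x. G \<beta> (act (a + b) \<alpha> x)) (circ (Suc a) b 1 f g))"
      using psubst_nbox[OF A G addE Gd[OF be], where f = f and g = g] by (simp add: E lin)
  qed
  also have "\<dots> = (\<Sum>\<alpha>\<in>Sh (a + b) (\<lambda>v. v \<le> b). \<Sum>\<beta>\<in>?S.
      psubst B (\<lambda>x. G \<beta> (act (a + b) \<alpha> x)) (circ (Suc a) b 1 f g))"
    by (rule sum.swap)
  also have "\<dots> = (\<Sum>\<alpha>\<in>Sh (a + b) (\<lambda>v. v \<le> b). \<Sum>\<beta>\<in>?S.
      psubst B (\<lambda>x. psubst ?N
          (\<lambda>u. \<iota> (act (a' + c) (perm_circ (a + b) c 1 \<alpha> id \<circ> \<beta>) u)) (circ (a + b) c (\<alpha> 1) x h))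
        (circ (Suc a) b 1 f g))"
    by (intro sum.cong refl psubst_cong Gact Sh_permutes)
  finally show ?thesis .
qed

text \<open>
  In $f \Box_A (g \Box_B h)$ the inner $\partial$ acts as $A+D$, so that the inner substitution
  $-B-\partial$ becomes the same operator $-(A+B)-D$ as above.
\<close>

lemma nested_nbox_right:
  assumes i: "additive \<iota>" and iD: "\<And>c'. \<iota> (d (a + (b' + c)) c') = D (\<iota> c')"
  shows "psubst B (\<lambda>x. psubst A \<iota> (nbox a (b' + c) f x)) (nbox b' c g h) =
    (\<Sum>\<tau>\<in>Sh (b' + c) (\<lambda>v. v \<le> c). \<Sum>\<sigma>\<in>Sh (a + (b' + c)) (\<lambda>v. v \<le> b' + c).
      psubst (\<lambda>y. - (A y + B y) - D y) (\<lambda>x. psubst (\<lambda>y. - A y - D y)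
          (\<lambda>u. \<iota> (act (a + (b' + c)) (\<tau> \<circ> \<sigma>) u)) (circ (Suc a) (b' + c) 1 f x))
        (circ (Suc b') c 1 g h))"
proof -
  let ?N = "\<lambda>y. - (A y + B y) - D y" and ?K = "\<lambda>y. - A y - D y"
  let ?S = "Sh (a + (b' + c)) (\<lambda>v. v \<le> b' + c)"
  have addK: "additive ?K" and addE: "additive (\<lambda>y. A y + D y)" by (intro additive_intros A D)+
  note lin = additive.add[OF A] additive.add[OF B] additive.add[OF D] additive.minus[OF A] additive.minus[OF B]
    additive.minus[OF D] additive.diff[OF A] additive.diff[OF B] additive.diff[OF D] AB AD BD
  define H where "H \<sigma> x = psubst ?K (\<lambda>u. \<iota> (act (a + (b' + c)) \<sigma> u)) (circ (Suc a) (b' + c) 1 f x)" for \<sigma> x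
  have inner: "psubst A \<iota> (nbox a (b' + c) f x) = (\<Sum>\<sigma>\<in>?S. H \<sigma> x)" for x
    unfolding H_def by (rule psubst_nbox[OF A i D iD AD])
  have H: "additive (H \<sigma>)" for \<sigma>
    unfolding H_def by (rule additive_comp[OF additive_psubst[OF addK additive_comp[OF i act_add]] circ_add_right])
  have Hd: "H \<sigma> (d (b' + c) x) = A (H \<sigma> x) + D (H \<sigma> x)" for \<sigma> x
    unfolding H_def by (subst psubst_circ_d_right[OF addK additive_comp[OF i act_add]]) simp_all
  have Hact: "H \<sigma> (act (b' + c) \<tau> x) = psubst ?K
      (\<lambda>u. \<iota> (act (a + (b' + c)) (\<tau> \<circ> \<sigma>) u)) (circ (Suc a) (b' + c) 1 f x)"
    if si: "\<sigma> permutes {1..a + (b' + c)}" and ta: "\<tau> permutes {1..b' + c}" for \<sigma> \<tau> x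
  proof -
    have ta': "\<tau> permutes {1..a + (b' + c)}" by (rule permutes_subset[OF ta]) auto
    show ?thesis
      unfolding H_def act_comp[OF ta' si]
      using circ_act_right[of "Suc a" \<tau>, OF _ ta, of f x]
        psubst_map_poly[OF addK additive_comp[OF i act_add] act_add,
          where q = "circ (Suc a) (b' + c) 1 f x"] by simp
  qed
  have E: "(\<lambda>x. - B x - (A x + D x)) = ?N" by (simp add: fun_eq_iff algebra_simps)
  have "psubst B (\<lambda>x. psubst A \<iota> (nbox a (b' + c) f x)) (nbox b' c g h) =
      (\<Sum>\<sigma>\<in>?S. psubst B (H \<sigma>) (nbox b' c g h))"
    unfolding inner by (rule psubst_sum_fun[OF B])
  also have "\<dots> = (\<Sum>\<sigma>\<in>?S. \<Sum>\<tau>\<in>Sh (b' + c) (\<lambda>v. v \<le> c).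
      psubst ?N (\<lambda>x. H \<sigma> (act (b' + c) \<tau> x)) (circ (Suc b') c 1 g h))"
  proof (rule sum.cong[OF refl])
    fix \<sigma>
    show "psubst B (H \<sigma>) (nbox b' c g h) = (\<Sum>\<tau>\<in>Sh (b' + c) (\<lambda>v. v \<le> c).
      psubst ?N (\<lambda>x. H \<sigma> (act (b' + c) \<tau> x)) (circ (Suc b') c 1 g h))"
      using psubst_nbox[OF B H addE Hd, where f = g and g = h] by (simp add: E lin)
  qed
  also have "\<dots> = (\<Sum>\<tau>\<in>Sh (b' + c) (\<lambda>v. v \<le> c). \<Sum>\<sigma>\<in>?S.
      psubst ?N (\<lambda>x. H \<sigma> (act (b' + c) \<tau> x)) (circ (Suc b') c 1 g h))"
    by (rule sum.swap)
  also have "\<dots> = (\<Sum>\<tau>\<in>Sh (b' + c) (\<lambda>v. v \<le> c). \<Sum>\<sigma>\<in>?S.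
      psubst ?N (\<lambda>x. psubst ?K
          (\<lambda>u. \<iota> (act (a + (b' + c)) (\<tau> \<circ> \<sigma>) u)) (circ (Suc a) (b' + c) 1 f x))
        (circ (Suc b') c 1 g h))"
    by (intro sum.cong refl psubst_cong Hact Sh_permutes)
  finally show ?thesis .
qed

end

end

lemma shuffle_sum_first_letter:
  assumes "1 \<le> a + b"
  shows "(\<Sum>\<alpha>\<in>Sh (a + b) (\<lambda>v. v \<le> b). T \<alpha>) =
    (if 1 \<le> b then \<Sum>\<alpha> | \<alpha> \<in> Sh (a + b) (\<lambda>v. v \<le> b) \<and> \<alpha> 1 = 1. T \<alpha> else 0) +
    (if 1 \<le> a then \<Sum>\<alpha> | \<alpha> \<in> Sh (a + b) (\<lambda>v. v \<le> b) \<and> \<alpha> 1 = b + 1. T \<alpha> else (0::'m::comm_monoid_add))"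
proof -
  let ?S = "Sh (a + b) (\<lambda>v. v \<le> b)"
  let ?S1 = "{\<alpha>. \<alpha> \<in> ?S \<and> \<alpha> 1 = 1 \<and> 1 \<le> b}" and ?S2 = "{\<alpha>. \<alpha> \<in> ?S \<and> \<alpha> 1 = b + 1 \<and> 1 \<le> a}"
  have "?S = ?S1 \<union> ?S2" using shuffle_first_letter[OF _ assms] by blast
  moreover have "sum T (?S1 \<union> ?S2) = sum T ?S1 + sum T ?S2"
    by (rule sum.union_disjoint) (auto intro: finite_subset[OF _ finite_Sh[of "a + b" "\<lambda>v. v \<le> b"]])
  ultimately show ?thesis by simp
qed

context total_operad
begin

text \<open>The associator $(f_\lambda g_\mu h)$ with \<open>A\<close>, \<open>B\<close> substituted for $\lambda$, $\mu$.\<close>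

definition asc :: "('v \<Rightarrow> 'm::ab_group_add) \<Rightarrow> ('m \<Rightarrow> 'm) \<Rightarrow> ('m \<Rightarrow> 'm) \<Rightarrow> int \<Rightarrow> int \<Rightarrow> int \<Rightarrow> 'v \<Rightarrow> 'v \<Rightarrow> 'v \<Rightarrow> 'm" where
  "asc \<iota> A B n m l f g h =
    psubst A (\<lambda>x. psubst (\<lambda>y. A y + B y) \<iota> (box d act circ (n + m) l x h)) (box d act circ n m f g) -
    psubst B (\<lambda>x. psubst A \<iota> (box d act circ n (m + l) f x)) (box d act circ m l g h)"

lemma psubst_zero_fun: "additive A \<Longrightarrow> psubst A (\<lambda>c. 0) q = 0"
  by (simp add: psubst_def additive.zero[OF additive_funpow])

context
  fixes A B D :: "'m::ab_group_add \<Rightarrow> 'm" and \<iota> :: "'v \<Rightarrow> 'm"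
  assumes A: "additive A" and B: "additive B" and D: "additive D" and i: "additive \<iota>"
    and AB: "\<And>x. A (B x) = B (A x)" and AD: "\<And>x. A (D x) = D (A x)" and BD: "\<And>x. B (D x) = D (B x)"
begin

lemmas op_lin = additive.add[OF A] additive.add[OF B] additive.add[OF D] additive.minus[OF A] additive.minus[OF B]
    additive.minus[OF D] additive.diff[OF A] additive.diff[OF B] additive.diff[OF D] AB AD BD

text \<open>
  In $(f \Box g) \Box h$ the element \<open>h\<close> is inserted either into the first input of \<open>g\<close>, or into the first
  free input of \<open>f\<close>. By nested associativity the terms of the first kind add up to
  $f \Box (g \Box h)$, so that those of the second kind make up the associator.
\<close>

lemma asc_formula:
  assumes iD: "\<And>x. \<iota> (d (a + b + c - 1) x) = D (\<iota> x)"
  shows "asc \<iota> A B (int a) (int b - 1) (int c - 1) f g h = (if 1 \<le> a then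
    \<Sum>\<gamma>\<in>Sh (a + b + c - 1) (blocks b c). psubst B (\<lambda>x. psubst (\<lambda>y. - (A y + B y) - D y)
      (\<lambda>u. \<iota> (act (a + b + c - 1) \<gamma> u)) (circ (a + b) c (b + 1) x h)) (circ (Suc a) b 1 f g) else 0)"
proof -
  let ?N = "\<lambda>y. - (A y + B y) - D y"
  have addN: "additive ?N" by (intro additive_intros A B D)
  have zero: "psubst C (\<lambda>x. psubst C' \<iota> 0) q = 0" if "additive C" for C C' :: "'m \<Rightarrow> 'm" and q
    using that by (simp add: psubst_zero_fun additive.zero[OF i])
  let ?box = "box d act circ"
  let ?L = "psubst A (\<lambda>x. psubst (\<lambda>y. A y + B y) \<iota> (?box (int a + (int b - 1)) (int c - 1) x h))
    (?box (int a) (int b - 1) f g)"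
  let ?R = "psubst B (\<lambda>x. psubst A \<iota> (?box (int a) (int b - 1 + (int c - 1)) f x))
    (?box (int b - 1) (int c - 1) g h)"
  define M where "M = a + b + c - 1"
  \<comment> \<open>If \<open>g\<close> has no inputs, then $g \Box h = 0$ and no shuffle starts with an input of \<open>g\<close>.\<close>
  have R: "?R = (if 1 \<le> b then \<Sum>\<gamma>\<in>Sh M (blocks c (b - 1)). psubst B (\<lambda>x. psubst ?N (\<lambda>u. \<iota> (act M \<gamma> u))
      (circ (a + b) c 1 x h)) (circ (Suc a) b 1 f g) else 0)"
  proof (cases b)
    case 0
    then show ?thesis
      by (simp add: box_eq_0 additive.zero[OF i] additive.zero[OF additive_box_right])
  next
    case (Suc b')
    have eqs: "int b - 1 = int b'" "int b' + (int c - 1) = int (b' + c) - 1" "M = a + (b' + c)"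
      using Suc by (simp_all add: M_def)
    have iD': "\<iota> (d (a + (b' + c)) x) = D (\<iota> x)" for x using iD[of x] eqs(3) unfolding M_def by simp
    have "?R = psubst B (\<lambda>x. psubst A \<iota> (nbox a (b' + c) f x)) (nbox b' c g h)"
      unfolding eqs(1) eqs(2) box_eq_nbox by (rule refl)
    also have "\<dots> = (\<Sum>\<tau>\<in>Sh (b' + c) (\<lambda>v. v \<le> c). \<Sum>\<sigma>\<in>Sh (a + (b' + c)) (\<lambda>v. v \<le> b' + c).
      psubst ?N (\<lambda>x. psubst (\<lambda>y. - A y - D y)
          (\<lambda>u. \<iota> (act (a + (b' + c)) (\<tau> \<circ> \<sigma>) u)) (circ (Suc a) (b' + c) 1 f x))
        (circ (Suc b') c 1 g h))"
      by (rule nested_nbox_right[OF A B D AB AD BD i iD'])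
    also have "\<dots> = (\<Sum>\<gamma>\<in>Sh (a + (b' + c)) (blocks c b').
      psubst ?N (\<lambda>x. psubst (\<lambda>y. - A y - D y)
          (\<lambda>u. \<iota> (act (a + (b' + c)) \<gamma> u)) (circ (Suc a) (b' + c) 1 f x))
        (circ (Suc b') c 1 g h))"
      by (rule sum_shuffles_nested)
    also have "\<dots> = (\<Sum>\<gamma>\<in>Sh M (blocks c b'). psubst B (\<lambda>x. psubst ?N (\<lambda>u. \<iota> (act M \<gamma> u))
      (circ (a + b) c 1 x h)) (circ (Suc a) b 1 f g))"
    proof (rule sum.cong)
      fix \<gamma>
      have X: "(\<lambda>y. B y + ?N y) = (\<lambda>y. - A y - D y)" by (simp add: fun_eq_iff algebra_simps)
      show "psubst ?N (\<lambda>x. psubst (\<lambda>y. - A y - D y)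
          (\<lambda>u. \<iota> (act (a + (b' + c)) \<gamma> u)) (circ (Suc a) (b' + c) 1 f x)) (circ (Suc b') c 1 g h) =
        psubst B (\<lambda>x. psubst ?N (\<lambda>u. \<iota> (act M \<gamma> u)) (circ (a + b) c 1 x h)) (circ (Suc a) b 1 f g)"
        using psubst_assoc_nested[where X = B and Y = ?N and \<kappa> = "\<lambda>u. \<iota> (act M \<gamma> u)" and i = 1 and n = "Suc a"
            and j = 1 and m = b and l = c and h = h and f = f and g = g, OF B addN additive_comp[OF i act_add]]
        unfolding X eqs(3) using Suc by (simp add: op_lin)
    qed (simp add: eqs(3))
    finally show ?thesis using Suc by simp
  qed
  \<comment> \<open>If $f \circ^1 g$ has no inputs, its box product with \<open>h\<close> is zero.\<close>
  show ?thesis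
  proof (cases "a + b")
    case 0
    then have "?L = 0" by (simp add: box_eq_0 zero[OF A])
    then show ?thesis using 0 R by (simp add: asc_def)
  next
    case (Suc a')
    have eqs: "int a + (int b - 1) = int a'" "M = a' + c" using Suc by (auto simp: M_def)
    have iD': "\<iota> (d (a' + c) x) = D (\<iota> x)" for x using iD[of x] eqs(2) unfolding M_def by simp
    let ?T = "\<lambda>j \<gamma>. psubst B (\<lambda>x. psubst ?N (\<lambda>u. \<iota> (act M \<gamma> u)) (circ (a + b) c j x h)) (circ (Suc a) b 1 f g)"
    let ?S = "Sh (a + b) (\<lambda>v. v \<le> b)" and ?S' = "Sh (a + b + c - 1) (\<lambda>v. v \<le> c)"
    have "?L = psubst A (\<lambda>x. psubst (\<lambda>y. A y + B y) \<iota> (nbox a' c x h)) (nbox a b f g)"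
      unfolding eqs(1) box_eq_nbox by (rule refl)
    also have "\<dots> = (\<Sum>\<alpha>\<in>?S. \<Sum>\<beta>\<in>Sh (a' + c) (\<lambda>v. v \<le> c).
      psubst B (\<lambda>x. psubst ?N (\<lambda>u. \<iota> (act (a' + c) (perm_circ (a + b) c 1 \<alpha> id \<circ> \<beta>) u))
        (circ (a + b) c (\<alpha> 1) x h)) (circ (Suc a) b 1 f g))"
      by (rule nested_nbox_left[OF A B D AB AD BD i Suc iD'])
    also have "\<dots> = (\<Sum>\<alpha>\<in>?S. \<Sum>\<beta>\<in>?S'. ?T (\<alpha> 1) (perm_circ (a + b) c 1 \<alpha> id \<circ> \<beta>))"
      using eqs(2) unfolding M_def by simp
    also have "\<dots> = (if 1 \<le> b then \<Sum>\<alpha> | \<alpha> \<in> ?S \<and> \<alpha> 1 = 1. \<Sum>\<beta>\<in>?S'. ?T 1 (perm_circ (a + b) c 1 \<alpha> id \<circ> \<beta>) else 0) +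
      (if 1 \<le> a then \<Sum>\<alpha> | \<alpha> \<in> ?S \<and> \<alpha> 1 = b + 1. \<Sum>\<beta>\<in>?S'. ?T (b + 1) (perm_circ (a + b) c 1 \<alpha> id \<circ> \<beta>) else 0)"
    proof -
      have "(\<Sum>\<alpha> | \<alpha> \<in> ?S \<and> \<alpha> 1 = p. \<Sum>\<beta>\<in>?S'. ?T (\<alpha> 1) (perm_circ (a + b) c 1 \<alpha> id \<circ> \<beta>)) =
        (\<Sum>\<alpha> | \<alpha> \<in> ?S \<and> \<alpha> 1 = p. \<Sum>\<beta>\<in>?S'. ?T p (perm_circ (a + b) c 1 \<alpha> id \<circ> \<beta>))" for p
        by (rule sum.cong) auto
      note inner = this
      have "1 \<le> a + b" using Suc by simp
      from shuffle_sum_first_letter[OF this,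
          of "\<lambda>\<alpha>. \<Sum>\<beta>\<in>?S'. ?T (\<alpha> 1) (perm_circ (a + b) c 1 \<alpha> id \<circ> \<beta>)"]
      show ?thesis unfolding inner .
    qed
    also have "\<dots> = (if 1 \<le> b then \<Sum>\<gamma>\<in>Sh M (blocks c (b - 1)). ?T 1 \<gamma> else 0) +
      (if 1 \<le> a then \<Sum>\<gamma>\<in>Sh M (blocks b c). ?T (b + 1) \<gamma> else 0)"
      unfolding M_def[symmetric]
      by (intro arg_cong2[where f = "(+)"] if_cong refl
          sum_shuffles_first_first[where F = "?T 1" and a = a and b = b and c = c, folded M_def]
          sum_shuffles_second_first[where F = "?T (b + 1)" and a = a and b = b and c = c, folded M_def])
    finally show ?thesis unfolding asc_def R M_def[symmetric] by simp
  qed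
qed

text \<open>Summed over all three-block shuffles, the block swap is absorbed by exchanging the first two blocks.\<close>

lemma asc_symmetric_nat:
  assumes f: "\<And>\<sigma>. \<sigma> permutes {1..Suc a} \<Longrightarrow> act (Suc a) \<sigma> f = f"
    and g: "g \<in> P b q" and h: "h \<in> P c r"
    and iD: "\<And>x. \<iota> (d (a + b + c - 1) x) = D (\<iota> x)"
  shows "(if 1 \<le> a then
    \<Sum>\<gamma>\<in>Sh (a + b + c - 1) (blocks b c). psubst B (\<lambda>x. psubst (\<lambda>y. - (A y + B y) - D y)
      (\<lambda>u. \<iota> (act (a + b + c - 1) \<gamma> u)) (circ (a + b) c (b + 1) x h)) (circ (Suc a) b 1 f g) else 0) =
    koszul q r (if 1 \<le> a then
    \<Sum>\<gamma>\<in>Sh (a + c + b - 1) (blocks c b). psubst (\<lambda>y. - (A y + B y) - D y) (\<lambda>x. psubst B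
      (\<lambda>u. \<iota> (act (a + c + b - 1) \<gamma> u)) (circ (a + c) b (c + 1) x g)) (circ (Suc a) c 1 f h) else 0)"
proof (cases "1 \<le> a")
  case a: True
  let ?N = "\<lambda>y. - (A y + B y) - D y"
  have addN: "additive ?N" by (intro additive_intros A B D)
  have NB: "?N (B x) = B (?N x)" for x by (simp add: op_lin)
  define M where "M = a + b + c - 1"
  have M: "b + c \<le> M" using a by (simp add: M_def)
  let ?T = "\<lambda>\<gamma>. psubst ?N (\<lambda>x. psubst B (\<lambda>u. \<iota> (act M \<gamma> u)) (circ (a + c) b (c + 1) x g)) (circ (Suc a) c 1 f h)"
  have "(\<Sum>\<gamma>\<in>Sh M (blocks b c). psubst B (\<lambda>x. psubst ?N (\<lambda>u. \<iota> (act M \<gamma> u)) (circ (a + b) c (b + 1) x h))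
      (circ (Suc a) b 1 f g)) = (\<Sum>\<gamma>\<in>Sh M (blocks b c). koszul q r (?T (block_swap b c \<circ> \<gamma>)))"
  proof (rule sum.cong[OF refl])
    fix \<gamma> assume "\<gamma> \<in> Sh M (blocks b c)"
    note p = Sh_permutes[OF this]
    show "psubst B (\<lambda>x. psubst ?N (\<lambda>u. \<iota> (act M \<gamma> u)) (circ (a + b) c (b + 1) x h)) (circ (Suc a) b 1 f g) =
        koszul q r (?T (block_swap b c \<circ> \<gamma>))"
      unfolding act_comp[OF block_swap_permutes[OF M] p]
      using circ_parallel_swap[where X = ?N and Y = B and \<kappa> = "\<lambda>u. \<iota> (act M \<gamma> u)",
          OF addN B additive_comp[OF i act_add] NB f a g h]
      unfolding M_def[symmetric] .
  qed
  also have "\<dots> = koszul q r (\<Sum>\<gamma>\<in>Sh M (blocks b c). ?T (block_swap b c \<circ> \<gamma>))"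
    by (rule additive.sum[OF additive_koszul, symmetric])
  also have "\<dots> = koszul q r (\<Sum>\<gamma>\<in>Sh M (blocks c b). ?T \<gamma>)"
    unfolding sum_block_swap[OF M, where F = ?T] by (rule refl)
  finally have *: "(\<Sum>\<gamma>\<in>Sh M (blocks b c). psubst B (\<lambda>x. psubst ?N (\<lambda>u. \<iota> (act M \<gamma> u)) (circ (a + b) c (b + 1) x h))
      (circ (Suc a) b 1 f g)) = koszul q r (\<Sum>\<gamma>\<in>Sh M (blocks c b). ?T \<gamma>)" .
  have M': "a + c + b - 1 = M" by (simp add: M_def)
  show ?thesis using * a unfolding M' M_def[symmetric] by simp
qed (simp add: additive.zero[OF additive_koszul])

end

text \<open>
  The three operators \<open>A\<close>, \<open>B\<close> and $-A-B-D$ enter symmetrically: \<open>B\<close> is recovered from \<open>A\<close> and the third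
  one as the third one is from \<open>A\<close> and \<open>B\<close>.
\<close>

theorem asc_symmetric:
  fixes A B D :: "'m::ab_group_add \<Rightarrow> 'm"
  assumes A: "additive A" and B: "additive B" and D: "additive D" and i: "additive \<iota>"
    and AB: "\<And>x. A (B x) = B (A x)" and AD: "\<And>x. A (D x) = D (A x)" and BD: "\<And>x. B (D x) = D (B x)"
    and iD: "\<And>x. \<iota> (d (ar (n + m + l)) x) = D (\<iota> x)"
    and nml: "n \<ge> -1" "m \<ge> -1" "l \<ge> -1"
    and f: "\<And>\<sigma>. \<sigma> permutes {1..ar n} \<Longrightarrow> act (ar n) \<sigma> f = f"
    and g: "g \<in> P (ar m) q" and h: "h \<in> P (ar l) r"
  shows "asc \<iota> A B n m l f g h = koszul q r (asc \<iota> A (\<lambda>y. - (A y + B y) - D y) n l m f h g)"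
proof (cases "n = -1")
  case True
  then show ?thesis
    by (simp add: asc_def box_eq_0 psubst_zero_fun A B D additive_intros additive.zero[OF i]
        additive.zero[OF additive_koszul] additive.zero[OF additive_box_left])
next
  case False
  define a b c where "a = nat n" "b = nat (m + 1)" "c = nat (l + 1)"
  have eqs: "n = int a" "m = int b - 1" "l = int c - 1" using nml False by (auto simp: a_b_c_def)
  have ars: "ar n = Suc a" "ar m = b" "ar l = c" "ar (n + m + l) = a + b + c - 1"
    unfolding eqs by (auto simp: ar_def nat_add_distrib)
  let ?N = "\<lambda>y. - (A y + B y) - D y"
  have addN: "additive ?N" by (intro additive_intros A B D)
  note lin = additive.add[OF A] additive.add[OF B] additive.add[OF D] additive.minus[OF A] additive.minus[OF B]
    additive.minus[OF D] additive.diff[OF A] additive.diff[OF B] additive.diff[OF D] AB AD BD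
  have AN: "A (?N x) = ?N (A x)" and ND: "?N (D x) = D (?N x)" for x by (simp_all add: lin)
  \<comment> \<open>The change of variables is an involution.\<close>
  have NN: "(\<lambda>y. - (A y + ?N y) - D y) = B" by (simp add: fun_eq_iff)
  have iD': "\<iota> (d (a + b + c - 1) x) = D (\<iota> x)" "\<iota> (d (a + c + b - 1) x) = D (\<iota> x)" for x
    using iD[of x] unfolding ars by (simp_all add: ac_simps)
  have f': "\<And>\<sigma>. \<sigma> permutes {1..Suc a} \<Longrightarrow> act (Suc a) \<sigma> f = f" using f unfolding ars .
  note 1 = asc_formula[where A = A and B = B and D = D and \<iota> = \<iota> and f = f and g = g and h = h,
      OF A B D i AB AD BD iD'(1)]
  have 2: "asc \<iota> A ?N (int a) (int c - 1) (int b - 1) f h g = (if 1 \<le> a then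
    \<Sum>\<gamma>\<in>Sh (a + c + b - 1) (blocks c b). psubst ?N (\<lambda>x. psubst B
      (\<lambda>u. \<iota> (act (a + c + b - 1) \<gamma> u)) (circ (a + c) b (c + 1) x g)) (circ (Suc a) c 1 f h) else 0)"
    using asc_formula[where A = A and B = ?N and D = D and \<iota> = \<iota> and f = f and g = h and h = g,
        OF A addN D i AN AD ND iD'(2)]
    by (simp only: NN)
  have gh: "g \<in> P b q" "h \<in> P c r" using g h by (simp_all only: ars)
  have "asc \<iota> A B (int a) (int b - 1) (int c - 1) f g h =
      koszul q r (asc \<iota> A ?N (int a) (int c - 1) (int b - 1) f h g)"
    unfolding 1 2 by (rule asc_symmetric_nat[where A = A and B = B and D = D and \<iota> = \<iota> and a = a,
          OF A B D i AB AD BD f' gh iD'(1)])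
  then show ?thesis by (simp only: eqs)
qed

section \<open>Invariance of the box product\<close>

lemma map_poly_act_subst_neg:
  assumes "\<sigma> permutes {1..n}"
  shows "map_poly (act n \<sigma>) (subst_neg (d n) q) = subst_neg (d n) (map_poly (act n \<sigma>) q)"
  by (rule map_poly_subst_neg[OF act_add d_add d_add act_d[OF assms]])

text \<open>
  For invariant \<open>f\<close> and \<open>g\<close>, the summand \<open>f \<circ>\<^sup>1 g\<close> is invariant under the permutations \<open>\<kappa>\<close> that preserve
  the inputs of \<open>g\<close>, for these are of the form $\alpha \circ_1 \tau$ with $\alpha(1) = 1$. So the box
  product is a sum over the cosets of a subgroup, and \<open>\<rho>\<close> only permutes the summands.
\<close>

lemma nbox_invariant:
  assumes f: "\<And>\<sigma>. \<sigma> permutes {1..Suc a} \<Longrightarrow> act (Suc a) \<sigma> f = f"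
    and g: "\<And>\<sigma>. \<sigma> permutes {1..b} \<Longrightarrow> act b \<sigma> g = g"
    and r: "\<rho> permutes {1..a + b}"
  shows "map_poly (act (a + b) \<rho>) (nbox a b f g) = nbox a b f g"
proof -
  let ?N = "a + b" and ?q = "circ (Suc a) b 1 f g"
  let ?S = "Sh (a + b) (\<lambda>v. v \<le> b)"
  let ?Q = "subst_neg (d ?N) ?q"
  have inv: "map_poly (act ?N \<kappa>) ?Q = ?Q" if k: "\<kappa> permutes {1..?N}" "\<kappa> ` {1..b} = {1..b}" for \<kappa>
  proof -
    have k': "\<kappa> permutes {1..Suc a + b - 1}" "\<kappa> ` {1..b} = {1..<1 + b}"
      using k by (simp_all add: atLeastLessThanSuc_atLeastAtMost)
    obtain \<alpha> \<tau> where at: "\<alpha> permutes {1..Suc a}" "\<tau> permutes {1..b}" "\<alpha> 1 = 1"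
      "\<kappa> = perm_circ (Suc a) b 1 \<alpha> \<tau>"
      by (rule ex_perm_circ_1[OF k'(1) _ _ k'(2)]) auto
    have "?q = circ (Suc a) b 1 (act (Suc a) \<alpha> f) (act b \<tau> g)" using f at(1) g at(2) by simp
    also have "\<dots> = map_poly (act ?N \<kappa>) ?q"
      using equivariance[of 1 "Suc a" \<alpha> \<tau> b f g] at k(1) by simp
    finally show ?thesis unfolding map_poly_act_subst_neg[OF k(1)] by simp
  qed
  obtain \<phi> where bij: "bij_betw \<phi> ?S ?S" and coset: "\<And>\<alpha>. \<alpha> \<in> ?S \<Longrightarrow>
      \<exists>\<kappa>. \<kappa> permutes {1..?N} \<and> \<kappa> ` {1..b} = {1..b} \<and> \<alpha> \<circ> \<rho> = \<kappa> \<circ> \<phi> \<alpha>"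
    using shuffle_coset_action[OF r, of b] by auto
  have comp: "map_poly (act ?N \<tau>) (map_poly (act ?N \<sigma>) x) = map_poly (act ?N (\<sigma> \<circ> \<tau>)) x"
    if "\<sigma> permutes {1..?N}" "\<tau> permutes {1..?N}" for \<sigma> \<tau> x
    by (rule poly_eqI) (simp add: coeff_map_poly zero_simps act_comp[OF that])
  have "map_poly (act ?N \<rho>) (nbox a b f g) = (\<Sum>\<alpha>\<in>?S. map_poly (act ?N \<rho>) (map_poly (act ?N \<alpha>) ?Q))"
    unfolding nbox_def by (rule additive.sum[OF additive_map_poly[OF act_add]])
  also have "\<dots> = (\<Sum>\<alpha>\<in>?S. map_poly (act ?N (\<phi> \<alpha>)) ?Q)"
  proof (rule sum.cong[OF refl])
    fix \<alpha> assume al: "\<alpha> \<in> ?S"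
    then obtain \<kappa> where k: "\<kappa> permutes {1..?N}" "\<kappa> ` {1..b} = {1..b}" "\<alpha> \<circ> \<rho> = \<kappa> \<circ> \<phi> \<alpha>"
      using coset by blast
    have m: "\<phi> \<alpha> \<in> ?S" using bij al by (auto simp: bij_betw_def)
    have "map_poly (act ?N (\<kappa> \<circ> \<phi> \<alpha>)) ?Q = map_poly (act ?N (\<phi> \<alpha>)) ?Q"
      using comp[OF k(1) Sh_permutes[OF m], of ?Q] unfolding inv[OF k(1,2)] by (rule sym)
    then show "map_poly (act ?N \<rho>) (map_poly (act ?N \<alpha>) ?Q) = map_poly (act ?N (\<phi> \<alpha>)) ?Q"
      unfolding comp[OF Sh_permutes[OF al] r] k(3) .
  qed
  also have "\<dots> = nbox a b f g" unfolding nbox_def by (rule sum.reindex_bij_betw[OF bij])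
  finally show ?thesis .
qed

end

section \<open>The commutator bracket\<close>

lemma polys_add:
  assumes "\<And>x y. x \<in> S \<Longrightarrow> y \<in> S \<Longrightarrow> x + y \<in> S"
  shows "p \<in> polys S \<Longrightarrow> q \<in> polys S \<Longrightarrow> p + q \<in> polys S"
  using assms by (simp add: polys_def)

lemma polys_diff:
  assumes "\<And>x y. x \<in> S \<Longrightarrow> y \<in> S \<Longrightarrow> x - y \<in> S"
  shows "p \<in> polys S \<Longrightarrow> q \<in> polys S \<Longrightarrow> p - q \<in> polys S"
  using assms by (simp add: polys_def)

lemma polys_sum:
  assumes "0 \<in> S" "\<And>x y. x \<in> S \<Longrightarrow> y \<in> S \<Longrightarrow> x + y \<in> S" "\<And>i. i \<in> I \<Longrightarrow> q i \<in> polys S"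
  shows "(\<Sum>i\<in>I. q i) \<in> polys S"
  using assms by (induction I rule: infinite_finite_induct) (auto simp: polys_def)

lemma polys_mono: "S \<subseteq> T \<Longrightarrow> polys S \<subseteq> polys T"
  by (auto simp: polys_def)

lemma polys_map_poly: "q \<in> polys S \<Longrightarrow> f 0 = 0 \<Longrightarrow> (\<And>x. x \<in> S \<Longrightarrow> f x \<in> T) \<Longrightarrow> map_poly f q \<in> polys T"
  by (simp add: polys_def coeff_map_poly)

lemma wholeI: "0 \<in> V (1 - p) \<Longrightarrow> x \<in> V p \<Longrightarrow> x \<in> whole V"
  unfolding whole_def by (cases p) force+

lemma psubst_koszul:
  assumes "additive A"
  shows "psubst A (\<lambda>c. koszul p q (F c)) x = koszul p q (psubst A F x)"
  by (simp add: koszul_def psubst_uminus_fun[OF assms])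

context total_operad
begin

lemma vs: "vector_space scale"
  using superspace by (simp add: superspace_def)

lemma P_subspace: "module.subspace scale (P n p)"
  using superspace by (simp add: superspace_def)

lemma P_zero: "0 \<in> P n p"
proof -
  interpret vector_space scale by (rule vs)
  show ?thesis by (rule subspace_0[OF P_subspace])
qed

lemma P_add: "x \<in> P n p \<Longrightarrow> y \<in> P n p \<Longrightarrow> x + y \<in> P n p"
proof -
  interpret vector_space scale by (rule vs)
  show "x \<in> P n p \<Longrightarrow> y \<in> P n p \<Longrightarrow> x + y \<in> P n p" by (rule subspace_add[OF P_subspace])
qed

lemma P_diff: "x \<in> P n p \<Longrightarrow> y \<in> P n p \<Longrightarrow> x - y \<in> P n p"
proof -
  interpret vector_space scale by (rule vs)
  show "x \<in> P n p \<Longrightarrow> y \<in> P n p \<Longrightarrow> x - y \<in> P n p" by (rule subspace_diff[OF P_subspace])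
qed

lemma P_scale: "x \<in> P n p \<Longrightarrow> scale c x \<in> P n p"
proof -
  interpret vector_space scale by (rule vs)
  show "x \<in> P n p \<Longrightarrow> scale c x \<in> P n p" by (rule subspace_scale[OF P_subspace])
qed

lemma P_whole: "x \<in> P n p \<Longrightarrow> x \<in> whole (P n)"
  by (rule wholeI[where p = p]) (rule P_zero)

lemma whole_zero: "0 \<in> whole (P n)"
  by (rule P_whole[OF P_zero])

lemma whole_add: "x \<in> whole (P n) \<Longrightarrow> y \<in> whole (P n) \<Longrightarrow> x + y \<in> whole (P n)"
proof -
  assume "x \<in> whole (P n)" "y \<in> whole (P n)"
  then obtain x0 x1 y0 y1 where "x0 \<in> P n 0" "x1 \<in> P n 1" "y0 \<in> P n 0" "y1 \<in> P n 1"
    "x = x0 + x1" "y = y0 + y1" by (auto simp: whole_def)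
  then have "x + y = (x0 + y0) + (x1 + y1)" "x0 + y0 \<in> P n 0" "x1 + y1 \<in> P n 1"
    by (simp_all add: P_add ac_simps)
  then show ?thesis unfolding whole_def by blast
qed

lemma box_in:
  assumes f: "f \<in> P (ar n) p" and g: "g \<in> P (ar m) q"
  shows "box d act circ n m f g \<in> polys (P (ar (n + m)) (p + q))"
proof (cases n m rule: box_cases)
  case 1
  then show ?thesis by (simp add: box_eq_0 polys_def P_zero)
next
  case (2 a b)
  have ars: "ar n = Suc a" "ar m = b" "ar (n + m) = a + b"
    using 2 by (simp_all add: ar_def nat_add_distrib)
  have "circ (Suc a) b 1 f g \<in> polys (P (a + b) (p + q))"
    using circ_in[of 1 "Suc a" f p g b q] f g by (simp add: ars)
  then have "subst_neg (d (a + b)) (circ (Suc a) b 1 f g) \<in> polys (P (a + b) (p + q))"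
    by (intro coeff_subst_neg_mem) (auto intro: d_in P_diff P_zero simp: zero_simps)
  then have "nbox a b f g \<in> polys (P (a + b) (p + q))"
    unfolding nbox_def
    by (intro polys_sum P_zero P_add polys_map_poly[where S = "P (a + b) (p + q)"])
      (auto intro: act_in Sh_permutes simp: zero_simps)
  then show ?thesis using 2 ars by (simp add: box_eq_nbox)
qed

lemma box_whole:
  assumes "f \<in> whole (P (ar n))" "g \<in> whole (P (ar m))"
  shows "box d act circ n m f g \<in> polys (whole (P (ar (n + m))))"
proof -
  obtain f0 f1 g0 g1 where *: "f0 \<in> P (ar n) 0" "f1 \<in> P (ar n) 1" "g0 \<in> P (ar m) 0" "g1 \<in> P (ar m) 1"
    and eq: "f = f0 + f1" "g = g0 + g1"
    using assms by (auto simp: whole_def)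
  have hom: "box d act circ n m x y \<in> polys (whole (P (ar (n + m))))"
    if "x \<in> P (ar n) p" "y \<in> P (ar m) q" for x y p q
    using box_in[OF that] polys_mono[of "P (ar (n + m)) (p + q)"] P_whole by blast
  show ?thesis
    unfolding eq additive.add[OF additive_box_left] additive.add[OF additive_box_right]
    by (intro polys_add[OF whole_add] hom[OF *(1) *(3)] hom[OF *(2) *(3)] hom[OF *(1) *(4)] hom[OF *(2) *(4)])
qed

lemma W_invariant:
  "f \<in> W P act n \<Longrightarrow> n \<ge> -1 \<Longrightarrow> \<sigma> permutes {1..ar n} \<Longrightarrow> act (ar n) \<sigma> f = f"
  by (simp add: W_def)

lemma W_zero: "0 \<in> W P act n"
  by (simp add: W_def whole_zero zero_simps)

lemma W_whole: "f \<in> W P act n \<Longrightarrow> f \<in> whole (P (ar n))"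
  by (auto simp: W_def whole_zero split: if_splits)

lemma W_add: "x \<in> W P act n \<Longrightarrow> y \<in> W P act n \<Longrightarrow> x + y \<in> W P act n"
  by (auto simp: W_def whole_add additive.add[OF act_add] split: if_splits)

lemma d_whole: "x \<in> whole (P n) \<Longrightarrow> d n x \<in> whole (P n)"
  unfolding whole_def using d_in additive.add[OF d_add] by force

lemma scale_add: "scale c (x + y) = scale c x + scale c y"
proof -
  interpret vector_space scale by (rule vs)
  show ?thesis by (rule scale_right_distrib)
qed

lemma additive_scale: "additive (scale c)"
  by (simp add: additive_def scale_add)

lemma scale_minus_one: "scale (- 1) x = - x"
proof -
  interpret vector_space scale by (rule vs)
  show ?thesis by simp
qed

lemma whole_scale: "x \<in> whole (P n) \<Longrightarrow> scale c x \<in> whole (P n)"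
proof -
  assume "x \<in> whole (P n)"
  then obtain x0 x1 where "x0 \<in> P n 0" "x1 \<in> P n 1" "x = x0 + x1" by (auto simp: whole_def)
  then have "scale c x = scale c x0 + scale c x1" "scale c x0 \<in> P n 0" "scale c x1 \<in> P n 1"
    by (auto simp: scale_add P_scale)
  then show ?thesis unfolding whole_def by blast
qed

lemma W_scale: "x \<in> W P act n \<Longrightarrow> scale c x \<in> W P act n"
  by (auto simp: W_def whole_scale act_scale additive.zero[OF additive_scale] split: if_splits)

lemma W_diff: "x \<in> W P act n \<Longrightarrow> y \<in> W P act n \<Longrightarrow> x - y \<in> W P act n"
  using W_add[of x n "- y"] W_scale[of y n "-1"] by (simp add: scale_minus_one)

lemma W_d: "x \<in> W P act n \<Longrightarrow> d (ar n) x \<in> W P act n"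
  by (auto simp: W_def d_whole act_d zero_simps split: if_splits)

theorem box_W:
  assumes nm: "n \<ge> -1" "m \<ge> -1" and f: "f \<in> W P act n" and g: "g \<in> W P act m"
  shows "box d act circ n m f g \<in> polys (W P act (n + m))"
proof (cases n m rule: box_cases)
  case 1
  then show ?thesis by (simp add: box_eq_0 polys_def W_zero)
next
  case (2 a b)
  have ars: "ar n = Suc a" "ar m = b" "ar (n + m) = a + b"
    using 2 by (simp_all add: ar_def nat_add_distrib)
  have "map_poly (act (a + b) \<rho>) (nbox a b f g) = nbox a b f g" if "\<rho> permutes {1..a + b}" for \<rho>
    by (rule nbox_invariant) (use W_invariant[OF f nm(1)] W_invariant[OF g nm(2)] that ars in auto)
  then have "act (a + b) \<rho> (coeff (nbox a b f g) k) = coeff (nbox a b f g) k"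
    if "\<rho> permutes {1..a + b}" for \<rho> k
    using that coeff_map_poly[of "act (a + b) \<rho>" "nbox a b f g" k] by (simp add: zero_simps)
  moreover have "n + m \<ge> -1" using 2 by simp
  moreover have "box d act circ n m f g \<in> polys (whole (P (ar (n + m))))"
    by (rule box_whole[OF W_whole[OF f] W_whole[OF g]])
  ultimately show ?thesis using 2 ars by (simp add: box_eq_nbox polys_def W_def)
qed

text \<open>
  The commutator with the sign of elements of parities \<open>p\<close>, \<open>q\<close> is defined for arbitrary elements,
  which makes it biadditive; it has its meaning only for elements of these parities.
\<close>

definition brs :: "bit \<Rightarrow> bit \<Rightarrow> int \<Rightarrow> int \<Rightarrow> 'v \<Rightarrow> 'v \<Rightarrow> 'v poly" where
  "brs p q n m f g =
     box d act circ n m f g - koszul p q (subst_neg (d (ar (n + m))) (box d act circ m n g f))"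

lemma additive_brs_left: "additive (\<lambda>f. brs p q n m f g)"
  unfolding brs_def
  by (intro additive_diff additive_box_left additive_comp[OF additive_koszul]
      additive_comp[OF additive_subst_neg[OF d_add]] additive_box_right)

lemma additive_brs_right: "additive (brs p q n m f)"
  unfolding brs_def
  by (intro additive_diff additive_box_right additive_comp[OF additive_koszul]
      additive_comp[OF additive_subst_neg[OF d_add]] additive_box_left)

lemma psubst_brs:
  assumes A: "additive A" and i: "additive \<iota>" and E: "additive E"
    and iE: "\<And>c. \<iota> (d (ar (n + m)) c) = E (\<iota> c)" and AE: "\<And>x. A (E x) = E (A x)"
  shows "psubst A \<iota> (brs p q n m f g) = psubst A \<iota> (box d act circ n m f g) -
    koszul p q (psubst (\<lambda>x. - A x - E x) \<iota> (box d act circ m n g f))"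
  unfolding brs_def additive.diff[OF additive_psubst[OF A i]] koszul_additive[OF additive_psubst[OF A i]]
    psubst_subst_neg[where A = A and F = \<iota> and E = E, OF A i d_add E iE AE] by (rule refl)

text \<open>The two halves of the associator, $(f_A g)_{A+B} h$ and $f_A(g_B h)$.\<close>

definition nested_left :: "('v \<Rightarrow> 'm::ab_group_add) \<Rightarrow> ('m \<Rightarrow> 'm) \<Rightarrow> ('m \<Rightarrow> 'm) \<Rightarrow> int \<Rightarrow> int \<Rightarrow> int \<Rightarrow> 'v \<Rightarrow> 'v \<Rightarrow> 'v \<Rightarrow> 'm" where
  "nested_left \<iota> A B n m l f g h =
    psubst A (\<lambda>x. psubst (\<lambda>y. A y + B y) \<iota> (box d act circ (n + m) l x h)) (box d act circ n m f g)"

definition nested_right :: "('v \<Rightarrow> 'm::ab_group_add) \<Rightarrow> ('m \<Rightarrow> 'm) \<Rightarrow> ('m \<Rightarrow> 'm) \<Rightarrow> int \<Rightarrow> int \<Rightarrow> int \<Rightarrow> 'v \<Rightarrow> 'v \<Rightarrow> 'v \<Rightarrow> 'm" where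
  "nested_right \<iota> A B n m l f g h =
    psubst B (\<lambda>x. psubst A \<iota> (box d act circ n (m + l) f x)) (box d act circ m l g h)"

lemma asc_eq: "asc \<iota> A B n m l f g h = nested_left \<iota> A B n m l f g h - nested_right \<iota> A B n m l f g h"
  by (simp add: asc_def nested_left_def nested_right_def)

context
  fixes A B C D :: "'m::ab_group_add \<Rightarrow> 'm" and \<iota> :: "'v \<Rightarrow> 'm"
  assumes A: "additive A" and B: "additive B" and D: "additive D" and i: "additive \<iota>"
    and AB: "\<And>x. A (B x) = B (A x)" and AD: "\<And>x. A (D x) = D (A x)" and BD: "\<And>x. B (D x) = D (B x)"
    and C: "\<And>x. C x = - (A x + B x) - D x"
begin

lemmas br_lin = additive.add[OF A] additive.add[OF B] additive.add[OF D] additive.minus[OF A] additive.minus[OF B]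
    additive.minus[OF D] additive.diff[OF A] additive.diff[OF B] additive.diff[OF D] AB AD BD

text \<open>
  Expansions of the nested brackets $[f_A[g_B h]]$ and $[[f_A g]_{A+B} h]$. In all eight terms, moving
  $\partial$ out of the inner product leaves only the operators \<open>A\<close>, \<open>B\<close> and \<open>C\<close> with
  $A+B+C+D = 0$, each of them attached to one of \<open>f\<close>, \<open>g\<close> and \<open>h\<close>.
\<close>

lemma nested_bracket_outer:
  assumes iD: "\<And>x. \<iota> (d (ar (n + m + l)) x) = D (\<iota> x)"
  shows "psubst B (\<lambda>x. psubst A \<iota> (brs p s n (m + l) f x)) (brs q r m l g h) =
    nested_right \<iota> A B n m l f g h - koszul q r (nested_right \<iota> A C n l m f h g) -
    koszul p s (nested_left \<iota> B C m l n g h f - koszul q r (nested_left \<iota> C B l m n h g f))"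
proof -
  let ?K = "\<lambda>y. - A y - D y" and ?E = "\<lambda>y. A y + D y"
  have K: "additive ?K" and E: "additive ?E" by (intro additive_intros A D)+
  define U where "U x = psubst A \<iota> (box d act circ n (m + l) f x)" for x
  define V where "V x = psubst ?K \<iota> (box d act circ (m + l) n x f)" for x
  have U: "additive U" unfolding U_def by (rule additive_comp[OF additive_psubst[OF A i] additive_box_right])
  have V: "additive V" unfolding V_def by (rule additive_comp[OF additive_psubst[OF K i] additive_box_left])
  have iD': "\<iota> (d (ar (n + (m + l))) x) = D (\<iota> x)" "\<iota> (d (ar (m + l + n)) x) = D (\<iota> x)" for x
    using iD[of x] by (simp_all add: ac_simps)
  have KD: "?K (D x) = D (?K x)" for x by (simp add: br_lin)
  have Ud: "U (d (ar (m + l)) x) = ?E (U x)" for x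
    unfolding U_def by (rule psubst_box_d_right[where A = A and D = D and \<iota> = \<iota>, OF A i D iD'(1) AD])
  have Vd: "V (d (ar (m + l)) x) = ?E (V x)" for x
    unfolding V_def psubst_box_d_left[where A = ?K and D = D and \<iota> = \<iota>, OF K i D iD'(2) KD] by simp
  have BE: "B (?E x) = ?E (B x)" for x by (simp add: br_lin)
  have CE: "(\<lambda>x. - B x - ?E x) = C" by (simp add: fun_eq_iff C algebra_simps)
  have BC: "(\<lambda>y. B y + C y) = ?K" and CB: "(\<lambda>y. C y + B y) = ?K" by (simp_all add: fun_eq_iff C)
  note eU = psubst_brs[where A = B and \<iota> = U and E = ?E, OF B U E Ud BE, unfolded CE]
  note eV = psubst_brs[where A = B and \<iota> = V and E = ?E, OF B V E Vd BE, unfolded CE]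
  have "psubst A \<iota> (brs p s n (m + l) f x) = U x - koszul p s (V x)" for x
    unfolding U_def V_def
    by (rule psubst_brs[where A = A and E = D and \<iota> = \<iota>, OF A i D iD'(1) AD])
  then have "psubst B (\<lambda>x. psubst A \<iota> (brs p s n (m + l) f x)) (brs q r m l g h) =
      psubst B U (brs q r m l g h) - koszul p s (psubst B V (brs q r m l g h))"
    by (simp add: psubst_diff_fun[OF B] psubst_koszul[OF B])
  also have "\<dots> = nested_right \<iota> A B n m l f g h - koszul q r (nested_right \<iota> A C n l m f h g) -
    koszul p s (nested_left \<iota> B C m l n g h f - koszul q r (nested_left \<iota> C B l m n h g f))"
    unfolding eU eV nested_right_def nested_left_def BC CB U_def V_def add.commute[of l m] by (rule refl)
  finally show ?thesis .
qed

lemma nested_bracket_inner: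
  assumes iD: "\<And>x. \<iota> (d (ar (n + m + l)) x) = D (\<iota> x)"
  shows "psubst A (\<lambda>x. psubst (\<lambda>y. A y + B y) \<iota> (brs s r (n + m) l x h)) (brs p q n m f g) =
    nested_left \<iota> A B n m l f g h - koszul p q (nested_left \<iota> B A m n l g f h) -
    koszul s r (nested_right \<iota> C A l n m h f g - koszul p q (nested_right \<iota> C B l m n h g f))"
proof -
  let ?S = "\<lambda>y. A y + B y" and ?E = "\<lambda>y. - (A y + B y)"
  have S: "additive ?S" and E: "additive ?E" and addC: "additive C"
    unfolding C[abs_def] by (intro additive_intros A B D)+
  define U where "U x = psubst ?S \<iota> (box d act circ (n + m) l x h)" for x
  define V where "V x = psubst C \<iota> (box d act circ l (n + m) h x)" for x
  have U: "additive U" unfolding U_def by (rule additive_comp[OF additive_psubst[OF S i] additive_box_left])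
  have V: "additive V" unfolding V_def by (rule additive_comp[OF additive_psubst[OF addC i] additive_box_right])
  have iD': "\<iota> (d (ar (l + (n + m))) x) = D (\<iota> x)" for x
    using iD[of x] by (simp_all add: ac_simps)
  have SD: "?S (D x) = D (?S x)" and CD: "C (D x) = D (C x)" for x by (simp_all add: br_lin C)
  have Ud: "U (d (ar (n + m)) x) = ?E (U x)" for x
    unfolding U_def by (rule psubst_box_d_left[where A = ?S and D = D and \<iota> = \<iota>, OF S i D iD SD])
  have Vd: "V (d (ar (n + m)) x) = ?E (V x)" for x
    unfolding V_def psubst_box_d_right[where A = C and D = D and \<iota> = \<iota>, OF addC i D iD' CD] by (simp add: C)
  have AE: "A (?E x) = ?E (A x)" for x by (simp add: br_lin)
  have BE: "(\<lambda>x. - A x - ?E x) = B" by (simp add: fun_eq_iff)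
  have CE: "(\<lambda>x. - ?S x - D x) = C" by (simp add: fun_eq_iff C)
  note eU = psubst_brs[where A = A and \<iota> = U and E = ?E, OF A U E Ud AE, unfolded BE]
  note eV = psubst_brs[where A = A and \<iota> = V and E = ?E, OF A V E Vd AE, unfolded BE]
  have BA: "(\<lambda>y. B y + A y) = ?S" by (simp add: fun_eq_iff add.commute)
  have "psubst ?S \<iota> (brs s r (n + m) l x h) = U x - koszul s r (V x)" for x
    unfolding U_def V_def
    by (rule psubst_brs[where A = ?S and E = D and \<iota> = \<iota>, OF S i D iD SD, unfolded CE])
  then have "psubst A (\<lambda>x. psubst ?S \<iota> (brs s r (n + m) l x h)) (brs p q n m f g) =
      psubst A U (brs p q n m f g) - koszul s r (psubst A V (brs p q n m f g))"
    by (simp add: psubst_diff_fun[OF A] psubst_koszul[OF A])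
  also have "\<dots> = nested_left \<iota> A B n m l f g h - koszul p q (nested_left \<iota> B A m n l g f h) -
    koszul s r (nested_right \<iota> C A l n m h f g - koszul p q (nested_right \<iota> C B l m n h g f))"
    unfolding eU eV nested_right_def nested_left_def BA U_def V_def add.commute[of m n] by (rule refl)
  finally show ?thesis .
qed

end

text \<open>
  The twelve terms of the Jacobi identity form six associators, two for each of the three elements in
  first position, and those two cancel by the symmetry of the associator in its last two arguments.
\<close>

theorem brs_jacobi:
  fixes A B D :: "'m::ab_group_add \<Rightarrow> 'm"
  assumes A: "additive A" and B: "additive B" and D: "additive D" and i: "additive \<iota>"
    and AB: "\<And>x. A (B x) = B (A x)" and AD: "\<And>x. A (D x) = D (A x)" and BD: "\<And>x. B (D x) = D (B x)"
    and iD: "\<And>x. \<iota> (d (ar (n + m + l)) x) = D (\<iota> x)"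
    and nml: "n \<ge> -1" "m \<ge> -1" "l \<ge> -1"
    and f: "f \<in> W P act n" "f \<in> P (ar n) p" and g: "g \<in> W P act m" "g \<in> P (ar m) q"
    and h: "h \<in> W P act l" "h \<in> P (ar l) r"
  shows "psubst B (\<lambda>x. psubst A \<iota> (brs p (q + r) n (m + l) f x)) (brs q r m l g h) -
      koszul p q (psubst A (\<lambda>x. psubst B \<iota> (brs q (p + r) m (n + l) g x)) (brs p r n l f h)) =
    psubst A (\<lambda>x. psubst (\<lambda>y. A y + B y) \<iota> (brs (p + q) r (n + m) l x h)) (brs p q n m f g)"
proof -
  define C where "C y = - (A y + B y) - D y" for y
  have addC: "additive C" unfolding C_def by (intro additive_intros A B D)
  note lin = additive.add[OF A] additive.add[OF B] additive.add[OF D] additive.minus[OF A] additive.minus[OF B]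
    additive.minus[OF D] additive.diff[OF A] additive.diff[OF B] additive.diff[OF D] AB AD BD
  have CA: "C (A x) = A (C x)" and CD: "C (D x) = D (C x)" for x by (simp_all add: C_def lin)
  have C': "C x = - (B x + A x) - D x" for x by (simp add: C_def add.commute)
  have NC: "(\<lambda>y. - (A y + B y) - D y) = C" "(\<lambda>y. - (B y + A y) - D y) = C"
    "(\<lambda>y. - (C y + A y) - D y) = B" by (simp_all add: fun_eq_iff C_def add.commute)
  have iD': "\<iota> (d (ar (m + n + l)) x) = D (\<iota> x)" "\<iota> (d (ar (l + n + m)) x) = D (\<iota> x)" for x
    using iD[of x] by (simp_all add: ac_simps)
  note 1 = nested_bracket_outer[where A = A and B = B and C = C and D = D and \<iota> = \<iota>,
      OF A B D i AB AD BD C_def iD]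
  note 2 = nested_bracket_outer[where A = B and B = A and C = C and D = D and \<iota> = \<iota>,
      OF B A D i AB[symmetric] BD AD C' iD'(1)]
  note 3 = nested_bracket_inner[where A = A and B = B and C = C and D = D and \<iota> = \<iota>,
      OF A B D i AB AD BD C_def iD]
  have s1: "nested_left \<iota> A B n m l f g h - nested_right \<iota> A B n m l f g h =
      koszul q r (nested_left \<iota> A C n l m f h g - nested_right \<iota> A C n l m f h g)"
    using asc_symmetric[where A = A and B = B and D = D and \<iota> = \<iota>,
        OF A B D i AB AD BD iD nml W_invariant[OF f(1) nml(1)] g(2) h(2)]
    unfolding NC asc_eq .
  have s2: "nested_left \<iota> B A m n l g f h - nested_right \<iota> B A m n l g f h =
      koszul p r (nested_left \<iota> B C m l n g h f - nested_right \<iota> B C m l n g h f)"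
    using asc_symmetric[where A = B and B = A and D = D and \<iota> = \<iota>,
        OF B A D i AB[symmetric] BD AD iD'(1) nml(2,1,3) W_invariant[OF g(1) nml(2)] f(2) h(2)]
    unfolding NC asc_eq .
  have s3: "nested_left \<iota> C A l n m h f g - nested_right \<iota> C A l n m h f g =
      koszul p q (nested_left \<iota> C B l m n h g f - nested_right \<iota> C B l m n h g f)"
    using asc_symmetric[where A = C and B = A and D = D and \<iota> = \<iota>,
        OF addC A D i CA CD AD iD'(2) nml(3,1,2) W_invariant[OF h(1) nml(3)] f(2) g(2)]
    unfolding NC asc_eq .
  have t1: "nested_left \<iota> A B n m l f g h = nested_right \<iota> A B n m l f g h +
      koszul q r (nested_left \<iota> A C n l m f h g - nested_right \<iota> A C n l m f h g)"
    using s1 by (simp add: diff_eq_eq add.commute)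
  have t2: "nested_left \<iota> B A m n l g f h = nested_right \<iota> B A m n l g f h +
      koszul p r (nested_left \<iota> B C m l n g h f - nested_right \<iota> B C m l n g h f)"
    using s2 by (simp add: diff_eq_eq add.commute)
  have t3: "nested_right \<iota> C A l n m h f g = nested_left \<iota> C A l n m h f g -
      koszul p q (nested_left \<iota> C B l m n h g f - nested_right \<iota> C B l m n h g f)"
    using s3 by (simp add: algebra_simps)
  \<comment> \<open>With one half of one associator in each pair eliminated, every remaining term cancels.\<close>
  show ?thesis
    unfolding 1 2 3 t1 t2 t3
    by (cases p; cases q; cases r) (simp_all add: koszul_def algebra_simps)
qed

end

section \<open>The associator in two formal variables\<close>

context total_operad
begin

lemma associator_eq_asc:
  "associator d act circ n m l f g h = asc (\<lambda>c. [:[:c:]:]) mlam mmu n m l f g h"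
  unfolding associator_def asc_def var_to_def mlammu_def[abs_def] by (rule refl)

text \<open>
  Substituting $-\lambda-\mu-\partial$ for $\mu$ is the evaluation of the formal associator at the operators
  $\lambda$ and $-\lambda-\mu-\partial$, so this is the symmetry established above.
\<close>

theorem associator_symmetric:
  assumes nml: "n \<ge> -1" "m \<ge> -1" "l \<ge> -1"
    and f: "f \<in> W P act n" and g: "g \<in> P (ar m) q" and h: "h \<in> P (ar l) r"
  shows "associator d act circ n m l f g h =
    koszul q r (psubst mlam (var_to (mneg (d (ar (n + m + l))))) (associator d act circ n l m f h g))"
proof -
  let ?c = "\<lambda>c::'v. [:[:c:]:]"
  define D where "D = map_poly (map_poly (d (ar (n + m + l))))"
  let ?N = "\<lambda>y. - (mlam y + mmu y) - D y"
  note add = additive_mlam additive_mmu additive_poly_poly_const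
  have D: "additive D" unfolding D_def by (intro additive_intros d_add)
  have LD: "mlam (D x) = D (mlam x)" for x
    by (simp add: mlam_def D_def map_poly_pCons0 additive_map_poly d_add)
  have UD: "mmu (D x) = D (mmu x)" for x
    by (rule poly_eqI)
      (simp add: mmu_def D_def coeff_map_poly map_poly_pCons0 additive_map_poly d_add zero_simps)
  have N: "additive ?N" by (intro additive_intros add D)
  have LN: "mlam (?N x) = ?N (mlam x)" for x
    by (simp add: additive.diff[OF add(1)] additive.minus[OF add(1)] additive.add[OF add(1)] LD mlam_mmu)
  have N_eq: "mneg (d (ar (n + m + l))) = ?N"
    by (simp add: fun_eq_iff mneg_def D_def)
  have iD: "?c (d (ar (n + m + l)) x) = D (?c x)" for x
    by (simp add: D_def map_poly_pCons0 additive_map_poly d_add)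
  let ?e = "psubst mlam (psubst ?N ?c)"
  note e = additive_eval2[where X = mlam and Y = ?N and \<kappa> = ?c, OF add(1) N add(3) LN]
  note eL = eval2_mlam[where X = mlam and Y = ?N and \<kappa> = ?c, OF add(1) N add(3) LN]
  note eU = eval2_mmu[where X = mlam and Y = ?N and \<kappa> = ?c, OF add(1) N add(3) LN]
  note eV = eval2_var_to[where X = mlam and Y = ?N and \<kappa> = ?c, OF add(1) N add(3) LN]
  have eS: "?e (mlam x + mmu x) = mlam (?e x) + ?N (?e x)" for x
    unfolding additive.add[OF e] eL eU by (rule refl)
  have v: "psubst mlam (var_to ?N) = ?e" by (simp add: var_to_def[abs_def])
  have "?e (asc ?c mlam mmu n l m f h g) = asc ?c mlam ?N n l m f h g"
    unfolding asc_def additive.diff[OF e]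
      psubst_natural[where e = ?e and A = mlam and A' = mlam and q = "box d act circ n l f h", OF e eL]
      psubst_natural[where e = ?e and A = mmu and A' = ?N and q = "box d act circ l m h g", OF e eU]
      eV[where A = "\<lambda>x. mlam x + mmu x" and A' = "\<lambda>x. mlam x + ?N x", OF eS, unfolded var_to_def]
      eV[where A = mlam and A' = mlam, OF eL, unfolded var_to_def]
    by (rule refl)
  moreover have "asc ?c mlam mmu n m l f g h = koszul q r (asc ?c mlam ?N n l m f h g)"
    by (rule asc_symmetric[where A = mlam and B = mmu and D = D and \<iota> = ?c,
        OF add(1,2) D add(3) mlam_mmu LD UD iD nml W_invariant[OF f nml(1)] g h])
  ultimately show ?thesis unfolding associator_eq_asc N_eq v by simp
qed

section \<open>Elementary properties of the commutator bracket\<close>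

lemma psubst_brs_d_left:
  assumes A: "additive A" and i: "additive \<iota>" and D: "additive D"
    and iD: "\<And>c. \<iota> (d (ar (n + m)) c) = D (\<iota> c)" and AD: "\<And>x. A (D x) = D (A x)"
  shows "psubst A \<iota> (brs p q n m (d (ar n) f) g) = - A (psubst A \<iota> (brs p q n m f g))"
proof -
  let ?K = "\<lambda>x. - A x - D x"
  have K: "additive ?K" by (intro additive_intros A D)
  have KD: "?K (D x) = D (?K x)" for x
    by (simp add: AD additive.diff[OF D] additive.minus[OF D])
  have iD': "\<iota> (d (ar (m + n)) c) = D (\<iota> c)" for c using iD by (simp add: add.commute)
  show ?thesis
    unfolding psubst_brs[where A = A and E = D, OF A i D iD AD]
      psubst_box_d_left[where A = A and D = D, OF A i D iD AD]
      psubst_box_d_right[where A = ?K and D = D, OF K i D iD' KD]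
    by (simp add: additive.diff[OF A] additive.minus[OF A] koszul_def)
qed

lemma psubst_brs_d_right:
  assumes A: "additive A" and i: "additive \<iota>" and D: "additive D"
    and iD: "\<And>c. \<iota> (d (ar (n + m)) c) = D (\<iota> c)" and AD: "\<And>x. A (D x) = D (A x)"
  shows "psubst A \<iota> (brs p q n m f (d (ar m) g)) =
    A (psubst A \<iota> (brs p q n m f g)) + D (psubst A \<iota> (brs p q n m f g))"
proof -
  let ?K = "\<lambda>x. - A x - D x"
  have K: "additive ?K" by (intro additive_intros A D)
  have KD: "?K (D x) = D (?K x)" for x
    by (simp add: AD additive.diff[OF D] additive.minus[OF D])
  have iD': "\<iota> (d (ar (m + n)) c) = D (\<iota> c)" for c using iD by (simp add: add.commute)
  show ?thesis
    unfolding psubst_brs[where A = A and E = D, OF A i D iD AD]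
      psubst_box_d_right[where A = A and D = D, OF A i D iD AD]
      psubst_box_d_left[where A = ?K and D = D, OF K i D iD' KD]
    by (simp add: additive.diff[OF A] additive.diff[OF D] additive.minus[OF A] additive.minus[OF D] koszul_def)
qed

lemma brs_d_left: "brs p q n m (d (ar n) f) g = - pCons 0 (brs p q n m f g)"
  using psubst_brs_d_left[where A = "pCons 0" and \<iota> = "\<lambda>c. [:c:]" and D = "map_poly (d (ar (n + m)))",
      of n m p q f g]
  by (simp add: psubst_pCons_const additive_intros d_add map_poly_pCons0 zero_simps)

lemma brs_d_right:
  "brs p q n m f (d (ar m) g) = pCons 0 (brs p q n m f g) + map_poly (d (ar (n + m))) (brs p q n m f g)"
  using psubst_brs_d_right[where A = "pCons 0" and \<iota> = "\<lambda>c. [:c:]" and D = "map_poly (d (ar (n + m)))",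
      of n m p q f g]
  by (simp add: psubst_pCons_const additive_intros d_add map_poly_pCons0 zero_simps)

lemma brs_skew:
  "brs p q n m f g = - koszul p q (subst_neg (d (ar (n + m))) (brs q p m n g f))"
  unfolding brs_def add.commute[of m n] additive.diff[OF additive_subst_neg[OF d_add]]
    koszul_additive[OF additive_subst_neg[OF d_add]] subst_neg_involution[OF d_add]
  by (simp add: koszul_def)

lemma map_poly_scale_subst_neg:
  "map_poly (scale c) (subst_neg (d n) q) = subst_neg (d n) (map_poly (scale c) q)"
  by (rule map_poly_subst_neg[OF additive_scale d_add d_add]) (simp add: d_scale)

lemma map_poly_scale_act:
  "map_poly (scale c) (map_poly (act n \<sigma>) q) = map_poly (act n \<sigma>) (map_poly (scale c) q)"
  by (rule poly_eqI) (simp add: coeff_map_poly zero_simps additive.zero[OF additive_scale] act_scale)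

lemma box_scale_left: "box d act circ n m (scale c f) g = map_poly (scale c) (box d act circ n m f g)"
  unfolding box_def additive.sum[OF additive_map_poly[OF additive_scale]] map_poly_scale_act
    map_poly_scale_subst_neg circ_scale_left by (rule refl)

lemma box_scale_right: "box d act circ n m f (scale c g) = map_poly (scale c) (box d act circ n m f g)"
  unfolding box_def additive.sum[OF additive_map_poly[OF additive_scale]] map_poly_scale_act
    map_poly_scale_subst_neg circ_scale_right by (rule refl)

lemma brs_scale_left: "brs p q n m (scale c f) g = map_poly (scale c) (brs p q n m f g)"
  unfolding brs_def box_scale_left box_scale_right map_poly_scale_subst_neg[symmetric]
    additive.diff[OF additive_map_poly[OF additive_scale]]
    koszul_additive[OF additive_map_poly[OF additive_scale]] by (rule refl)

lemma brs_scale_right: "brs p q n m f (scale c g) = map_poly (scale c) (brs p q n m f g)"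
  unfolding brs_def box_scale_left box_scale_right map_poly_scale_subst_neg[symmetric]
    additive.diff[OF additive_map_poly[OF additive_scale]]
    koszul_additive[OF additive_map_poly[OF additive_scale]] by (rule refl)

lemma koszul_polys:
  assumes "\<And>x y. x \<in> S \<Longrightarrow> y \<in> S \<Longrightarrow> x - y \<in> S" "0 \<in> S" "x \<in> polys S"
  shows "koszul p q x \<in> polys S"
proof -
  have "- y \<in> S" if "y \<in> S" for y using assms(1)[OF assms(2) that] by simp
  then show ?thesis using assms(3) by (simp add: koszul_def polys_def)
qed

lemma brs_in:
  assumes "f \<in> P (ar n) p" "g \<in> P (ar m) q"
  shows "brs p q n m f g \<in> polys (P (ar (n + m)) (p + q))"
proof -
  have "box d act circ m n g f \<in> polys (P (ar (n + m)) (p + q))"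
    using box_in[OF assms(2,1)] by (simp only: add.commute)
  then have "subst_neg (d (ar (n + m))) (box d act circ m n g f) \<in> polys (P (ar (n + m)) (p + q))"
    by (intro coeff_subst_neg_mem) (auto intro: d_in P_diff P_zero simp: zero_simps)
  then show ?thesis
    unfolding brs_def by (intro polys_diff P_diff box_in assms koszul_polys P_zero)
qed

lemma brs_W:
  assumes "n \<ge> -1" "m \<ge> -1" "f \<in> W P act n" "g \<in> W P act m"
  shows "brs p q n m f g \<in> polys (W P act (n + m))"
proof -
  have "box d act circ m n g f \<in> polys (W P act (n + m))"
    using box_W[OF assms(2,1,4,3)] by (simp only: add.commute)
  then have "subst_neg (d (ar (n + m))) (box d act circ m n g f) \<in> polys (W P act (n + m))"
    by (intro coeff_subst_neg_mem) (auto intro: W_d W_diff W_zero simp: zero_simps)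
  then show ?thesis
    unfolding brs_def by (intro polys_diff W_diff box_W assms koszul_polys W_zero)
qed

end

section \<open>Finitely supported families\<close>

lemma additive_single: "additive (Poly_Mapping.single n)"
  by (simp add: additive_def single_add)

lemma additive_sum_keys:
  assumes "\<And>k. additive (T k)"
  shows "additive (\<lambda>F. \<Sum>k\<in>Poly_Mapping.keys F. T k (Poly_Mapping.lookup F k))"
  unfolding additive_def
proof (intro allI)
  fix F G
  show "(\<Sum>k\<in>Poly_Mapping.keys (F + G). T k (Poly_Mapping.lookup (F + G) k)) =
      (\<Sum>k\<in>Poly_Mapping.keys F. T k (Poly_Mapping.lookup F k)) +
      (\<Sum>k\<in>Poly_Mapping.keys G. T k (Poly_Mapping.lookup G k))"
    by (rule setsum_keys_plus_distrib[where f = T])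
      (rule additive.zero[OF assms], rule additive.add[OF assms])
qed

lemma sum_keys_single:
  assumes "T n 0 = 0"
  shows "(\<Sum>k\<in>Poly_Mapping.keys (Poly_Mapping.single n x). T k (Poly_Mapping.lookup (Poly_Mapping.single n x) k)) = T n x"
  using assms by (cases "x = 0") simp_all

lemma sum_singles:
  "(\<Sum>k\<in>Poly_Mapping.keys F. Poly_Mapping.single k (Poly_Mapping.lookup F k)) = F"
proof (rule poly_mapping_eqI)
  fix j
  have "Poly_Mapping.lookup (\<Sum>k\<in>Poly_Mapping.keys F. Poly_Mapping.single k (Poly_Mapping.lookup F k)) j =
      (\<Sum>k\<in>Poly_Mapping.keys F. if k = j then Poly_Mapping.lookup F j else 0)"
    unfolding lookup_sum by (rule sum.cong) (auto simp: lookup_single)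
  also have "\<dots> = Poly_Mapping.lookup F j" by (simp add: sum.delta in_keys_iff)
  finally show "Poly_Mapping.lookup (\<Sum>k\<in>Poly_Mapping.keys F. Poly_Mapping.single k (Poly_Mapping.lookup F k)) j =
      Poly_Mapping.lookup F j" .
qed

lemma additive_zero_on_singles:
  assumes T: "additive T" and "\<And>n. T (Poly_Mapping.single n (Poly_Mapping.lookup F n)) = 0"
  shows "T F = 0"
proof -
  have "T F = (\<Sum>k\<in>Poly_Mapping.keys F. T (Poly_Mapping.single k (Poly_Mapping.lookup F k)))"
    using additive.sum[OF T] sum_singles[of F] by metis
  then show ?thesis using assms(2) by simp
qed

lemma biadditive_eqI:
  assumes S: "\<And>G. additive (\<lambda>F. S F G)" "\<And>F. additive (S F)"
    and T: "\<And>G. additive (\<lambda>F. T F G)" "\<And>F. additive (T F)"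
    and eq: "\<And>n f m g. S (Poly_Mapping.single n f) (Poly_Mapping.single m g) =
      T (Poly_Mapping.single n f) (Poly_Mapping.single m g)"
  shows "S F G = T F G"
proof -
  have "S F G - T F G = 0"
  proof (rule additive_zero_on_singles[where T = "\<lambda>F. S F G - T F G"])
    fix n let ?f = "Poly_Mapping.single n (Poly_Mapping.lookup F n)"
    show "S ?f G - T ?f G = 0"
      by (rule additive_zero_on_singles[where T = "\<lambda>G. S ?f G - T ?f G"]) (intro additive_diff S T, simp add: eq)
  qed (intro additive_diff S T)
  then show ?thesis by simp
qed

lemma additive_psubst_fun:
  assumes "additive A" "\<And>c. additive (\<lambda>a. F a c)"
  shows "additive (\<lambda>a. psubst A (F a) q)"
  unfolding additive_def
proof (intro allI)
  fix a b
  have "F (a + b) = (\<lambda>c. F a c + F b c)" by (simp add: fun_eq_iff additive.add[OF assms(2)])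
  then show "psubst A (F (a + b)) q = psubst A (F a) q + psubst A (F b) q"
    by (simp add: psubst_add_fun[OF assms(1)])
qed

context total_operad
begin

lemma lookup_scale_sum: "Poly_Mapping.lookup (scale_sum scale c F) k = scale c (Poly_Mapping.lookup F k)"
  by (simp add: scale_sum_def map.rep_eq additive.zero[OF additive_scale] when_def)

lemma lookup_d_sum: "Poly_Mapping.lookup (d_sum d F) k = d (ar k) (Poly_Mapping.lookup F k)"
  by (simp add: d_sum_def lookup_mapp zero_simps when_def in_keys_iff)

lemma additive_d_sum: "additive (d_sum d)"
  by (simp add: additive_def poly_mapping_eq_iff fun_eq_iff lookup_d_sum lookup_add additive.add[OF d_add])

lemma additive_scale_sum: "additive (scale_sum scale c)"
  by (simp add: additive_def poly_mapping_eq_iff fun_eq_iff lookup_scale_sum lookup_add scale_add)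

lemma d_sum_single: "d_sum d (Poly_Mapping.single n x) = Poly_Mapping.single n (d (ar n) x)"
  by (rule poly_mapping_eqI) (simp add: lookup_d_sum lookup_single when_def zero_simps)

lemma scale_sum_single: "scale_sum scale c (Poly_Mapping.single n x) = Poly_Mapping.single n (scale c x)"
  by (rule poly_mapping_eqI)
    (simp add: lookup_scale_sum lookup_single when_def additive.zero[OF additive_scale])

lemma vector_space_scale_sum: "vector_space (scale_sum scale)"
proof -
  interpret vector_space scale by (rule vs)
  show ?thesis
    by unfold_locales
      (auto intro!: poly_mapping_eqI simp: lookup_scale_sum lookup_add scale_right_distrib scale_left_distrib)
qed

lemma superspaceI_sum:
  assumes 0: "\<And>p. 0 \<in> V p" and add: "\<And>p x y. x \<in> V p \<Longrightarrow> y \<in> V p \<Longrightarrow> x + y \<in> V p"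
    and scale: "\<And>p c x. x \<in> V p \<Longrightarrow> scale_sum scale c x \<in> V p"
    and int: "\<And>x n. x \<in> V 0 \<Longrightarrow> x \<in> V 1 \<Longrightarrow> Poly_Mapping.lookup x n \<in> P (ar n) 0 \<inter> P (ar n) 1"
  shows "superspace (scale_sum scale) V"
proof -
  interpret vector_space "scale_sum scale" by (rule vector_space_scale_sum)
  have "x = 0" if "x \<in> V 0" "x \<in> V 1" for x
  proof (rule poly_mapping_eqI)
    fix n
    have "Poly_Mapping.lookup x n \<in> P (ar n) 0 \<inter> P (ar n) 1" by (rule int[OF that])
    also have "P (ar n) 0 \<inter> P (ar n) 1 = {0}" using superspace by (simp add: superspace_def)
    finally show "Poly_Mapping.lookup x n = Poly_Mapping.lookup 0 n" by simp
  qed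
  then have "V 0 \<inter> V 1 = {0}" using 0 by blast
  moreover have "subspace (V p)" for p by (rule subspaceI) (use 0 add scale in auto)
  ultimately show ?thesis
    unfolding superspace_def using vector_space_scale_sum by (intro conjI allI)
qed

lemma map_poly_single_scale:
  "map_poly (Poly_Mapping.single n) (map_poly (scale c) q) =
    map_poly (scale_sum scale c) (map_poly (Poly_Mapping.single n) q)"
  by (rule poly_eqI)
    (simp add: coeff_map_poly scale_sum_single additive.zero[OF additive_scale] additive.zero[OF additive_scale_sum])

text \<open>
  The bracket of arbitrary elements of degrees \<open>n\<close> and \<open>m\<close> is obtained by splitting them into their
  homogeneous parts, and that of the direct sum by splitting them into components.
\<close>

definition comp_bracket :: "int \<Rightarrow> int \<Rightarrow> 'v \<Rightarrow> 'v \<Rightarrow> 'v poly" where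
  "comp_bracket n m f g = (\<Sum>p\<in>{0, 1}. \<Sum>q\<in>{0, 1}. brs p q n m (pr (ar n) p f) (pr (ar m) q g))"

lemma additive_comp_bracket_left: "additive (\<lambda>f. comp_bracket n m f g)"
  unfolding comp_bracket_def by (intro additive_sum additive_comp[OF additive_brs_left] pr_add)

lemma additive_comp_bracket_right: "additive (comp_bracket n m f)"
  unfolding comp_bracket_def by (intro additive_sum additive_comp[OF additive_brs_right] pr_add)

lemma comp_bracket_hom:
  assumes "f \<in> P (ar n) p" "g \<in> P (ar m) q"
  shows "comp_bracket n m f g = brs p q n m f g"
proof -
  have "pr (ar n) p' f = (if p' = p then f else 0)" for p'
    using pr_id[OF assms(1)] pr_other[OF assms(1), of p'] by simp
  moreover have "pr (ar m) q' g = (if q' = q then g else 0)" for q'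
    using pr_id[OF assms(2)] pr_other[OF assms(2), of q'] by simp
  ultimately show ?thesis
    unfolding comp_bracket_def
    by (cases p; cases q) (simp_all add: additive.zero[OF additive_brs_left] additive.zero[OF additive_brs_right])
qed

definition bracket :: "(int \<Rightarrow>\<^sub>0 'v) \<Rightarrow> (int \<Rightarrow>\<^sub>0 'v) \<Rightarrow> (int \<Rightarrow>\<^sub>0 'v) poly" where
  "bracket F G = (\<Sum>n\<in>Poly_Mapping.keys F. \<Sum>m\<in>Poly_Mapping.keys G.
     map_poly (Poly_Mapping.single (n + m)) (comp_bracket n m (Poly_Mapping.lookup F n) (Poly_Mapping.lookup G m)))"

lemma additive_bracket_left: "additive (\<lambda>F. bracket F G)"
  unfolding bracket_def
  by (intro additive_sum_keys additive_sum additive_comp[OF additive_map_poly[OF additive_single]] additive_comp_bracket_left)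

lemma additive_bracket_right: "additive (bracket F)"
  unfolding bracket_def
  by (intro additive_sum additive_sum_keys additive_comp[OF additive_map_poly[OF additive_single]] additive_comp_bracket_right)

lemma bracket_single:
  "bracket (Poly_Mapping.single n f) (Poly_Mapping.single m g) =
    map_poly (Poly_Mapping.single (n + m)) (comp_bracket n m f g)"
proof -
  have "bracket (Poly_Mapping.single n f) (Poly_Mapping.single m g) =
      (\<Sum>j\<in>Poly_Mapping.keys (Poly_Mapping.single m g). map_poly (Poly_Mapping.single (n + j))
        (comp_bracket n j f (Poly_Mapping.lookup (Poly_Mapping.single m g) j)))"
    unfolding bracket_def
    by (rule sum_keys_single[where T = "\<lambda>k x. \<Sum>j\<in>Poly_Mapping.keys (Poly_Mapping.single m g).
        map_poly (Poly_Mapping.single (k + j)) (comp_bracket k j x (Poly_Mapping.lookup (Poly_Mapping.single m g) j))"])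
      (simp add: additive.zero[OF additive_comp_bracket_left])
  also have "\<dots> = map_poly (Poly_Mapping.single (n + m)) (comp_bracket n m f g)"
    by (rule sum_keys_single[where T = "\<lambda>j x. map_poly (Poly_Mapping.single (n + j)) (comp_bracket n j f x)"])
      (simp add: additive.zero[OF additive_comp_bracket_right])
  finally show ?thesis .
qed

lemma bracket_hom:
  assumes "f \<in> P (ar n) p" "g \<in> P (ar m) q"
  shows "bracket (Poly_Mapping.single n f) (Poly_Mapping.single m g) =
    map_poly (Poly_Mapping.single (n + m)) (brs p q n m f g)"
  unfolding bracket_single comp_bracket_hom[OF assms] by (rule refl)

lemma bracket_scale_left: "bracket (scale_sum scale c F) G = map_poly (scale_sum scale c) (bracket F G)"
proof (rule biadditive_eqI[where S = "\<lambda>F G. bracket (scale_sum scale c F) G"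
      and T = "\<lambda>F G. map_poly (scale_sum scale c) (bracket F G)"])
  fix n f m g
  have "comp_bracket n m (scale c f) g = map_poly (scale c) (comp_bracket n m f g)"
    unfolding comp_bracket_def pr_scale brs_scale_left additive.sum[OF additive_map_poly[OF additive_scale]] by (rule refl)
  then show "bracket (scale_sum scale c (Poly_Mapping.single n f)) (Poly_Mapping.single m g) =
      map_poly (scale_sum scale c) (bracket (Poly_Mapping.single n f) (Poly_Mapping.single m g))"
    unfolding scale_sum_single bracket_single by (simp only: map_poly_single_scale)
qed (intro additive_comp[OF additive_bracket_left] additive_comp[OF additive_map_poly[OF additive_scale_sum]]
    additive_scale_sum additive_bracket_left additive_bracket_right)+

lemma bracket_scale_right: "bracket F (scale_sum scale c G) = map_poly (scale_sum scale c) (bracket F G)"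
proof (rule biadditive_eqI[where S = "\<lambda>F G. bracket F (scale_sum scale c G)"
      and T = "\<lambda>F G. map_poly (scale_sum scale c) (bracket F G)"])
  fix n f m g
  have "comp_bracket n m f (scale c g) = map_poly (scale c) (comp_bracket n m f g)"
    unfolding comp_bracket_def pr_scale brs_scale_right additive.sum[OF additive_map_poly[OF additive_scale]] by (rule refl)
  then show "bracket (Poly_Mapping.single n f) (scale_sum scale c (Poly_Mapping.single m g)) =
      map_poly (scale_sum scale c) (bracket (Poly_Mapping.single n f) (Poly_Mapping.single m g))"
    unfolding scale_sum_single bracket_single by (simp only: map_poly_single_scale)
qed (intro additive_comp[OF additive_bracket_right] additive_comp[OF additive_map_poly[OF additive_scale_sum]]
    additive_scale_sum additive_bracket_left additive_bracket_right)+

section \<open>The Lie conformal superalgebra of invariants\<close>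

lemma Wsum_zero: "0 \<in> Wsum P act p"
  by (simp add: Wsum_def W_zero P_zero)

lemma Wsum_add: "x \<in> Wsum P act p \<Longrightarrow> y \<in> Wsum P act p \<Longrightarrow> x + y \<in> Wsum P act p"
  by (simp add: Wsum_def lookup_add W_add P_add)

lemma Wsum_single: "f \<in> W P act n \<Longrightarrow> f \<in> P (ar n) p \<Longrightarrow> Poly_Mapping.single n f \<in> Wsum P act p"
  by (simp add: Wsum_def lookup_single when_def W_zero P_zero)

text \<open>
  The finitely supported families of invariants are sums of homogeneous components, so that additive
  identities need to be checked on the latter only.
\<close>

lemma Wsum_induct_zero:
  assumes T: "additive T"
    and hom: "\<And>n f. n \<ge> -1 \<Longrightarrow> f \<in> W P act n \<Longrightarrow> f \<in> P (ar n) p \<Longrightarrow> T (Poly_Mapping.single n f) = 0"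
    and F: "F \<in> Wsum P act p"
  shows "T F = 0"
proof (rule additive_zero_on_singles[OF T])
  fix n
  have f: "Poly_Mapping.lookup F n \<in> W P act n" "Poly_Mapping.lookup F n \<in> P (ar n) p"
    using F by (auto simp: Wsum_def)
  show "T (Poly_Mapping.single n (Poly_Mapping.lookup F n)) = 0"
  proof (cases "n \<ge> -1")
    case True then show ?thesis by (rule hom[OF _ f])
  next
    case False
    then have "Poly_Mapping.lookup F n = 0" using f(1) by (simp add: W_def)
    then show ?thesis by (simp add: additive.zero[OF T])
  qed
qed

lemma whole_Wsum_induct_zero:
  assumes T: "additive T"
    and hom: "\<And>n f p. n \<ge> -1 \<Longrightarrow> f \<in> W P act n \<Longrightarrow> f \<in> P (ar n) p \<Longrightarrow> T (Poly_Mapping.single n f) = 0"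
    and F: "F \<in> whole (Wsum P act)"
  shows "T F = 0"
proof -
  obtain x y where xy: "x \<in> Wsum P act 0" "y \<in> Wsum P act 1" "F = x + y"
    using F by (auto simp: whole_def)
  have "T x = 0" by (rule Wsum_induct_zero[OF T hom xy(1)])
  moreover have "T y = 0" by (rule Wsum_induct_zero[OF T hom xy(2)])
  ultimately show ?thesis by (simp add: xy(3) additive.add[OF T])
qed

lemma Wsum_biadditive_eqI:
  assumes S: "\<And>b. additive (\<lambda>a. S a b)" "\<And>a. additive (S a)"
    and T: "\<And>b. additive (\<lambda>a. T a b)" "\<And>a. additive (T a)"
    and hom: "\<And>n f m g. f \<in> P (ar n) p \<Longrightarrow> g \<in> P (ar m) q \<Longrightarrow>
      S (Poly_Mapping.single n f) (Poly_Mapping.single m g) = T (Poly_Mapping.single n f) (Poly_Mapping.single m g)"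
    and a: "a \<in> Wsum P act p" and b: "b \<in> Wsum P act q"
  shows "S a b = T a b"
proof -
  have "S a b - T a b = 0"
  proof (rule Wsum_induct_zero[where T = "\<lambda>a. S a b - T a b", OF _ _ a])
    fix n f assume f: "f \<in> P (ar n) p"
    show "S (Poly_Mapping.single n f) b - T (Poly_Mapping.single n f) b = 0"
      by (rule Wsum_induct_zero[where T = "\<lambda>b. S (Poly_Mapping.single n f) b - T (Poly_Mapping.single n f) b", OF _ _ b])
        (intro additive_diff S T, simp add: hom[OF f])
  qed (intro additive_diff S T)
  then show ?thesis by simp
qed

lemma whole_Wsum_biadditive_eqI:
  assumes S: "\<And>b. additive (\<lambda>a. S a b)" "\<And>a. additive (S a)"
    and T: "\<And>b. additive (\<lambda>a. T a b)" "\<And>a. additive (T a)"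
    and hom: "\<And>n f m g p q. f \<in> P (ar n) p \<Longrightarrow> g \<in> P (ar m) q \<Longrightarrow>
      S (Poly_Mapping.single n f) (Poly_Mapping.single m g) = T (Poly_Mapping.single n f) (Poly_Mapping.single m g)"
    and ab: "a \<in> whole (Wsum P act)" "b \<in> whole (Wsum P act)"
  shows "S a b = T a b"
proof -
  obtain a0 a1 b0 b1 where *: "a0 \<in> Wsum P act 0" "a1 \<in> Wsum P act 1" "b0 \<in> Wsum P act 0" "b1 \<in> Wsum P act 1"
    and eq: "a = a0 + a1" "b = b0 + b1" using ab by (auto simp: whole_def)
  have "S x y = T x y" if "x \<in> Wsum P act p" "y \<in> Wsum P act q" for x y p q
    by (rule Wsum_biadditive_eqI[OF S T hom that])
  note this[OF *(1,3)] this[OF *(1,4)] this[OF *(2,3)] this[OF *(2,4)]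
  then show ?thesis
    by (simp add: eq additive.add[OF S(1)] additive.add[OF S(2)] additive.add[OF T(1)] additive.add[OF T(2)])
qed

lemma Wsum_induct_mem:
  assumes T: "additive T" and S: "0 \<in> S" "\<And>x y. x \<in> S \<Longrightarrow> y \<in> S \<Longrightarrow> x + y \<in> S"
    and hom: "\<And>n f. n \<ge> -1 \<Longrightarrow> f \<in> W P act n \<Longrightarrow> f \<in> P (ar n) p \<Longrightarrow> T (Poly_Mapping.single n f) \<in> polys S"
    and F: "F \<in> Wsum P act p"
  shows "T F \<in> polys S"
proof -
  have "T F = (\<Sum>k\<in>Poly_Mapping.keys F. T (Poly_Mapping.single k (Poly_Mapping.lookup F k)))"
    using additive.sum[OF T] sum_singles[of F] by metis
  also have "\<dots> \<in> polys S"
  proof (rule polys_sum[OF S])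
    fix n
    have f: "Poly_Mapping.lookup F n \<in> W P act n" "Poly_Mapping.lookup F n \<in> P (ar n) p"
      using F by (auto simp: Wsum_def)
    show "T (Poly_Mapping.single n (Poly_Mapping.lookup F n)) \<in> polys S"
    proof (cases "n \<ge> -1")
      case True then show ?thesis by (rule hom[OF _ f])
    next
      case False
      then have "Poly_Mapping.lookup F n = 0" using f(1) by (simp add: W_def)
      then show ?thesis by (simp add: additive.zero[OF T] polys_def S)
    qed
  qed
  finally show ?thesis .
qed

lemma bracket_hom_in:
  assumes "n \<ge> -1" "m \<ge> -1" "f \<in> W P act n" "f \<in> P (ar n) p" "g \<in> W P act m" "g \<in> P (ar m) q"
  shows "bracket (Poly_Mapping.single n f) (Poly_Mapping.single m g) \<in>
    polys (Poly_Mapping.single (n + m) ` (W P act (n + m) \<inter> P (ar (n + m)) (p + q)))"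
proof -
  have "brs p q n m f g \<in> polys (W P act (n + m) \<inter> P (ar (n + m)) (p + q))"
    using brs_in[OF assms(4,6)] brs_W[OF assms(1,2,3,5), of p q] by (simp add: polys_def)
  then show ?thesis
    unfolding bracket_hom[OF assms(4,6)] by (rule polys_map_poly) auto
qed

lemma bracket_in:
  assumes "F \<in> Wsum P act p" "G \<in> Wsum P act q"
  shows "bracket F G \<in> polys (Wsum P act (p + q))"
proof (rule Wsum_induct_mem[where T = "\<lambda>F. bracket F G", OF additive_bracket_left Wsum_zero Wsum_add _ assms(1)])
  fix n f assume f: "n \<ge> -1" "f \<in> W P act n" "f \<in> P (ar n) p"
  show "bracket (Poly_Mapping.single n f) G \<in> polys (Wsum P act (p + q))"
  proof (rule Wsum_induct_mem[OF additive_bracket_right Wsum_zero Wsum_add _ assms(2)])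
    fix m g assume g: "m \<ge> -1" "g \<in> W P act m" "g \<in> P (ar m) q"
    show "bracket (Poly_Mapping.single n f) (Poly_Mapping.single m g) \<in> polys (Wsum P act (p + q))"
      by (rule subsetD[OF polys_mono bracket_hom_in[OF f(1) g(1) f(2,3) g(2,3)]]) (auto intro: Wsum_single)
  qed
qed

text \<open>The Jacobi identity for homogeneous elements, transported from the operad to the direct sum.\<close>

lemma bracket_jacobi_hom:
  assumes nml: "n \<ge> -1" "m \<ge> -1" "l \<ge> -1"
    and f: "f \<in> W P act n" "f \<in> P (ar n) p" and g: "g \<in> W P act m" "g \<in> P (ar m) q"
    and h: "h \<in> W P act l" "h \<in> P (ar l) r"
  defines "a \<equiv> Poly_Mapping.single n f" and "b \<equiv> Poly_Mapping.single m g" and "c \<equiv> Poly_Mapping.single l h"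
  shows "psubst mmu (\<lambda>x. var_to mlam (bracket a x)) (bracket b c)
        - koszul p q (psubst mlam (\<lambda>x. var_to mmu (bracket b x)) (bracket a c)) =
        psubst mlam (\<lambda>x. var_to mlammu (bracket x c)) (bracket a b)"
proof -
  let ?c = "\<lambda>c::int \<Rightarrow>\<^sub>0 'v. [:[:c:]:]"
  define D where "D = map_poly (map_poly (d_sum d))"
  define \<iota> where "\<iota> x = ?c (Poly_Mapping.single (n + m + l) x)" for x
  have i: "additive \<iota>" unfolding \<iota>_def by (rule additive_comp[OF additive_poly_poly_const additive_single])
  have D: "additive D" unfolding D_def by (intro additive_intros additive_d_sum)
  have LD: "mlam (D x) = D (mlam x)" for x
    by (simp add: mlam_def D_def map_poly_pCons0 additive_map_poly additive_d_sum)
  have UD: "mmu (D x) = D (mmu x)" for x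
    by (rule poly_eqI)
      (simp add: mmu_def D_def coeff_map_poly map_poly_pCons0 additive_map_poly additive_d_sum
        additive.zero[OF additive_d_sum])
  have iD: "\<iota> (d (ar (n + m + l)) x) = D (\<iota> x)" for x
    by (simp add: D_def \<iota>_def map_poly_pCons0 additive_map_poly additive_d_sum d_sum_single)
  have outer: "psubst B (\<lambda>x. psubst A ?c (bracket (Poly_Mapping.single n f) x))
        (bracket (Poly_Mapping.single m g) (Poly_Mapping.single l h)) =
      psubst B (\<lambda>x. psubst A (\<lambda>u. ?c (Poly_Mapping.single (n + (m + l)) u)) (brs p (q + r) n (m + l) f x)) (brs q r m l g h)"
    if A: "additive A" and B: "additive B"
      and f: "f \<in> P (ar n) p" and g: "g \<in> P (ar m) q" and h: "h \<in> P (ar l) r"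
    for A B :: "(int \<Rightarrow>\<^sub>0 'v) poly poly \<Rightarrow> (int \<Rightarrow>\<^sub>0 'v) poly poly" and n m l f g h p q r
  proof -
    have "psubst B (\<lambda>x. psubst A ?c (bracket (Poly_Mapping.single n f) x))
        (bracket (Poly_Mapping.single m g) (Poly_Mapping.single l h)) =
      psubst B (\<lambda>x. psubst A ?c (bracket (Poly_Mapping.single n f) (Poly_Mapping.single (m + l) x))) (brs q r m l g h)"
      unfolding bracket_hom[OF g h]
      by (rule psubst_map_poly[OF B additive_comp[OF additive_psubst[OF A additive_poly_poly_const] additive_bracket_right]
            additive_single])
    also have "\<dots> = psubst B (\<lambda>x. psubst A (\<lambda>u. ?c (Poly_Mapping.single (n + (m + l)) u)) (brs p (q + r) n (m + l) f x)) (brs q r m l g h)"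
    proof (rule psubst_cong)
      fix k
      have "coeff (brs q r m l g h) k \<in> P (ar (m + l)) (q + r)" using brs_in[OF g h] by (simp add: polys_def)
      from bracket_hom[OF f this]
      show "psubst A ?c (bracket (Poly_Mapping.single n f) (Poly_Mapping.single (m + l) (coeff (brs q r m l g h) k))) =
          psubst A (\<lambda>u. ?c (Poly_Mapping.single (n + (m + l)) u)) (brs p (q + r) n (m + l) f (coeff (brs q r m l g h) k))"
        by (simp add: psubst_map_poly[OF A additive_poly_poly_const additive_single])
    qed
    finally show ?thesis .
  qed
  have inner: "psubst mlam (\<lambda>x. psubst mlammu ?c (bracket x (Poly_Mapping.single l h)))
        (bracket (Poly_Mapping.single n f) (Poly_Mapping.single m g)) =
      psubst mlam (\<lambda>x. psubst mlammu \<iota> (brs (p + q) r (n + m) l x h)) (brs p q n m f g)"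
  proof -
    have "psubst mlam (\<lambda>x. psubst mlammu ?c (bracket x (Poly_Mapping.single l h)))
        (bracket (Poly_Mapping.single n f) (Poly_Mapping.single m g)) =
      psubst mlam (\<lambda>x. psubst mlammu ?c (bracket (Poly_Mapping.single (n + m) x) (Poly_Mapping.single l h))) (brs p q n m f g)"
      unfolding bracket_hom[OF f(2) g(2)]
      by (rule psubst_map_poly[OF additive_mlam
            additive_comp[OF additive_psubst[OF additive_mlammu additive_poly_poly_const] additive_bracket_left]
            additive_single])
    also have "\<dots> = psubst mlam (\<lambda>x. psubst mlammu \<iota> (brs (p + q) r (n + m) l x h)) (brs p q n m f g)"
    proof (rule psubst_cong)
      fix k
      have "coeff (brs p q n m f g) k \<in> P (ar (n + m)) (p + q)" using brs_in[OF f(2) g(2)] by (simp add: polys_def)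
      from bracket_hom[OF this h(2)]
      show "psubst mlammu ?c (bracket (Poly_Mapping.single (n + m) (coeff (brs p q n m f g) k)) (Poly_Mapping.single l h)) =
          psubst mlammu \<iota> (brs (p + q) r (n + m) l (coeff (brs p q n m f g) k) h)"
        by (simp add: psubst_map_poly[OF additive_mlammu additive_poly_poly_const additive_single] \<iota>_def[abs_def])
    qed
    finally show ?thesis .
  qed
  have deg: "n + (m + l) = n + m + l" "m + (n + l) = n + m + l" by simp_all
  show ?thesis
    unfolding a_def b_def c_def var_to_def inner
      outer[OF additive_mlam additive_mmu f(2) g(2) h(2)] outer[OF additive_mmu additive_mlam g(2) f(2) h(2)]
    unfolding deg \<iota>_def[symmetric] mlammu_def[abs_def]
    by (rule brs_jacobi[where A = mlam and B = mmu and D = D and \<iota> = \<iota>,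
          OF additive_mlam additive_mmu D i mlam_mmu LD UD iD nml f g h])
qed

lemma bracket_jacobi:
  assumes a: "a \<in> Wsum P act p" and b: "b \<in> Wsum P act q" and c: "c \<in> whole (Wsum P act)"
  shows "psubst mmu (\<lambda>x. var_to mlam (bracket a x)) (bracket b c)
        - koszul p q (psubst mlam (\<lambda>x. var_to mmu (bracket b x)) (bracket a c)) =
        psubst mlam (\<lambda>x. var_to mlammu (bracket x c)) (bracket a b)"
proof -
  define J where "J a b c = psubst mmu (\<lambda>x. var_to mlam (bracket a x)) (bracket b c)
        - koszul p q (psubst mlam (\<lambda>x. var_to mmu (bracket b x)) (bracket a c)) -
        psubst mlam (\<lambda>x. var_to mlammu (bracket x c)) (bracket a b)" for a b c
  have v: "additive (var_to A)" if "additive A" for A :: "(int \<Rightarrow>\<^sub>0 'v) poly poly \<Rightarrow> (int \<Rightarrow>\<^sub>0 'v) poly poly"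
    unfolding var_to_def[abs_def] by (intro additive_psubst that additive_poly_poly_const)
  note vL = v[OF additive_mlam] and vU = v[OF additive_mmu] and vS = v[OF additive_mlammu]
  note in_fun = additive_psubst_fun[OF additive_mlam] additive_psubst_fun[OF additive_mmu]
  note in_arg = additive_comp[OF additive_psubst[OF additive_mlam]] additive_comp[OF additive_psubst[OF additive_mmu]]
  note comps = additive_comp[OF vL] additive_comp[OF vU] additive_comp[OF vS]
  have Ja: "additive (\<lambda>a. J a b c)" for b c
    unfolding J_def
    by (intro additive_diff additive_comp[OF additive_koszul] in_fun(2) in_arg(1) comps additive_bracket_left additive_bracket_right)
  have Jb: "additive (\<lambda>b. J a b c)" for a c
    unfolding J_def
    by (intro additive_diff additive_comp[OF additive_koszul] in_fun(1) in_arg(2) in_arg(1)[OF comps(3)[OF additive_bracket_left]]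
        comps additive_bracket_left additive_bracket_right)
  have Jc: "additive (\<lambda>c. J a b c)" for a b
    unfolding J_def
    by (intro additive_diff additive_comp[OF additive_koszul] in_fun(1) in_arg(2)
        in_arg(1)[OF comps(2)[OF additive_bracket_right]] comps additive_bracket_left additive_bracket_right)
  have "J a b c = 0"
  proof (rule Wsum_induct_zero[where T = "\<lambda>a. J a b c", OF Ja _ a])
    fix n f assume f: "n \<ge> -1" "f \<in> W P act n" "f \<in> P (ar n) p"
    let ?a = "Poly_Mapping.single n f"
    show "J ?a b c = 0"
    proof (rule Wsum_induct_zero[where T = "\<lambda>b. J ?a b c", OF Jb _ b])
      fix m g assume g: "m \<ge> -1" "g \<in> W P act m" "g \<in> P (ar m) q"
      let ?b = "Poly_Mapping.single m g"
      show "J ?a ?b c = 0"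
      proof (rule whole_Wsum_induct_zero[where T = "\<lambda>c. J ?a ?b c", OF Jc _ c])
        fix l h r assume h: "l \<ge> -1" "h \<in> W P act l" "h \<in> P (ar l) r"
        show "J ?a ?b (Poly_Mapping.single l h) = 0"
          using bracket_jacobi_hom[OF f(1) g(1) h(1) f(2,3) g(2,3) h(2,3)] by (simp add: J_def)
      qed
    qed
  qed
  then show ?thesis by (simp add: J_def)
qed

end

lemma psubst_cong_on:
  assumes q: "q \<in> polys S" and F: "\<And>c. c \<in> S \<Longrightarrow> F c = G c \<and> F c \<in> M"
    and A: "\<And>x. x \<in> M \<Longrightarrow> A x = B x \<and> A x \<in> M"
  shows "psubst A F q = psubst B G q"
proof -
  have pow: "(A ^^ k) x = (B ^^ k) x \<and> (A ^^ k) x \<in> M" if "x \<in> M" for k x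
  proof (induction k)
    case (Suc k)
    then have 1: "(A ^^ k) x = (B ^^ k) x" "(A ^^ k) x \<in> M" by auto
    show ?case unfolding funpow.simps o_apply 1(1)[symmetric] by (rule A[OF 1(2)])
  qed (use that in simp)
  then show ?thesis
    unfolding psubst_def
  proof (intro sum.cong refl)
    fix k
    have "coeff q k \<in> S" using q by (simp add: polys_def)
    note 1 = F[OF this]
    then show "(A ^^ k) (F (coeff q k)) = (B ^^ k) (G (coeff q k))"
      using pow[OF conjunct2[OF 1], of k] by simp
  qed
qed

lemma subst_neg_cong_on:
  assumes q: "q \<in> polys S" and d: "\<And>c. c \<in> S \<Longrightarrow> d c = d' c \<and> d c \<in> S" and 0: "0 \<in> S" "d 0 = 0"
    and S: "\<And>x y. x \<in> S \<Longrightarrow> y \<in> S \<Longrightarrow> x - y \<in> S"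
  shows "subst_neg d q = subst_neg d' q"
  unfolding subst_neg_def
proof (rule psubst_cong_on[OF q])
  show "[:c:] = [:c:] \<and> [:c:] \<in> polys S" if "c \<in> S" for c
    using that 0 by (auto simp: polys_def coeff_pCons split: nat.splits)
  fix x assume x: "x \<in> polys S"
  have "d' 0 = 0" using d[OF 0(1)] 0(2) by simp
  have d'S: "d' c \<in> S" if "c \<in> S" for c using d[OF that] by metis
  then have "map_poly d x = map_poly d' x"
    using x d 0 by (intro poly_eqI) (simp add: coeff_map_poly polys_def)
  then have "- pCons 0 x - map_poly d x \<in> polys S"
    unfolding \<open>map_poly d x = map_poly d' x\<close> using x d'S 0 S S[OF 0(1)] \<open>d' 0 = 0\<close>
    by (auto simp: polys_def coeff_map_poly coeff_pCons split: nat.splits)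
  then show "- pCons 0 x - map_poly d x = - pCons 0 x - map_poly d' x \<and>
      - pCons 0 x - map_poly d x \<in> polys S"
    using \<open>map_poly d x = map_poly d' x\<close> by simp
qed

lemma map_poly_cong_on:
  assumes "q \<in> polys S" "\<And>c. c \<in> S \<Longrightarrow> f c = g c" "f 0 = 0" "g 0 = 0"
  shows "map_poly f q = map_poly g q"
  using assms by (intro poly_eqI) (simp add: coeff_map_poly polys_def)

lemma whole_diff:
  assumes "\<And>p x y. x \<in> V p \<Longrightarrow> y \<in> V p \<Longrightarrow> x - y \<in> V p" "x \<in> whole V" "y \<in> whole V"
  shows "x - y \<in> whole V"
proof -
  obtain x0 x1 y0 y1 where "x0 \<in> V 0" "x1 \<in> V 1" "y0 \<in> V 0" "y1 \<in> V 1" "x = x0 + x1" "y = y0 + y1"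
    using assms(2,3) by (auto simp: whole_def)
  then have "x - y = (x0 - y0) + (x1 - y1)" "x0 - y0 \<in> V 0" "x1 - y1 \<in> V 1"
    using assms(1) by simp_all
  then show ?thesis unfolding whole_def by blast
qed

context total_operad
begin

lemma Wsum_diff: "x \<in> Wsum P act p \<Longrightarrow> y \<in> Wsum P act p \<Longrightarrow> x - y \<in> Wsum P act p"
  by (simp add: Wsum_def lookup_minus W_diff P_diff)

lemma Wsum_d: "x \<in> Wsum P act p \<Longrightarrow> d_sum d x \<in> Wsum P act p"
  by (simp add: Wsum_def lookup_d_sum W_d d_in)

lemma Wsum_scale: "x \<in> Wsum P act p \<Longrightarrow> scale_sum scale c x \<in> Wsum P act p"
  by (simp add: Wsum_def lookup_scale_sum W_scale P_scale)

lemma Wsum_whole: "x \<in> Wsum P act p \<Longrightarrow> x \<in> whole (Wsum P act)"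
  by (rule wholeI[where p = p]) (rule Wsum_zero)

lemma whole_Wsum_d: "x \<in> whole (Wsum P act) \<Longrightarrow> d_sum d x \<in> whole (Wsum P act)"
  unfolding whole_def using Wsum_d additive.add[OF additive_d_sum] by force

lemma whole_Wsum_diff: "x \<in> whole (Wsum P act) \<Longrightarrow> y \<in> whole (Wsum P act) \<Longrightarrow> x - y \<in> whole (Wsum P act)"
  by (rule whole_diff) (rule Wsum_diff)

lemma bracket_skew:
  assumes a: "a \<in> Wsum P act p" and b: "b \<in> Wsum P act q"
  shows "bracket a b = - koszul p q (subst_neg (d_sum d) (bracket b a))"
proof (rule Wsum_biadditive_eqI[where S = bracket and T = "\<lambda>a b. - koszul p q (subst_neg (d_sum d) (bracket b a))", OF _ _ _ _ _ a b])
  fix n f m g assume f: "f \<in> P (ar n) p" and g: "g \<in> P (ar m) q"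
  have "subst_neg (d_sum d) (bracket (Poly_Mapping.single m g) (Poly_Mapping.single n f)) =
      map_poly (Poly_Mapping.single (n + m)) (subst_neg (d (ar (n + m))) (brs q p m n g f))"
    unfolding bracket_hom[OF g f] add.commute[of m n]
    by (rule map_poly_subst_neg[symmetric, OF additive_single d_add additive_d_sum]) (simp add: d_sum_single)
  moreover have "bracket (Poly_Mapping.single n f) (Poly_Mapping.single m g) =
      - koszul p q (map_poly (Poly_Mapping.single (n + m)) (subst_neg (d (ar (n + m))) (brs q p m n g f)))"
    unfolding bracket_hom[OF f g] brs_skew[of p q n m f g] additive.minus[OF additive_map_poly[OF additive_single]]
      koszul_additive[OF additive_map_poly[OF additive_single]] by (rule refl)
  ultimately show "bracket (Poly_Mapping.single n f) (Poly_Mapping.single m g) =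
      - koszul p q (subst_neg (d_sum d) (bracket (Poly_Mapping.single m g) (Poly_Mapping.single n f)))" by simp
qed (intro additive_uminus additive_comp[OF additive_koszul] additive_comp[OF additive_subst_neg[OF additive_d_sum]]
    additive_bracket_left additive_bracket_right)+

lemma bracket_d_left:
  assumes "a \<in> whole (Wsum P act)" "b \<in> whole (Wsum P act)"
  shows "bracket (d_sum d a) b = - pCons 0 (bracket a b)"
proof (rule whole_Wsum_biadditive_eqI[where S = "\<lambda>a. bracket (d_sum d a)" and T = "\<lambda>a b. - pCons 0 (bracket a b)", OF _ _ _ _ _ assms])
  fix n f m g p q assume f: "f \<in> P (ar n) p" and g: "g \<in> P (ar m) q"
  show "bracket (d_sum d (Poly_Mapping.single n f)) (Poly_Mapping.single m g) =
      - pCons 0 (bracket (Poly_Mapping.single n f) (Poly_Mapping.single m g))"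
    unfolding d_sum_single bracket_hom[OF d_in[OF f] g] bracket_hom[OF f g] brs_d_left
      additive.minus[OF additive_map_poly[OF additive_single]]
    by (simp add: map_poly_pCons0 additive_single)
qed (intro additive_uminus additive_comp[OF additive_pCons] additive_comp[OF additive_bracket_left] additive_d_sum
    additive_bracket_left additive_bracket_right)+

lemma bracket_d_right:
  assumes "a \<in> whole (Wsum P act)" "b \<in> whole (Wsum P act)"
  shows "bracket a (d_sum d b) = pCons 0 (bracket a b) + map_poly (d_sum d) (bracket a b)"
proof (rule whole_Wsum_biadditive_eqI[where S = "\<lambda>a b. bracket a (d_sum d b)"
      and T = "\<lambda>a b. pCons 0 (bracket a b) + map_poly (d_sum d) (bracket a b)", OF _ _ _ _ _ assms])
  fix n f m g p q assume f: "f \<in> P (ar n) p" and g: "g \<in> P (ar m) q"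
  let ?q = "brs p q n m f g"
  have "map_poly (Poly_Mapping.single (n + m)) (map_poly (d (ar (n + m))) ?q) =
      map_poly (d_sum d) (map_poly (Poly_Mapping.single (n + m)) ?q)"
    by (rule poly_eqI) (simp add: coeff_map_poly zero_simps d_sum_single additive.zero[OF additive_d_sum])
  then show "bracket (Poly_Mapping.single n f) (d_sum d (Poly_Mapping.single m g)) =
      pCons 0 (bracket (Poly_Mapping.single n f) (Poly_Mapping.single m g)) +
      map_poly (d_sum d) (bracket (Poly_Mapping.single n f) (Poly_Mapping.single m g))"
    unfolding d_sum_single bracket_hom[OF f d_in[OF g]] bracket_hom[OF f g] brs_d_right map_poly_add[OF additive_single]
    by (simp add: map_poly_pCons0 additive_single)
qed (intro additive_add additive_comp[OF additive_pCons] additive_comp[OF additive_map_poly[OF additive_d_sum]]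
    additive_comp[OF additive_bracket_right] additive_d_sum additive_bracket_left additive_bracket_right)+

lemma bracket_whole:
  assumes "a \<in> whole (Wsum P act)" "b \<in> whole (Wsum P act)"
  shows "bracket a b \<in> polys (whole (Wsum P act))"
proof -
  obtain a0 a1 b0 b1 where *: "a0 \<in> Wsum P act 0" "a1 \<in> Wsum P act 1" "b0 \<in> Wsum P act 0" "b1 \<in> Wsum P act 1"
    and eq: "a = a0 + a1" "b = b0 + b1" using assms by (auto simp: whole_def)
  have hom: "bracket x y \<in> polys (whole (Wsum P act))" if "x \<in> Wsum P act p" "y \<in> Wsum P act q" for x y p q
    by (rule subsetD[OF polys_mono bracket_in[OF that]]) (auto intro: Wsum_whole)
  have neg: "- y \<in> whole (Wsum P act)" if "y \<in> whole (Wsum P act)" for y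
    using whole_Wsum_diff[OF Wsum_whole[OF Wsum_zero] that] by simp
  have add: "x + y \<in> whole (Wsum P act)" if "x \<in> whole (Wsum P act)" "y \<in> whole (Wsum P act)" for x y
    using whole_Wsum_diff[OF that(1) neg[OF that(2)]] by simp
  show ?thesis
    unfolding eq additive.add[OF additive_bracket_left] additive.add[OF additive_bracket_right]
    by (intro polys_add[OF add] hom[OF *(1) *(3)] hom[OF *(2) *(3)] hom[OF *(1) *(4)] hom[OF *(2) *(4)])
qed

lemma Wcomp_superspace: "superspace (scale_sum scale) (Wcomp P act n)"
proof (rule superspaceI_sum)
  show "0 \<in> Wcomp P act n p" for p
    unfolding Wcomp_def using W_zero P_zero by (intro image_eqI[of _ _ 0]) auto
  show "x + y \<in> Wcomp P act n p" if "x \<in> Wcomp P act n p" "y \<in> Wcomp P act n p" for p x y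
    using that W_add P_add unfolding Wcomp_def by (force simp: single_add[symmetric])
  show "scale_sum scale c x \<in> Wcomp P act n p" if "x \<in> Wcomp P act n p" for p c x
    using that W_scale P_scale unfolding Wcomp_def by (force simp: scale_sum_single)
  show "Poly_Mapping.lookup x k \<in> P (ar k) 0 \<inter> P (ar k) 1"
    if x: "x \<in> Wcomp P act n 0" "x \<in> Wcomp P act n 1" for x k
  proof -
    obtain u where u: "x = Poly_Mapping.single n u" "u \<in> P (ar n) 0"
      using x(1) by (auto simp: Wcomp_def)
    obtain v where v: "x = Poly_Mapping.single n v" "v \<in> P (ar n) 1"
      using x(2) by (auto simp: Wcomp_def)
    note uv = u v
    then have "u = v" by (metis lookup_single_eq)
    then show ?thesis using uv P_zero by (cases "n = k") (auto simp: lookup_single)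
  qed
qed

lemma Wsum_superspace: "superspace (scale_sum scale) (Wsum P act)"
proof (rule superspaceI_sum)
  show "Poly_Mapping.lookup x n \<in> P (ar n) 0 \<inter> P (ar n) 1"
    if "x \<in> Wsum P act 0" "x \<in> Wsum P act 1" for x n
    using that by (auto simp: Wsum_def)
qed (auto intro: Wsum_zero Wsum_add Wsum_scale)

text \<open>
  The endomorphism \<open>d0\<close> is the given $\partial$, whereas \<open>d\<close> is its additive extension to the ambient
  space; the direct sum of the invariants sees no difference.
\<close>

theorem graded_lie:
  assumes eq: "\<And>n x. x \<in> whole (P n) \<Longrightarrow> d0 n x = d n x"
  shows "graded_lie_conformal_superalgebra (scale_sum scale) (Wsum P act) (d_sum d0) bracket (Wcomp P act)"
proof -
  let ?R = "Wsum P act"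
  have zero: "0 \<in> whole ?R" by (rule Wsum_whole[OF Wsum_zero])
  have d0: "d_sum d0 x = d_sum d x" if "x \<in> whole ?R" for x
  proof (rule poly_mapping_eqI)
    fix k
    obtain x0 x1 where x: "x0 \<in> ?R 0" "x1 \<in> ?R 1" "x = x0 + x1" using \<open>x \<in> whole ?R\<close> by (auto simp: whole_def)
    then have "Poly_Mapping.lookup x k \<in> whole (P (ar k))"
      unfolding Wsum_def x(3) lookup_add
      by (intro whole_add P_whole[where p = 0 and n = "ar k"] P_whole[where p = 1 and n = "ar k"]) auto
    then show "Poly_Mapping.lookup (d_sum d0 x) k = Poly_Mapping.lookup (d_sum d x) k"
      by (simp add: d_sum_def lookup_mapp eq when_def)
  qed
  have d00: "d_sum d0 0 = 0" "d_sum d 0 = 0" using d0[OF zero] additive.zero[OF additive_d_sum] by simp_all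
  have mp: "map_poly (d_sum d0) q = map_poly (d_sum d) q" if "q \<in> polys (whole ?R)" for q
    by (rule map_poly_cong_on[where f = "d_sum d0" and g = "d_sum d", OF that d0 d00])
  have sn: "subst_neg (d_sum d) q = subst_neg (d_sum d0) q" if "q \<in> polys (whole ?R)" for q
    by (rule subst_neg_cong_on[where d = "d_sum d" and d' = "d_sum d0", OF that _ zero d00(2) whole_Wsum_diff]) (simp_all add: d0 whole_Wsum_d)
  have addR: "x + y \<in> whole ?R" if "x \<in> whole ?R" "y \<in> whole ?R" for x y
    using whole_Wsum_diff[OF that(1) whole_Wsum_diff[OF zero that(2)]] by simp
  have scR: "scale_sum scale c x \<in> whole ?R" if "x \<in> whole ?R" for c x
    using that Wsum_scale[of _ _ c] additive.add[OF additive_scale_sum[of c]] unfolding whole_def by force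
  have WcompI: "Poly_Mapping.single n x \<in> Wcomp P act n p" if "x \<in> W P act n" "x \<in> P (ar n) p" for n p x
    using that by (auto simp: Wcomp_def)
  have Wcomp_sub: "Wcomp P act n p \<subseteq> ?R p" for n p by (auto simp: Wcomp_def intro: Wsum_single)
  interpret comp: vector_space "scale_sum scale" by (rule vector_space_scale_sum)
  have comp_sub: "comp.subspace (Wcomp P act n p)" for n p
    using Wcomp_superspace by (simp add: superspace_def)
  have comp_whole: "x \<in> whole (Wcomp P act n)" if "x \<in> Wcomp P act n p" for n p x
    by (rule wholeI[where V = "Wcomp P act n" and p = p, OF comp.subspace_0[OF comp_sub] that])
  have comp_add: "x + y \<in> whole (Wcomp P act n)"
    if xy: "x \<in> whole (Wcomp P act n)" "y \<in> whole (Wcomp P act n)" for x y n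
  proof -
    obtain x0 x1 y0 y1 where *: "x0 \<in> Wcomp P act n 0" "x1 \<in> Wcomp P act n 1" "y0 \<in> Wcomp P act n 0"
      "y1 \<in> Wcomp P act n 1" "x = x0 + x1" "y = y0 + y1" using xy by (auto simp: whole_def)
    then have "x + y = (x0 + y0) + (x1 + y1)" by simp
    then show ?thesis
      using comp.subspace_add[OF comp_sub *(1,3)] comp.subspace_add[OF comp_sub *(2,4)]
      unfolding whole_def by blast
  qed
  show ?thesis
  proof unfold_locales
    show "superspace (scale_sum scale) ?R" by (rule Wsum_superspace)
    show "even_endo (scale_sum scale) ?R (d_sum d0)"
      unfolding even_endo_def
      using d0 addR scR additive.add[OF additive_d_sum] Wsum_d Wsum_whole
      by (auto intro!: poly_mapping_eqI simp: lookup_d_sum lookup_scale_sum d_scale)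
    show "even_bilinear (scale_sum scale) ?R ?R ?R bracket"
      unfolding even_bilinear_def
      using additive.add[OF additive_bracket_left] additive.add[OF additive_bracket_right] bracket_scale_left
        bracket_scale_right bracket_in by auto
    show "bracket (d_sum d0 a) b = - pCons 0 (bracket a b)" if "a \<in> whole ?R" "b \<in> whole ?R" for a b
      unfolding d0[OF that(1)] by (rule bracket_d_left[OF that])
    show "bracket a (d_sum d0 b) = pCons 0 (bracket a b) + map_poly (d_sum d0) (bracket a b)"
      if "a \<in> whole ?R" "b \<in> whole ?R" for a b
      unfolding d0[OF that(2)] mp[OF bracket_whole[OF that]] by (rule bracket_d_right[OF that])
    show "bracket a b = - koszul p q (subst_neg (d_sum d0) (bracket b a))" if "a \<in> ?R p" "b \<in> ?R q" for a b p q
      unfolding sn[OF bracket_whole[OF Wsum_whole[OF that(2)] Wsum_whole[OF that(1)]], symmetric]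
      by (rule bracket_skew[OF that])
    show "psubst mmu (\<lambda>x. var_to mlam (bracket a x)) (bracket b c)
        - koszul p q (psubst mlam (\<lambda>x. var_to mmu (bracket b x)) (bracket a c)) =
        psubst mlam (\<lambda>x. var_to mlammu (bracket x c)) (bracket a b)"
      if "a \<in> ?R p" "b \<in> ?R q" "c \<in> whole ?R" for a b c p q
      by (rule bracket_jacobi[OF that])
    show "superspace (scale_sum scale) (Wcomp P act n)" for n by (rule Wcomp_superspace)
    show "Wcomp P act n p \<subseteq> ?R p" for n p by (rule Wcomp_sub)
    show "Wcomp P act n p = {0}" if "n < -1" for n p
      using that P_zero by (auto simp: Wcomp_def W_def)
    show "d_sum d0 a \<in> whole (Wcomp P act n)" if a: "a \<in> whole (Wcomp P act n)" for n a
    proof -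
      obtain x y where xy: "x \<in> W P act n" "x \<in> P (ar n) 0" "y \<in> W P act n" "y \<in> P (ar n) 1"
        and aeq: "a = Poly_Mapping.single n x + Poly_Mapping.single n y"
        using a by (auto simp: whole_def Wcomp_def)
      have "a \<in> whole ?R" unfolding aeq
        by (rule addR[OF Wsum_whole[OF Wsum_single[OF xy(1,2)]] Wsum_whole[OF Wsum_single[OF xy(3,4)]]])
      then have "d_sum d0 a = Poly_Mapping.single n (d (ar n) x) + Poly_Mapping.single n (d (ar n) y)"
        by (simp add: d0 aeq additive.add[OF additive_d_sum] d_sum_single)
      then show ?thesis
        using WcompI[OF W_d[OF xy(1)] d_in[OF xy(2)]] WcompI[OF W_d[OF xy(3)] d_in[OF xy(4)]]
        unfolding whole_def by blast
    qed
    show "bracket a b \<in> polys (whole (Wcomp P act (n + m)))"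
      if ab: "a \<in> whole (Wcomp P act n)" "b \<in> whole (Wcomp P act m)" for n m a b
    proof (cases "n \<ge> -1 \<and> m \<ge> -1")
      case False
      then have "a = 0 \<or> b = 0" using ab by (auto simp: whole_def Wcomp_def W_def)
      then have "bracket a b = 0"
        using additive.zero[OF additive_bracket_left] additive.zero[OF additive_bracket_right] by auto
      then show ?thesis using comp_whole[OF comp.subspace_0[OF comp_sub]] by (simp add: polys_def)
    next
      case True
      have hom: "bracket x y \<in> polys (whole (Wcomp P act (n + m)))"
        if xy: "x \<in> Wcomp P act n p" "y \<in> Wcomp P act m q" for x y p q
      proof -
        obtain u v where uv: "u \<in> W P act n" "u \<in> P (ar n) p" "v \<in> W P act m" "v \<in> P (ar m) q"
          and xy: "x = Poly_Mapping.single n u" "y = Poly_Mapping.single m v"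
          using xy by (auto simp: Wcomp_def)
        show ?thesis
          unfolding xy
          by (rule subsetD[OF polys_mono bracket_hom_in[OF _ _ uv]]) (use True in \<open>auto intro: comp_whole[OF WcompI]\<close>)
      qed
      obtain a0 a1 b0 b1 where *: "a0 \<in> Wcomp P act n 0" "a1 \<in> Wcomp P act n 1" "b0 \<in> Wcomp P act m 0"
        "b1 \<in> Wcomp P act m 1" "a = a0 + a1" "b = b0 + b1" using ab by (auto simp: whole_def)
      show ?thesis
        unfolding *(5,6) additive.add[OF additive_bracket_left] additive.add[OF additive_bracket_right]
        by (intro polys_add[OF comp_add] hom[OF *(1,3)] hom[OF *(2,3)] hom[OF *(1,4)] hom[OF *(2,4)])
    qed
    show "\<exists>!c. finite {n. c n \<noteq> 0} \<and> (\<forall>n. c n \<in> Wcomp P act n p) \<and> x = (\<Sum>n | c n \<noteq> 0. c n)"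
      if x: "x \<in> ?R p" for x p
    proof (rule ex1I)
      let ?c = "\<lambda>n. Poly_Mapping.single n (Poly_Mapping.lookup x n)"
      have nz: "{n. ?c n \<noteq> 0} = Poly_Mapping.keys x"
        by (auto simp: in_keys_iff) (metis lookup_single_eq lookup_zero)
      have "?c n \<in> Wcomp P act n p" for n using x by (intro WcompI) (auto simp: Wsum_def)
      then show "finite {n. ?c n \<noteq> 0} \<and> (\<forall>n. ?c n \<in> Wcomp P act n p) \<and> x = (\<Sum>n | ?c n \<noteq> 0. ?c n)"
        unfolding nz by (simp add: sum_singles)
    next
      fix c assume c: "finite {n. c n \<noteq> 0} \<and> (\<forall>n. c n \<in> Wcomp P act n p) \<and> x = (\<Sum>n | c n \<noteq> 0. c n)"
      then have "\<forall>n. \<exists>u. c n = Poly_Mapping.single n u" by (auto simp: Wcomp_def)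
      then obtain u where u: "\<And>n. c n = Poly_Mapping.single n (u n)" by metis
      have "Poly_Mapping.lookup x k = u k" for k
      proof -
        have "Poly_Mapping.lookup x k = (\<Sum>n | c n \<noteq> 0. Poly_Mapping.lookup (c n) k)"
          using c lookup_sum[of c "{n. c n \<noteq> 0}" k] by simp
        also have "\<dots> = (\<Sum>n | c n \<noteq> 0. if n = k then u k else 0)"
          by (rule sum.cong) (auto simp: u lookup_single)
        also have "\<dots> = (if c k \<noteq> 0 then u k else 0)" using c by simp
        also have "\<dots> = u k" using u[of k] lookup_single_eq[of k "u k"] by (cases "c k = 0") (metis lookup_zero, simp)
        finally show ?thesis .
      qed
      then show "c = (\<lambda>n. Poly_Mapping.single n (Poly_Mapping.lookup x n))" using u by (simp add: fun_eq_iff)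
    qed
  qed
qed

end

section \<open>Extending the operations to the ambient space\<close>

text \<open>
  A basis of \<open>U\<close>, enlarged by vectors of \<open>V\<close> to one of \<open>U + V\<close>: the projection is the identity on the
  former basis vectors and zero on the added ones, and these span subspaces of \<open>U\<close> and \<open>V\<close>.
\<close>

lemma ex_linear_projection:
  assumes vs: "vector_space (scale :: 'f::field \<Rightarrow> 'v::ab_group_add \<Rightarrow> 'v)"
    and U: "module.subspace scale U" and V: "module.subspace scale V" and UV: "U \<inter> V = {0}"
  shows "\<exists>g. additive g \<and> (\<forall>c x. g (scale c x) = scale c (g x)) \<and> range g \<subseteq> U \<and>
    (\<forall>x\<in>U. g x = x) \<and> (\<forall>x\<in>V. g x = 0)"
proof -
  interpret vector_space scale by (rule vs)
  interpret vs: vector_space_pair scale scale by unfold_locales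
  obtain B0 where B0: "B0 \<subseteq> U" "independent B0" "U \<subseteq> span B0"
    by (rule basis_exists[of U])
  have spanB0: "span B0 = U" by (rule span_subspace[OF B0(1,3) U])
  obtain B where B: "B0 \<subseteq> B" "B \<subseteq> B0 \<union> V" "independent B" "B0 \<union> V \<subseteq> span B"
    by (rule maximal_independent_subset_extend[OF Un_upper1 B0(2), of V])
  define \<phi> where "\<phi> b = (if b \<in> B0 then b else 0)" for b
  obtain g where g: "Vector_Spaces.linear scale scale g" "\<And>x. x \<in> B \<Longrightarrow> g x = \<phi> x" "range g = span (\<phi> ` B)"
    using vs.linear_independent_extend_subspace[OF B(3), of \<phi>] by blast
  interpret g: Vector_Spaces.linear scale scale g by (rule g(1))
  have "\<phi> ` B \<subseteq> span B0" by (auto simp: \<phi>_def span_base span_zero)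
  then have rng: "range g \<subseteq> U" unfolding g(3) spanB0[symmetric] by (rule span_minimal) (rule subspace_span)
  have idU: "g x = x" if "x \<in> U" for x
  proof -
    have "x \<in> span B0" using that spanB0 by simp
    then show ?thesis
    proof (induction x rule: span_induct_alt)
      case base show ?case by (rule g.zero)
    next
      case (step c b y)
      have "g b = b" using step(1) B(1) g(2)[of b] by (auto simp: \<phi>_def)
      then show ?case using step by (simp add: g.add g.scale)
    qed
  qed
  have zV: "g x = 0" if x: "x \<in> V" for x
  proof -
    have "x \<in> span (B0 \<union> (B - B0))" using B(1,4) x by (auto simp: Un_absorb1)
    then obtain u w where uw: "x = u + w" "u \<in> span B0" "w \<in> span (B - B0)" unfolding span_Un by blast
    have "span (B - B0) \<subseteq> V" using B(2) by (intro span_minimal V) auto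
    then have w: "w \<in> V" using uw by blast
    have "u = x - w" using uw by simp
    then have "u \<in> U \<inter> V" using uw(2) spanB0 subspace_diff[OF V x w] by simp
    then have "u = 0" using UV by simp
    then have "x \<in> span (B - B0)" using uw by simp
    then show ?thesis
    proof (induction x rule: span_induct_alt)
      case base show ?case by (rule g.zero)
    next
      case (step c b y)
      have "g b = 0" using step(1) g(2)[of b] by (auto simp: \<phi>_def)
      then show ?case using step by (simp add: g.add g.scale)
    qed
  qed
  show ?thesis
    using rng idU zV by (intro exI[of _ g]) (auto simp: additive_def g.add g.scale)
qed

lemma ex_parity_projections:
  assumes "superspace scale V"
  shows "\<exists>pr. \<forall>p. additive (pr p) \<and> (\<forall>c x. pr p (scale c x) = scale c (pr p x)) \<and> (\<forall>x. pr p x \<in> V p) \<and>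
    (\<forall>x\<in>V p. pr p x = x) \<and> (\<forall>q. q \<noteq> p \<longrightarrow> (\<forall>x\<in>V q. pr p x = 0))"
proof -
  have s: "vector_space scale" "\<And>p. module.subspace scale (V p)" "V 0 \<inter> V 1 = {0}" "V 1 \<inter> V 0 = {0}"
    using assms by (auto simp: superspace_def)
  obtain g0 where g0: "additive g0" "\<forall>c x. g0 (scale c x) = scale c (g0 x)" "range g0 \<subseteq> V 0"
      "\<forall>x\<in>V 0. g0 x = x" "\<forall>x\<in>V 1. g0 x = 0"
    using ex_linear_projection[OF s(1,2,2,3)] by blast
  obtain g1 where g1: "additive g1" "\<forall>c x. g1 (scale c x) = scale c (g1 x)" "range g1 \<subseteq> V 1"
      "\<forall>x\<in>V 1. g1 x = x" "\<forall>x\<in>V 0. g1 x = 0"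
    using ex_linear_projection[OF s(1,2,2,4)] by blast
  show ?thesis
  proof (intro exI[of _ "\<lambda>p. if p = 0 then g0 else g1"] allI)
    fix p :: bit
    have q: "q = 1" if "q \<noteq> 0" for q :: bit using that by (cases q) auto
    show "additive (if p = 0 then g0 else g1) \<and>
      (\<forall>c x. (if p = 0 then g0 else g1) (scale c x) = scale c ((if p = 0 then g0 else g1) x)) \<and>
      (\<forall>x. (if p = 0 then g0 else g1) x \<in> V p) \<and> (\<forall>x\<in>V p. (if p = 0 then g0 else g1) x = x) \<and>
      (\<forall>q. q \<noteq> p \<longrightarrow> (\<forall>x\<in>V q. (if p = 0 then g0 else g1) x = 0))"
    proof (cases "p = 0")
      case True
      have "\<forall>q. q \<noteq> 0 \<longrightarrow> (\<forall>x\<in>V q. g0 x = 0)" using g0(5) q by metis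
      then show ?thesis using True g0 by auto
    next
      case False
      have "\<forall>q. q \<noteq> 1 \<longrightarrow> (\<forall>x\<in>V q. g1 x = 0)" using g1(5) q by metis
      then show ?thesis using q[OF False] g1 by auto
    qed
  qed
qed

lemma polysD: "q \<in> polys S \<Longrightarrow> coeff q k \<in> S"
  by (simp add: polys_def)

text \<open>
  Every operation is composed with the projections of its arguments. This changes nothing on
  the operad and makes the operations additive everywhere, and all axioms survive because the values of the
  given operations lie in the operad again.
\<close>

locale projected_operad = conformal_pseudo_operad scale P d act circ
  for scale :: "'f::field \<Rightarrow> 'v::ab_group_add \<Rightarrow> 'v" and P d act circ +
  fixes pr :: "nat \<Rightarrow> bit \<Rightarrow> 'v \<Rightarrow> 'v"
  assumes pr_add: "\<And>n p. additive (pr n p)"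
    and pr_scale: "\<And>n p c x. pr n p (scale c x) = scale c (pr n p x)"
    and pr_in: "\<And>n p x. pr n p x \<in> P n p"
    and pr_id: "\<And>n p x. x \<in> P n p \<Longrightarrow> pr n p x = x"
    and pr_other: "\<And>n p q x. x \<in> P n q \<Longrightarrow> p \<noteq> q \<Longrightarrow> pr n p x = 0"
begin

definition proj :: "nat \<Rightarrow> 'v \<Rightarrow> 'v" where "proj n x = pr n 0 x + pr n 1 x"

definition d' :: "nat \<Rightarrow> 'v \<Rightarrow> 'v" where "d' n x = d n (proj n x)"

definition act' :: "nat \<Rightarrow> (nat \<Rightarrow> nat) \<Rightarrow> 'v \<Rightarrow> 'v" where
  "act' n \<sigma> x = (if \<sigma> permutes {1..n} then act n \<sigma> (proj n x) else 0)"

definition circ' :: "nat \<Rightarrow> nat \<Rightarrow> nat \<Rightarrow> 'v \<Rightarrow> 'v \<Rightarrow> 'v poly" where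
  "circ' n m i f g = (if i \<in> {1..n} then circ n m i (proj n f) (proj m g) else 0)"

lemma P_zero: "0 \<in> P n p"
  using pr_in[of n p 0] additive.zero[OF pr_add] by simp

lemma P_whole: "x \<in> P n p \<Longrightarrow> x \<in> whole (P n)"
  by (rule wholeI[where p = p]) (rule P_zero)

lemma proj_add: "additive (proj n)"
  unfolding proj_def[abs_def] by (intro additive_add pr_add)

lemma proj_whole: "proj n x \<in> whole (P n)"
  unfolding proj_def whole_def using pr_in by blast

lemma proj_hom: "x \<in> P n p \<Longrightarrow> proj n x = x"
  using pr_id[of x n p] pr_other[of x n p] unfolding proj_def by (cases p) auto

lemma proj_id: "x \<in> whole (P n) \<Longrightarrow> proj n x = x"
  unfolding whole_def using proj_hom additive.add[OF proj_add] by force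

lemma scale_add: "scale c (x + y) = scale c x + scale c y"
proof -
  interpret vector_space scale using superspace[of 0] by (simp add: superspace_def)
  show ?thesis by (rule scale_right_distrib)
qed

lemma proj_scale: "proj n (scale c x) = scale c (proj n x)"
  by (simp add: proj_def pr_scale scale_add)

lemma whole_add: "x \<in> whole (P n) \<Longrightarrow> y \<in> whole (P n) \<Longrightarrow> x + y \<in> whole (P n)"
  by (metis additive.add[OF proj_add] proj_id proj_whole)

lemma whole_diff': "x \<in> whole (P n) \<Longrightarrow> y \<in> whole (P n) \<Longrightarrow> x - y \<in> whole (P n)"
  by (metis additive.diff[OF proj_add] proj_id proj_whole)

lemma whole_zero: "0 \<in> whole (P n)"
  by (rule P_whole[OF P_zero])

lemma endo_whole:
  assumes "even_endo scale (P n) T" "x \<in> whole (P n)"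
  shows "T x \<in> whole (P n)"
proof -
  obtain x0 x1 where x: "x0 \<in> P n 0" "x1 \<in> P n 1" "x = x0 + x1" using assms(2) by (auto simp: whole_def)
  then have "T x = T x0 + T x1" "T x0 \<in> P n 0" "T x1 \<in> P n 1"
    using assms(1) P_whole[OF x(1)] P_whole[OF x(2)] by (auto simp: even_endo_def)
  then show ?thesis unfolding whole_def by blast
qed

lemma endo_add: "even_endo scale (P n) T \<Longrightarrow> x \<in> whole (P n) \<Longrightarrow> y \<in> whole (P n) \<Longrightarrow> T (x + y) = T x + T y"
  by (simp add: even_endo_def)

lemma endo_zero: "even_endo scale (P n) T \<Longrightarrow> T 0 = 0"
  using endo_add[of n T 0 0] whole_zero by simp

lemma endo_scale: "even_endo scale (P n) T \<Longrightarrow> x \<in> whole (P n) \<Longrightarrow> T (scale c x) = scale c (T x)"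
  by (simp add: even_endo_def)

lemma endo_hom: "even_endo scale (P n) T \<Longrightarrow> x \<in> P n p \<Longrightarrow> T x \<in> P n p"
  by (simp add: even_endo_def)

lemma d'_eq: "x \<in> whole (P n) \<Longrightarrow> d' n x = d n x"
  by (simp add: d'_def proj_id)

lemma act'_eq: "\<sigma> permutes {1..n} \<Longrightarrow> x \<in> whole (P n) \<Longrightarrow> act' n \<sigma> x = act n \<sigma> x"
  by (simp add: act'_def proj_id)

lemma circ'_eq: "i \<in> {1..n} \<Longrightarrow> f \<in> whole (P n) \<Longrightarrow> g \<in> whole (P m) \<Longrightarrow> circ' n m i f g = circ n m i f g"
  by (simp add: circ'_def proj_id)

lemma circ_hom:
  "i \<in> {1..n} \<Longrightarrow> f \<in> P n p \<Longrightarrow> g \<in> P m q \<Longrightarrow> circ n m i f g \<in> polys (P (n + m - 1) (p + q))"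
  using circ_bilinear[of i n m] by (simp add: even_bilinear_def)

lemma circ_addl: "i \<in> {1..n} \<Longrightarrow> x \<in> whole (P n) \<Longrightarrow> x' \<in> whole (P n) \<Longrightarrow> y \<in> whole (P m) \<Longrightarrow>
    circ n m i (x + x') y = circ n m i x y + circ n m i x' y"
  using circ_bilinear[of i n m] by (simp add: even_bilinear_def)

lemma circ_addr: "i \<in> {1..n} \<Longrightarrow> x \<in> whole (P n) \<Longrightarrow> y \<in> whole (P m) \<Longrightarrow> y' \<in> whole (P m) \<Longrightarrow>
    circ n m i x (y + y') = circ n m i x y + circ n m i x y'"
  using circ_bilinear[of i n m] by (simp add: even_bilinear_def)

lemma circ_scalel: "i \<in> {1..n} \<Longrightarrow> x \<in> whole (P n) \<Longrightarrow> y \<in> whole (P m) \<Longrightarrow>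
    circ n m i (scale c x) y = map_poly (scale c) (circ n m i x y)"
  using circ_bilinear[of i n m] by (simp add: even_bilinear_def)

lemma circ_scaler: "i \<in> {1..n} \<Longrightarrow> x \<in> whole (P n) \<Longrightarrow> y \<in> whole (P m) \<Longrightarrow>
    circ n m i x (scale c y) = map_poly (scale c) (circ n m i x y)"
  using circ_bilinear[of i n m] by (simp add: even_bilinear_def)

lemma circ_whole:
  assumes i: "i \<in> {1..n}" and f: "f \<in> whole (P n)" and g: "g \<in> whole (P m)"
  shows "circ n m i f g \<in> polys (whole (P (n + m - 1)))"
proof -
  obtain f0 f1 g0 g1 where *: "f0 \<in> P n 0" "f1 \<in> P n 1" "g0 \<in> P m 0" "g1 \<in> P m 1"
    and eq: "f = f0 + f1" "g = g0 + g1" using f g by (auto simp: whole_def)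
  note w = P_whole[OF *(1)] P_whole[OF *(2)] P_whole[OF *(3)] P_whole[OF *(4)]
  have hom: "circ n m i x y \<in> polys (whole (P (n + m - 1)))" if "x \<in> P n p" "y \<in> P m q" for x y p q
    by (rule subsetD[OF polys_mono circ_hom[OF i that]]) (auto intro: P_whole)
  have "circ n m i f g = circ n m i f0 g0 + circ n m i f0 g1 + (circ n m i f1 g0 + circ n m i f1 g1)"
    unfolding eq circ_addl[OF i w(1,2) whole_add[OF w(3,4)]] circ_addr[OF i w(1) w(3,4)]
      circ_addr[OF i w(2) w(3,4)] by (rule refl)
  also have "\<dots> \<in> polys (whole (P (n + m - 1)))"
    by (intro polys_add[OF whole_add] hom[OF *(1,3)] hom[OF *(2,3)] hom[OF *(1,4)] hom[OF *(2,4)])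
  finally show ?thesis .
qed

lemma d'_zero: "d' n 0 = 0"
  unfolding d'_def additive.zero[OF proj_add] by (rule endo_zero[OF d_even])

lemma act'_zero: "act' n \<sigma> 0 = 0"
  unfolding act'_def additive.zero[OF proj_add] using endo_zero[OF act_even] by simp

lemma map_poly_d':
  assumes "q \<in> polys (whole (P n))" shows "map_poly (d' n) q = map_poly (d n) q"
  by (rule map_poly_cong_on[where f = "d' n" and g = "d n", OF assms d'_eq d'_zero endo_zero[OF d_even]])

lemma map_poly_act':
  assumes q: "q \<in> polys (whole (P n))" and s: "\<sigma> permutes {1..n}"
  shows "map_poly (act' n \<sigma>) q = map_poly (act n \<sigma>) q"
  by (rule map_poly_cong_on[where f = "act' n \<sigma>" and g = "act n \<sigma>",
        OF q act'_eq[OF s] act'_zero endo_zero[OF act_even[OF s]]])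

lemma act_whole: "\<sigma> permutes {1..n} \<Longrightarrow> x \<in> whole (P n) \<Longrightarrow> act n \<sigma> x \<in> whole (P n)"
  by (rule endo_whole[OF act_even])

lemma d_whole: "x \<in> whole (P n) \<Longrightarrow> d n x \<in> whole (P n)"
  by (rule endo_whole[OF d_even])

lemma total: "total_operad scale P d' act' circ' pr"
proof (rule total_operad.intro)
  show "superspace scale (P n)" for n by (rule superspace)
  show "additive (pr n p)" for n p by (rule pr_add)
  show "pr n p (scale c x) = scale c (pr n p x)" for n p c x by (rule pr_scale)
  show "pr n p x \<in> P n p" for n p x by (rule pr_in)
  show "pr n p x = x" if "x \<in> P n p" for n p x by (rule pr_id[OF that])
  show "pr n p x = 0" if "x \<in> P n q" "p \<noteq> q" for n p q x by (rule pr_other[OF that])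
  show "additive (d' n)" for n
    by (simp add: additive_def d'_def additive.add[OF proj_add] endo_add[OF d_even proj_whole proj_whole])
  show "d' n (scale c x) = scale c (d' n x)" for n c x
    by (simp add: d'_def proj_scale endo_scale[OF d_even proj_whole])
  show "d' n x \<in> P n p" if "x \<in> P n p" for n p x
    using d'_eq[OF P_whole[OF that]] endo_hom[OF d_even that] by simp
  show "additive (act' n \<sigma>)" for n \<sigma>
    by (simp add: additive_def act'_def additive.add[OF proj_add] endo_add[OF act_even proj_whole proj_whole])
  have sc0: "scale c 0 = 0" for c using scale_add[of c 0 0] by simp
  show "act' n \<sigma> (scale c x) = scale c (act' n \<sigma> x)" for n \<sigma> c x
    by (simp add: act'_def proj_scale endo_scale[OF act_even proj_whole] sc0)
  show "act' n \<sigma> x \<in> P n p" if "\<sigma> permutes {1..n}" "x \<in> P n p" for n \<sigma> p x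
    using act'_eq[OF that(1) P_whole[OF that(2)]] endo_hom[OF act_even[OF that(1)] that(2)] by simp
  show "act' n (\<sigma> \<circ> \<tau>) f = act' n \<tau> (act' n \<sigma> f)" if "\<sigma> permutes {1..n}" "\<tau> permutes {1..n}" for n \<sigma> \<tau> f
    using that permutes_compose[OF that(2,1)] act_whole[OF that(1) proj_whole]
    by (simp add: act'_def proj_id act_comp[OF that proj_whole])
  show "act' n \<sigma> (d' n f) = d' n (act' n \<sigma> f)" if "\<sigma> permutes {1..n}" for n \<sigma> f
    using that by (simp add: act'_def d'_def proj_id d_whole act_whole proj_whole act_d)
  show "additive (\<lambda>f. circ' n m i f g)" for n m i g
    by (cases "i \<in> {1..n}")
      (simp_all only: additive_def circ'_def additive.add[OF proj_add] circ_addl[OF _ proj_whole proj_whole proj_whole]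
        if_True if_False add_0 simp_thms)
  show "additive (circ' n m i f)" for n m i f
    by (cases "i \<in> {1..n}")
      (simp_all only: additive_def circ'_def additive.add[OF proj_add] circ_addr[OF _ proj_whole proj_whole proj_whole]
        if_True if_False add_0 simp_thms)
  show "circ' n m i (scale c f) g = map_poly (scale c) (circ' n m i f g)" for n m i c f g
    by (cases "i \<in> {1..n}")
      (simp_all only: circ'_def proj_scale circ_scalel[OF _ proj_whole proj_whole] if_True if_False simp_thms map_poly_0)
  show "circ' n m i f (scale c g) = map_poly (scale c) (circ' n m i f g)" for n m i c f g
    by (cases "i \<in> {1..n}")
      (simp_all only: circ'_def proj_scale circ_scaler[OF _ proj_whole proj_whole] if_True if_False simp_thms map_poly_0)
  show "circ' n m i f g \<in> polys (P (n + m - 1) (p + q))"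
    if "i \<in> {1..n}" "f \<in> P n p" "g \<in> P m q" for n m i p q f g
    using circ'_eq[OF that(1) P_whole[OF that(2)] P_whole[OF that(3)]] circ_hom[OF that] by simp
  show "circ' n m i (d' n f) g = pCons 0 (circ' n m i f g) + map_poly (d' (n + m - 1)) (circ' n m i f g)"
    if i: "i \<in> {1..n}" for n m i f g
  proof -
    note w = proj_whole[of n f] proj_whole[of m g]
    show ?thesis
      using i map_poly_d'[OF circ_whole[OF i w]] sesqui_left[OF i w]
      by (simp add: circ'_def d'_def[of n] proj_id[OF d_whole[OF w(1)]])
  qed
  show "circ' n m i f (d' m g) = - pCons 0 (circ' n m i f g)" if i: "i \<in> {1..n}" for n m i f g
  proof -
    note w = proj_whole[of n f] proj_whole[of m g]
    show ?thesis
      using i sesqui_right[OF i w] by (simp add: circ'_def d'_def[of m] proj_id[OF d_whole[OF w(2)]])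
  qed
  have inner: "circ' n m j c h = circ n m j c (proj m h)" if "j \<in> {1..n}" "c \<in> whole (P n)" for n m j c h
    using that by (simp add: circ'_def proj_id)
  have inner': "circ' n m j f c = circ n m j (proj n f) c" if "j \<in> {1..n}" "c \<in> whole (P m)" for n m j c f
    using that by (simp add: circ'_def proj_id)
  show "psubst mlam (\<lambda>c. var_to mmu (circ' (n + m - 1) l j c h)) (circ' n m i f g) =
        koszul q r (psubst mmu (\<lambda>c. var_to mlam (circ' (n + l - 1) m (l + i - 1) c g)) (circ' n l j f h))"
    if i: "i \<in> {1..n}" and j: "1 \<le> j" "j < i" and g: "g \<in> P m q" and h: "h \<in> P l r" for n m l i j f g h q r
  proof -
    note w = proj_whole[of n f] P_whole[OF g] P_whole[OF h]
    have jj: "j \<in> {1..n + m - 1}" "j \<in> {1..n}" "l + i - 1 \<in> {1..n + l - 1}" using i j by auto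
    have "psubst mlam (\<lambda>c. var_to mmu (circ' (n + m - 1) l j c h)) (circ' n m i f g) =
        psubst mlam (\<lambda>c. var_to mmu (circ (n + m - 1) l j c h)) (circ n m i (proj n f) g)"
      unfolding inner'[OF i w(2)]
      by (rule psubst_cong)
        (simp only: inner[OF jj(1) polysD[OF circ_whole[OF i w(1,2)]]] proj_hom[OF h])
    moreover have "psubst mmu (\<lambda>c. var_to mlam (circ' (n + l - 1) m (l + i - 1) c g)) (circ' n l j f h) =
        psubst mmu (\<lambda>c. var_to mlam (circ (n + l - 1) m (l + i - 1) c g)) (circ n l j (proj n f) h)"
      unfolding inner'[OF jj(2) w(3)]
      by (rule psubst_cong)
        (simp only: inner[OF jj(3) polysD[OF circ_whole[OF jj(2) w(1,3)]]] proj_hom[OF g])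
    ultimately show ?thesis using assoc_parallel[OF i j w(1) g h] by simp
  qed
  show "psubst mlam (\<lambda>c. var_to mmu (circ' (n + m - 1) l j c h)) (circ' n m i f g) =
        psubst mmu (\<lambda>c. var_to mlammu (circ' n (m + l - 1) i f c)) (circ' m l (j - i + 1) g h)"
    if i: "i \<in> {1..n}" and j: "i \<le> j" "j < i + m" for n m l i j f g h
  proof -
    note w = proj_whole[of n f] proj_whole[of m g] proj_whole[of l h]
    have jj: "j \<in> {1..n + m - 1}" "j - i + 1 \<in> {1..m}" using i j by auto
    have "psubst mlam (\<lambda>c. var_to mmu (circ' (n + m - 1) l j c h)) (circ' n m i f g) =
        psubst mlam (\<lambda>c. var_to mmu (circ (n + m - 1) l j c (proj l h))) (circ n m i (proj n f) (proj m g))"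
      unfolding circ'_def[of n m i] using i
      by (simp only: if_True)
        (rule psubst_cong, simp only: inner[OF jj(1) polysD[OF circ_whole[OF i w(1,2)]]])
    moreover have "psubst mmu (\<lambda>c. var_to mlammu (circ' n (m + l - 1) i f c)) (circ' m l (j - i + 1) g h) =
        psubst mmu (\<lambda>c. var_to mlammu (circ n (m + l - 1) i (proj n f) c)) (circ m l (j - i + 1) (proj m g) (proj l h))"
      unfolding circ'_def[of m l "j - i + 1"] using jj(2)
      by (simp only: if_True)
        (rule psubst_cong, simp only: inner'[OF i polysD[OF circ_whole[OF jj(2) w(2,3)]]])
    ultimately show ?thesis using assoc_nested[OF i j w] by simp
  qed
  show "circ' n m i (act' n \<sigma> f) (act' m \<tau> g) =
        map_poly (act' (n + m - 1) (perm_circ n m i \<sigma> \<tau>)) (circ' n m (\<sigma> i) f g)"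
    if i: "i \<in> {1..n}" and s: "\<sigma> permutes {1..n}" and t: "\<tau> permutes {1..m}"
      and pc: "perm_circ n m i \<sigma> \<tau> permutes {1..n + m - 1}" for n m i f g \<sigma> \<tau>
  proof -
    note w = proj_whole[of n f] proj_whole[of m g]
    have si: "\<sigma> i \<in> {1..n}" using i permutes_in_image[OF s] by simp
    have l: "circ' n m i (act' n \<sigma> f) (act' m \<tau> g) = circ n m i (act n \<sigma> (proj n f)) (act m \<tau> (proj m g))"
      using i s t by (simp add: circ'_def act'_def proj_id act_whole w)
    have r: "circ' n m (\<sigma> i) f g = circ n m (\<sigma> i) (proj n f) (proj m g)" using si by (simp add: circ'_def)
    show ?thesis
      unfolding l r map_poly_act'[OF circ_whole[OF si w] pc] by (rule equivariance[OF i s t w])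
  qed
  have id': "proj n (act' n id f) = proj n f" for n f
    by (simp add: act'_def permutes_id act_id proj_whole proj_id)
  show "circ' n m i (act' n id f) g = circ' n m i f g" for n m i f g by (simp add: circ'_def id')
  show "circ' n m i f (act' m id g) = circ' n m i f g" for n m i f g by (simp add: circ'_def id')
qed

sublocale T: total_operad scale P d' act' circ' pr
  by (rule total)

lemma W_eq: "W P act' n = W P act n"
  unfolding W_def by (auto simp: act'_eq)

lemma subst_neg_d':
  assumes "q \<in> polys (whole (P n))" shows "subst_neg (d n) q = subst_neg (d' n) q"
  by (rule subst_neg_cong_on[where d = "d n" and d' = "d' n",
        OF assms _ whole_zero endo_zero[OF d_even] whole_diff']) (simp add: d'_eq d_whole)

lemma box_eq:
  assumes f: "f \<in> whole (P (ar n))" and g: "g \<in> whole (P (ar m))"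
  shows "box d act circ n m f g = box d' act' circ' n m f g"
proof (cases "n < 0 \<or> m < -1")
  case True
  then show ?thesis by (auto simp: box_def shuffle_perms_def)
next
  case False
  then have 1: "1 \<in> {1..ar n}" and N: "ar n + ar m - 1 = ar (n + m)" and N': "nat (m + 1 + n) = ar (n + m)"
    by (auto simp: ar_def add_ac)
  let ?S = "whole (P (ar (n + m)))" and ?q = "circ (ar n) (ar m) 1 f g"
  have q: "?q \<in> polys ?S" using circ_whole[OF 1 f g] by (simp only: N)
  note sn = subst_neg_d'[OF q]
  have mem: "subst_neg (d (ar (n + m))) ?q \<in> polys ?S"
    by (rule coeff_subst_neg_mem[where d = "d (ar (n + m))", OF d_whole whole_zero endo_zero[OF d_even] whole_diff' q])
  show ?thesis
    unfolding box_def
  proof (rule sum.cong[OF refl])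
    fix \<sigma> assume "\<sigma> \<in> shuffle_perms (m + 1) n"
    then have "\<sigma> permutes {1..ar (n + m)}" unfolding shuffle_perms_def N' by (simp split: if_splits)
    then have p: "inv \<sigma> permutes {1..ar (n + m)}" by (rule permutes_inv)
    show "map_poly (act (ar (n + m)) (inv \<sigma>)) (subst_neg (d (ar (n + m))) (circ (ar n) (ar m) 1 f g)) =
        map_poly (act' (ar (n + m)) (inv \<sigma>)) (subst_neg (d' (ar (n + m))) (circ' (ar n) (ar m) 1 f g))"
      unfolding circ'_eq[OF 1 f g] sn[symmetric] by (rule map_poly_act'[OF mem p, symmetric])
  qed
qed

lemma associator_eq:
  assumes f: "f \<in> whole (P (ar n))" and g: "g \<in> whole (P (ar m))" and h: "h \<in> whole (P (ar l))"
  shows "associator d act circ n m l f g h = associator d' act' circ' n m l f g h"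
proof -
  have b: "box d' act' circ' n m f g \<in> polys (whole (P (ar (n + m))))"
    "box d' act' circ' m l g h \<in> polys (whole (P (ar (m + l))))"
    by (rule T.box_whole[OF f g], rule T.box_whole[OF g h])
  have "psubst mlam (\<lambda>c. var_to mlammu (box d act circ (n + m) l c h)) (box d act circ n m f g) =
      psubst mlam (\<lambda>c. var_to mlammu (box d' act' circ' (n + m) l c h)) (box d' act' circ' n m f g)"
    unfolding box_eq[OF f g]
    by (rule psubst_cong) (simp only: box_eq[OF polysD[OF b(1)] h])
  moreover have "psubst mmu (\<lambda>c. var_to mlam (box d act circ n (m + l) f c)) (box d act circ m l g h) =
      psubst mmu (\<lambda>c. var_to mlam (box d' act' circ' n (m + l) f c)) (box d' act' circ' m l g h)"
    unfolding box_eq[OF g h]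
    by (rule psubst_cong) (simp only: box_eq[OF f polysD[OF b(2)]])
  ultimately show ?thesis unfolding associator_def by simp
qed

end

section \<open>Back to the given operations\<close>

lemma psubst_in:
  assumes q: "q \<in> polys S" and F: "\<And>c. c \<in> S \<Longrightarrow> F c \<in> M" and A: "\<And>x. x \<in> M \<Longrightarrow> A x \<in> M"
    and M: "0 \<in> M" "\<And>x y. x \<in> M \<Longrightarrow> y \<in> M \<Longrightarrow> x + y \<in> M"
  shows "psubst A F q \<in> M"
proof -
  have pow: "(A ^^ k) x \<in> M" if "x \<in> M" for k x by (induction k) (use that A in auto)
  have "(\<Sum>k\<in>K. (A ^^ k) (F (coeff q k))) \<in> M" if "finite K" for K
    using that by induction (auto intro!: M pow F polysD[OF q])
  then show ?thesis by (simp add: psubst_def)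
qed

context projected_operad
begin

lemma polys_polys_add:
  "x \<in> polys (polys (whole (P n))) \<Longrightarrow> y \<in> polys (polys (whole (P n))) \<Longrightarrow> x + y \<in> polys (polys (whole (P n)))"
  by (intro polys_add whole_add)

lemma polys_polys_diff:
  "x \<in> polys (polys (whole (P n))) \<Longrightarrow> y \<in> polys (polys (whole (P n))) \<Longrightarrow> x - y \<in> polys (polys (whole (P n)))"
  by (intro polys_diff whole_diff')

lemma polys_polys_zero: "0 \<in> polys (polys (whole (P n)))"
  by (simp add: polys_def whole_zero)

lemma polys_polys_const: "c \<in> whole (P n) \<Longrightarrow> [:[:c:]:] \<in> polys (polys (whole (P n)))"
  by (auto simp: polys_def whole_zero coeff_pCons split: nat.splits)

lemma mlam_in: "x \<in> polys (polys (whole (P n))) \<Longrightarrow> mlam x \<in> polys (polys (whole (P n)))"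
  by (auto simp: polys_def mlam_def whole_zero coeff_pCons split: nat.splits)

lemma mmu_in: "x \<in> polys (polys (whole (P n))) \<Longrightarrow> mmu x \<in> polys (polys (whole (P n)))"
  by (auto simp: polys_def mmu_def whole_zero coeff_map_poly coeff_pCons split: nat.splits)

lemma mlammu_in: "x \<in> polys (polys (whole (P n))) \<Longrightarrow> mlammu x \<in> polys (polys (whole (P n)))"
  unfolding mlammu_def by (intro polys_polys_add mlam_in mmu_in)

lemma mneg_in:
  assumes "x \<in> polys (polys (whole (P n)))"
  shows "mneg (d n) x = mneg (d' n) x \<and> mneg (d n) x \<in> polys (polys (whole (P n)))"
proof -
  have "map_poly (map_poly (d n)) x = map_poly (map_poly (d' n)) x"
    using assms by (intro poly_eqI)
      (simp add: coeff_map_poly polys_def endo_zero[OF d_even] d'_zero d'_eq)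
  moreover have "map_poly (map_poly (d n)) x \<in> polys (polys (whole (P n)))"
    using assms by (simp add: polys_def coeff_map_poly endo_zero[OF d_even] d_whole)
  then have "0 - mlam x - mmu x - map_poly (map_poly (d n)) x \<in> polys (polys (whole (P n)))"
    by (intro polys_polys_diff polys_polys_zero mlam_in mmu_in assms)
  ultimately show ?thesis by (simp add: mneg_def)
qed

lemma var_to_in:
  assumes "q \<in> polys (whole (P n))"
    "\<And>x. x \<in> polys (polys (whole (P n))) \<Longrightarrow> A x \<in> polys (polys (whole (P n)))"
  shows "var_to A q \<in> polys (polys (whole (P n)))"
  unfolding var_to_def
  by (rule psubst_in[OF assms(1) polys_polys_const assms(2) polys_polys_zero polys_polys_add])

lemma associator_in:
  assumes f: "f \<in> whole (P (ar n))" and g: "g \<in> whole (P (ar m))" and h: "h \<in> whole (P (ar l))"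
  shows "associator d' act' circ' n m l f g h \<in> polys (polys (whole (P (ar (n + m + l)))))"
  unfolding associator_def
proof (intro polys_polys_diff)
  show "psubst mlam (\<lambda>c. var_to mlammu (box d' act' circ' (n + m) l c h)) (box d' act' circ' n m f g)
      \<in> polys (polys (whole (P (ar (n + m + l)))))"
    by (rule psubst_in[OF T.box_whole[OF f g] var_to_in[OF T.box_whole[OF _ h] mlammu_in] mlam_in
          polys_polys_zero polys_polys_add])
  have deg: "n + m + l = n + (m + l)" by simp
  show "psubst mmu (\<lambda>c. var_to mlam (box d' act' circ' n (m + l) f c)) (box d' act' circ' m l g h)
      \<in> polys (polys (whole (P (ar (n + m + l)))))"
    unfolding deg
    by (rule psubst_in[OF T.box_whole[OF g h] var_to_in[OF T.box_whole[OF f] mlam_in] mmu_in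
          polys_polys_zero polys_polys_add])
qed

lemma associator_symmetric:
  assumes nml: "n \<ge> -1" "m \<ge> -1" "l \<ge> -1"
    and f: "f \<in> W P act n" and g: "g \<in> P (ar m) q" and h: "h \<in> P (ar l) r"
  shows "associator d act circ n m l f g h =
    koszul q r (psubst mlam (var_to (mneg (d (ar (n + m + l))))) (associator d act circ n l m f h g))"
proof -
  let ?n = "ar (n + m + l)"
  have f': "f \<in> W P act' n" using f by (simp only: W_eq)
  note w = T.W_whole[OF f'] P_whole[OF g] P_whole[OF h]
  have deg: "n + m + l = n + l + m" by simp
  have X: "associator d' act' circ' n l m f h g \<in> polys (polys (whole (P ?n)))"
    unfolding deg by (rule associator_in[OF w(1,3,2)])
  have "psubst mlam (var_to (mneg (d ?n))) (associator d' act' circ' n l m f h g) =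
      psubst mlam (var_to (mneg (d' ?n))) (associator d' act' circ' n l m f h g)"
  proof (rule psubst_cong)
    fix k
    show "var_to (mneg (d ?n)) (coeff (associator d' act' circ' n l m f h g) k) =
        var_to (mneg (d' ?n)) (coeff (associator d' act' circ' n l m f h g) k)"
      unfolding var_to_def
      by (rule psubst_cong_on[OF polysD[OF X] _ mneg_in]) (simp_all add: polys_polys_const)
  qed
  then show ?thesis
    unfolding associator_eq[OF w] associator_eq[OF w(1,3,2)]
    using T.associator_symmetric[OF nml f' g h] by simp
qed

lemma box_properties:
  assumes f: "f \<in> whole (P (ar n))" and g: "g \<in> whole (P (ar m))"
  shows "box d act circ n m f g \<in> polys (whole (P (ar (n + m))))"
    and "box d act circ n m (d (ar n) f) g = - pCons 0 (box d act circ n m f g)"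
    and "box d act circ n m f (d (ar m) g) =
      pCons 0 (box d act circ n m f g) + map_poly (d (ar (n + m))) (box d act circ n m f g)"
proof -
  show 1: "box d act circ n m f g \<in> polys (whole (P (ar (n + m))))"
    unfolding box_eq[OF f g] by (rule T.box_whole[OF f g])
  show "box d act circ n m (d (ar n) f) g = - pCons 0 (box d act circ n m f g)"
    using T.box_d_left[of n m f g] by (simp add: box_eq f g d_whole d'_eq)
  show "box d act circ n m f (d (ar m) g) =
      pCons 0 (box d act circ n m f g) + map_poly (d (ar (n + m))) (box d act circ n m f g)"
    using T.box_d_right[of n m f g] map_poly_d'[OF 1] by (simp add: box_eq f g d_whole d'_eq)
qed

lemma box_invariant:
  assumes "n \<ge> -1" "m \<ge> -1" and f: "f \<in> W P act n" and g: "g \<in> W P act m"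
  shows "box d act circ n m f g \<in> polys (W P act (n + m))"
proof -
  have fg: "f \<in> W P act' n" "g \<in> W P act' m" using f g by (simp_all only: W_eq)
  show ?thesis
    using T.box_W[OF assms(1,2) fg] unfolding box_eq[OF T.W_whole[OF fg(1)] T.W_whole[OF fg(2)]] W_eq .
qed

lemma Wsum_eq: "Wsum P act' = Wsum P act"
  by (simp add: Wsum_def[abs_def] W_eq)

lemma Wcomp_eq: "Wcomp P act' = Wcomp P act"
  by (simp add: Wcomp_def[abs_def] W_eq)

lemma bracket_graded_lie:
  "graded_lie_conformal_superalgebra (scale_sum scale) (Wsum P act) (d_sum d) T.bracket (Wcomp P act)"
  using T.graded_lie[of d] d'_eq unfolding Wsum_eq Wcomp_eq by simp

lemma bracket_single:
  assumes f: "f \<in> P (ar n) p" and g: "g \<in> P (ar m) q"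
  shows "T.bracket (Poly_Mapping.single n f) (Poly_Mapping.single m g) =
    map_poly (Poly_Mapping.single (n + m)) (box d act circ n m f g -
      koszul p q (subst_neg (d (ar (n + m))) (box d act circ m n g f)))"
proof -
  have "box d act circ m n g f \<in> polys (whole (P (ar (n + m))))"
    using box_properties(1)[OF P_whole[OF g] P_whole[OF f]] by (simp only: add.commute)
  from subst_neg_d'[OF this] show ?thesis
    unfolding T.bracket_hom[OF f g] T.brs_def box_eq[OF P_whole[OF f] P_whole[OF g]]
      box_eq[OF P_whole[OF g] P_whole[OF f]] by simp
qed

end

theorem theorem3p5:
  fixes scale :: "'f::field_char_0 \<Rightarrow> 'v::ab_group_add \<Rightarrow> 'v"
    and P :: "nat \<Rightarrow> bit \<Rightarrow> 'v set"
    and d :: "nat \<Rightarrow> 'v \<Rightarrow> 'v"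
    and act :: "nat \<Rightarrow> (nat \<Rightarrow> nat) \<Rightarrow> 'v \<Rightarrow> 'v"
    and circ :: "nat \<Rightarrow> nat \<Rightarrow> nat \<Rightarrow> 'v \<Rightarrow> 'v \<Rightarrow> 'v poly"
  assumes "conformal_pseudo_operad scale P d act circ"
  shows
    "(\<forall>n\<ge>-1. \<forall>m\<ge>-1. \<forall>f \<in> whole (P (ar n)). \<forall>g \<in> whole (P (ar m)).
        box d act circ n m f g \<in> polys (whole (P (ar (n + m)))) \<and>
        box d act circ n m (d (ar n) f) g = - pCons 0 (box d act circ n m f g) \<and>
        box d act circ n m f (d (ar m) g) =
          pCons 0 (box d act circ n m f g) + map_poly (d (ar (n + m))) (box d act circ n m f g)) \<and>
     (\<forall>n\<ge>-1. \<forall>m\<ge>-1. \<forall>l\<ge>-1. \<forall>q r. \<forall>f \<in> W P act n. \<forall>g \<in> P (ar m) q. \<forall>h \<in> P (ar l) r.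
        associator d act circ n m l f g h =
        koszul q r (psubst mlam (var_to (mneg (d (ar (n + m + l))))) (associator d act circ n l m f h g))) \<and>
     (\<forall>n\<ge>-1. \<forall>m\<ge>-1. \<forall>f \<in> W P act n. \<forall>g \<in> W P act m.
        box d act circ n m f g \<in> polys (W P act (n + m))) \<and>
     (\<exists>br. graded_lie_conformal_superalgebra (scale_sum scale) (Wsum P act) (d_sum d) br (Wcomp P act) \<and>
        (\<forall>n\<ge>-1. \<forall>m\<ge>-1. \<forall>p q. \<forall>f \<in> W P act n \<inter> P (ar n) p. \<forall>g \<in> W P act m \<inter> P (ar m) q.
           br (Poly_Mapping.single n f) (Poly_Mapping.single m g) =
           map_poly (Poly_Mapping.single (n + m))
             (box d act circ n m f g
              - koszul p q (subst_neg (d (ar (n + m))) (box d act circ m n g f)))))"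
proof -
  interpret conformal_pseudo_operad scale P d act circ by (rule assms)
  obtain pr where pr: "\<And>n p. additive (pr n p) \<and> (\<forall>c x. pr n p (scale c x) = scale c (pr n p x)) \<and>
      (\<forall>x. pr n p x \<in> P n p) \<and> (\<forall>x\<in>P n p. pr n p x = x) \<and>
      (\<forall>q. q \<noteq> p \<longrightarrow> (\<forall>x\<in>P n q. pr n p x = 0))"
    using ex_parity_projections[OF superspace] by metis
  have "projected_operad scale P d act circ pr"
  proof (rule projected_operad.intro[OF assms], rule projected_operad_axioms.intro)
    show "pr n p x = 0" if "x \<in> P n q" "p \<noteq> q" for n p q x using pr[of n p] that by auto
  qed (use pr in blast)+
  then interpret projected_operad scale P d act circ pr .
  show ?thesis
    by (intro conjI allI impI ballI exI[of _ T.bracket] box_properties associator_symmetric box_invariant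
        bracket_graded_lie bracket_single; (assumption | erule IntD2))
qed

end
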